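(* Let $f:\mathbb{R}\times\mathbb{R}\to\mathbb{R}$ satisfy the KPP assumptions (a)-(c) of the context, and let $[c_*,c^*]$ and $[\tilde c_*,\tilde c^*]$ be the spreading speed interval and the generalized spreading speed interval (defined in the context) of $$\dot u_i(t)=u_{i+1}(t)-2u_i(t)+u_{i-1}(t)+u_i(t)f(t,u_i(t)),\qquad i\in\mathbb{Z}.\qquad (L)$$ Then: (1) $$c_0^-:=\inf_{\mu>0}\frac{e^{-\mu}+e^{\mu}-2+\bar f^+_{\inf}}{\mu}\ \le\ c_*\ \le\ c^*\ \le\ c_0^+:=\inf_{\mu>0}\frac{e^{-\mu}+e^{\mu}-2+\bar f^+_{\sup}}{\mu}.$$ (2) $$\tilde c_0^-:=\inf_{\mu>0}\frac{e^{-\mu}+e^{\mu}-2+\bar f_{\inf}}{\mu}\ \le\ \tilde c_*\ \le\ \tilde c^*\ \le\ \tilde c_0^+:=\inf_{\mu>0}\frac{e^{-\mu}+e^{\mu}-2+\bar f_{\sup}}{\mu}.$$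
   Context: KPP assumptions on $f:\mathbb{R}\times\mathbb{R}\to\mathbb{R}$, $(t,u)\mapsto f(t,u)$: (a) $f(t,u)$ is locally Hölder continuous in $t\in\mathbb{R}$, Lipschitz continuous in $u\in\mathbb{R}$, and continuously differentiable in $u$ for $u\ge 0$. (b) For each $u\in\mathbb{R}$, $f(\cdot,u)\in L^\infty(\mathbb{R})$; there is $M_0>0$ with $f(t,u)<0$ for all $t$ and all $u\ge M_0$; $f_u(t,u)<0$ for $u\ge 0$; and $\liminf_{t-s\to\infty}\frac{1}{t-s}\int_s^t f(\tau,0)\,d\tau>0$. (c) There are $0<\tilde m_0<\tilde M_0$ such that $f(t,0)-\tilde M_0u\le f(t,u)\le f(t,0)-\tilde m_0u$ for all $t\in\mathbb{R}$, $u\ge 0$. $l^\infty(\mathbb{Z})$ is the space of bounded real sequences indexed by $\mathbb{Z}$ with the sup norm. For $u^0\in l^\infty(\mathbb{Z})$ with nonnegative entries and $s\in\mathbb{R}$, $u(t;s,u^0)=\{u_i(t;s,u^0)\}_{i\in\mathbb{Z}}$, $t\ge s$, is the unique solution of (L) with $u(s;s,u^0)=u^0$. Under (a)-(c), (L) has a unique spatially homogeneous solution $u_i(t)=u^+(t)$ ($i\in\mathbb{Z}$) defined for all $t\in\mathbb{R}$ with $\inf_{t\in\mathbb{R}}u^+(t)>0$; $u^+$ denotes this function. $l_0^\infty(\mathbb{Z})$ is the set of $u\in l^\infty(\mathbb{Z})$ with $u_i\ge0$ for all $i$, $u_i=0$ for all sufficiently large $|i|$, and $u\ne 0$. Notation: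 $\limsup_{|i|\ge ct,\,t\to\infty}$ means $\limsup_{t\to\infty}\sup_{i\in\mathbb{Z},|i|\ge ct}$, and $\limsup_{|i|\le ct,\,t\to\infty}$ means $\limsup_{t\to\infty}\sup_{i\in\mathbb{Z},|i|\le ct}$. Spreading speed interval $[c_*,c^*]$: $c^*=\inf\{c:\limsup_{|i|\ge ct,t\to\infty}u_i(t;0,u^0)=0\ \text{for all } u^0\in l^\infty_0(\mathbb{Z})\}$, $c_*=\sup\{c:\limsup_{|i|\le ct,t\to\infty}|u_i(t;0,u^0)-u^+(t)|=0\ \text{for all } u^0\in l^\infty_0(\mathbb{Z})\}$. Generalized spreading speed interval $[\tilde c_*,\tilde c^*]$: $\tilde c^*=\inf\{c:\limsup_{|i|\ge ct,t\to\infty}u_i(t+s;s,u^0)=0\ \text{uniformly in } s\in\mathbb{R},\ \text{for all } u^0\in l^\infty_0(\mathbb{Z})\}$, $\tilde c_*=\sup\{c:\limsup_{|i|\le ct,t\to\infty}|u_i(t+s;s,u^0)-u^+(t+s)|=0\ \text{uniformly in } s\in\mathbb{R},\ \text{for all } u^0\in l^\infty_0(\mathbb{Z})\}$. Averages: $\bar f_{\inf}=\liminf_{t\ge s,\,t-s\to\infty}\frac1{t-s}\int_s^tf(\tau,0)d\tau$, $\bar f_{\sup}=\limsup_{t\ge s,\,t-s\to\infty}\frac1{t-s}\int_s^tf(\tau,0)d\tau$, $\bar f^+_{\inf}=\liminf_{t\ge s\ge0,\,t-s\to\infty}\frac1{t-s}\int_s^tf(\tau,0)d\tau$, $\bar f^+_{\sup}=\limsup_{t\ge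 s\ge 0,\,t-s\to\infty}\frac1{t-s}\int_s^tf(\tau,0)d\tau$. Here $\liminf_{t-s\to\infty}F(s,t)=\lim_{r\to\infty}\inf_{t-s\ge r}F(s,t)$ over all admissible $s,t$ (both varying), and similarly for $\limsup$.
   Formalization: The condition f_u(t,u)<0 for u≥0 is taken uniformly in t for each fixed u, i.e. sup_t f_u(t,u)<0; with mere pointwise negativity the entire solution u^+ need not be unique, so c_* would be ill-defined. *)

theory Defs
  imports "HOL-Analysis.Analysis"
begin

definition mean_value :: "(real \<Rightarrow> real \<Rightarrow> real) \<Rightarrow> real \<Rightarrow> real \<Rightarrow> real" where
  "mean_value f s t = 1 / (t - s) * integral {s..t} (\<lambda>\<tau>. f \<tau> 0)"

(* Filters on pairs (s, t): t - s tends to infinity, with s and t both varying;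
   in the second one the pairs are restricted to s >= 0. *)

definition gap_filter :: "(real \<times> real) filter" where
  "gap_filter = filtercomap (\<lambda>(s, t). t - s) at_top"

definition gap_filter_pos :: "(real \<times> real) filter" where
  "gap_filter_pos = inf gap_filter (principal {(s, t). 0 \<le> s})"

definition f_inf :: "(real \<Rightarrow> real \<Rightarrow> real) \<Rightarrow> ereal" where
  "f_inf f = Liminf gap_filter (\<lambda>(s, t). ereal (mean_value f s t))"

definition f_sup :: "(real \<Rightarrow> real \<Rightarrow> real) \<Rightarrow> ereal" where
  "f_sup f = Limsup gap_filter (\<lambda>(s, t). ereal (mean_value f s t))"

definition f_inf_pos :: "(real \<Rightarrow> real \<Rightarrow> real) \<Rightarrow> ereal" where
  "f_inf_pos f = Liminf gap_filter_pos (\<lambda>(s, t). ereal (mean_value f s t))"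

definition f_sup_pos :: "(real \<Rightarrow> real \<Rightarrow> real) \<Rightarrow> ereal" where
  "f_sup_pos f = Limsup gap_filter_pos (\<lambda>(s, t). ereal (mean_value f s t))"

(* Local Hoelder continuity in t is imposed for each fixed u. The Lipschitz constant
   in u is global in u and uniform for t in compact intervals. *)

definition KPP_a :: "(real \<Rightarrow> real \<Rightarrow> real) \<Rightarrow> (real \<Rightarrow> real \<Rightarrow> real) \<Rightarrow> bool" where
  "KPP_a f fu \<longleftrightarrow>
     (\<forall>u a b. \<exists>C \<alpha>. 0 < \<alpha> \<and> \<alpha> \<le> 1 \<and>
        (\<forall>s\<in>{a..b}. \<forall>t\<in>{a..b}. \<bar>f t u - f s u\<bar> \<le> C * \<bar>t - s\<bar> powr \<alpha>)) \<and>
     (\<forall>a b. \<exists>L. \<forall>t\<in>{a..b}. L-lipschitz_on UNIV (f t)) \<and>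
     (\<forall>t. \<forall>u\<ge>0. (f t has_real_derivative fu t u) (at u within {0..})) \<and>
     (\<forall>t. continuous_on {0..} (fu t))"

(* As f is continuous in t, membership of f(.,u) in L^infinity is plain boundedness.

   Negativity of f_u is uniform in t for each fixed u: sup_t f_u(t,u) < 0 for u >= 0.
   With mere negativity at each (t,u) the entire solution u^+ is not unique and c_* may
   degenerate. Example: f(t,u) = g(u) - e^(-|t|) u for u >= 0, with g(u) equal to
   (1-u)^2 on [0,1], 0 on [1,2], -(u-2)^2 on [2,3] and -1-2(u-3) beyond; the equation
   v' = v f(t,v) then has infinitely many entire solutions bounded away from 0, with
   different limits in (1,2) as t tends to minus infinity. *)

definition KPP_b :: "(real \<Rightarrow> real \<Rightarrow> real) \<Rightarrow> (real \<Rightarrow> real \<Rightarrow> real) \<Rightarrow> bool" where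
  "KPP_b f fu \<longleftrightarrow>
     (\<forall>u. bounded (range (\<lambda>t. f t u))) \<and>
     (\<exists>M\<^sub>0>0. \<forall>t. \<forall>u\<ge>M\<^sub>0. f t u < 0) \<and>
     (\<forall>u\<ge>0. \<exists>\<delta>>0. \<forall>t. fu t u \<le> - \<delta>) \<and>
     0 < f_inf f"

definition KPP_c :: "(real \<Rightarrow> real \<Rightarrow> real) \<Rightarrow> bool" where
  "KPP_c f \<longleftrightarrow>
     (\<exists>m M. 0 < m \<and> m < M \<and>
        (\<forall>t. \<forall>u\<ge>0. f t 0 - M * u \<le> f t u \<and> f t u \<le> f t 0 - m * u))"

definition KPP :: "(real \<Rightarrow> real \<Rightarrow> real) \<Rightarrow> bool" where
  "KPP f \<longleftrightarrow> (\<exists>fu. KPP_a f fu \<and> KPP_b f fu) \<and> KPP_c f"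

(* Since int carries the discrete topology, the type of bounded continuous functions
   from int to real is the Banach space of bounded real sequences indexed by the integers,
   with the sup norm. *)

type_synonym linf = "int \<Rightarrow>\<^sub>C real"

definition lattice_solution ::
    "(real \<Rightarrow> real \<Rightarrow> real) \<Rightarrow> real set \<Rightarrow> (real \<Rightarrow> linf) \<Rightarrow> bool" where
  "lattice_solution f T U \<longleftrightarrow>
     continuous_on T U \<and>
     (\<forall>t\<in>T. \<forall>i. ((\<lambda>\<tau>. U \<tau> i) has_real_derivative
        U t (i + 1) - 2 * U t i + U t (i - 1) + U t i * f t (U t i)) (at t within T))"

(* lattice_sol f t s u0 is u(t;s,u0). The description is on the value at time t, because
   a solution is determined only on [s, infinity). *)

definition lattice_sol ::
    "(real \<Rightarrow> real \<Rightarrow> real) \<Rightarrow> real \<Rightarrow> real \<Rightarrow> linf \<Rightarrow> linf" where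
  "lattice_sol f t s u0 = (THE v. \<exists>U. lattice_solution f {s..} U \<and> U s = u0 \<and> U t = v)"

definition u_plus :: "(real \<Rightarrow> real \<Rightarrow> real) \<Rightarrow> real \<Rightarrow> real" where
  "u_plus f = (THE v. lattice_solution f UNIV (\<lambda>t. const_bcontfun (v t)) \<and>
                      (\<exists>\<delta>>0. \<forall>t. \<delta> \<le> v t))"

definition linf0 :: "linf set" where
  "linf0 = {u. (\<forall>i. 0 \<le> apply_bcontfun u i) \<and> (\<exists>N. \<forall>i. N < \<bar>i\<bar> \<longrightarrow> u i = 0) \<and> u \<noteq> (0 :: linf)}"

(* Speeds are extended reals. In the two lower speeds the index set is empty when c < 0
   and t > 0, so the Limsup is minus infinity and no c < 0 is admitted. *)

definition c_upper :: "(real \<Rightarrow> real \<Rightarrow> real) \<Rightarrow> ereal" where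
  "c_upper f = Inf (ereal ` {c. \<forall>u0\<in>linf0.
     Limsup at_top (\<lambda>t. SUP i\<in>{i. c * t \<le> real_of_int \<bar>i\<bar>}.
       ereal (lattice_sol f t 0 u0 i)) = 0})"

definition c_lower :: "(real \<Rightarrow> real \<Rightarrow> real) \<Rightarrow> ereal" where
  "c_lower f = Sup (ereal ` {c. \<forall>u0\<in>linf0.
     Limsup at_top (\<lambda>t. SUP i\<in>{i. real_of_int \<bar>i\<bar> \<le> c * t}.
       ereal \<bar>lattice_sol f t 0 u0 i - u_plus f t\<bar>) = 0})"

(* Uniformity in s: the supremum over s is taken before the limit in t. *)

definition gen_c_upper :: "(real \<Rightarrow> real \<Rightarrow> real) \<Rightarrow> ereal" where
  "gen_c_upper f = Inf (ereal ` {c. \<forall>u0\<in>linf0.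
     Limsup at_top (\<lambda>t. SUP s. SUP i\<in>{i. c * t \<le> real_of_int \<bar>i\<bar>}.
       ereal (lattice_sol f (t + s) s u0 i)) = 0})"

definition gen_c_lower :: "(real \<Rightarrow> real \<Rightarrow> real) \<Rightarrow> ereal" where
  "gen_c_lower f = Sup (ereal ` {c. \<forall>u0\<in>linf0.
     Limsup at_top (\<lambda>t. SUP s. SUP i\<in>{i. real_of_int \<bar>i\<bar> \<le> c * t}.
       ereal \<bar>lattice_sol f (t + s) s u0 i - u_plus f (t + s)\<bar>) = 0})"

definition speed :: "ereal \<Rightarrow> ereal" where
  "speed a = (INF \<mu>\<in>{0<..}. (ereal (exp (- \<mu>) + exp \<mu> - 2) + a) / ereal \<mu>)"

end

theory Submission
  imports Defs
begin

text \<open>Upper bounds: since \<open>f t u \<le> f t 0\<close> for \<open>u \<ge> 0\<close>, the functions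
  \<open>exp (\<mp> \<mu> * i + (exp (- \<mu>) + exp \<mu> - 2) * (t - s) + \<integral>\<^sub>s\<^sup>t f(\<tau>, 0) d\<tau>)\<close> are supersolutions.

  Lower bounds: the difference between a running average of an antiderivative of \<open>f(\<cdot>, 0)\<close> and the
  antiderivative itself is bounded. Multiplying by its exponential turns the growth rate \<open>f t 0\<close>
  into an average over a long window, which is almost at least the least mean. This leaves an
  autonomous KPP problem, whose compactly supported travelling subsolutions keep solutions away
  from zero in every cone of speed below the linear one. Inside the cone the ratio \<open>q = u / u\<^sup>+\<close> satisfies
  \<open>q' = \<Delta>q + q * (f(t, u) - f(t, u\<^sup>+))\<close>, and the uniform strict monotonicity of \<open>f\<close> in \<open>u\<close> drives it
  to 1 within a time that does not depend on the starting time.\<close>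

section \<open>Comparison and the initial value problem on the lattice\<close>

text \<open>Two obstacles shape the argument: the lattice is infinite, and every bound must be
  uniform in the starting time, because the generalized speeds take the supremum over
  \<open>s\<close> before the limit. The main estimates are therefore comparisons with explicit
  functions whose constants are fixed before \<open>s\<close> and \<open>u\<close>. Comparison tests
  its differential inequality only where the difference is negative. This admits truncated bumps as
  subsolutions: a nonnegative solution can lie below a bump only where the bump is positive, and
  there it is differentiable.

  Each site of the cone is reached by a bump travelling at its own speed, so all speeds up to a
  bound must share one support and one height. The averaged rate has to be controlled at every time
  after the start; hence solutions started at 0 involve means over all \<open>s \<ge> 0\<close>.
  Both \<open>lattice_sol\<close> and \<open>u_plus\<close> are definite descriptions, so existence
  and uniqueness belong to the proof. Lower speeds do not exceed upper ones, since at a common site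
  a solution cannot be close both to 0 and to \<open>u_plus\<close>.\<close>

definition dlap :: "(int \<Rightarrow> real) \<Rightarrow> int \<Rightarrow> real" where
  "dlap v i = v (i + 1) - 2 * v i + v (i - 1)"

text \<open>The barrier \<open>\<epsilon> * exp (K * (\<tau> - s)) * (1 + j\<^sup>2)\<close> confines the first touching point to a
  finite part of the lattice, so no compactness in space is needed.\<close>
lemma lattice_comparison:
  fixes z :: "real \<Rightarrow> int \<Rightarrow> real"
  assumes cont: "\<And>i. continuous_on {s..T} (\<lambda>t. z t i)"
    and lb: "\<And>t i. t \<in> {s..T} \<Longrightarrow> - B \<le> z t i"
    and init: "\<And>i. 0 \<le> z s i"
    and ineq: "\<And>t i. s < t \<Longrightarrow> t \<le> T \<Longrightarrow> z t i < 0 \<Longrightarrow>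
       \<exists>D. ((\<lambda>\<tau>. z \<tau> i) has_real_derivative D) (at t within {s..T}) \<and>
           dlap (z t) i + A * z t i \<le> D"
    and t: "t \<in> {s..T}"
  shows "0 \<le> z t i"
proof (rule ccontr)
  assume neg: "\<not> 0 \<le> z t i"
  \<comment> \<open>\<open>2\<close> absorbs \<open>dlap g \<le> 2 * g\<close>,
    \<open>\<bar>A\<bar>\<close> the term of order zero, and the remaining 1 makes the derivative at
    the touching point strictly positive.\<close>
  define K where "K = \<bar>A\<bar> + 3"
  define g where "g = (\<lambda>\<tau> (j::int). exp (K * (\<tau> - s)) * (1 + (real_of_int j)\<^sup>2))"
  have gpos: "0 < g \<tau> j" for \<tau> j
    by (auto simp: g_def intro!: mult_pos_pos add_pos_nonneg)
  \<comment> \<open>The choice gives \<open>Z t i = z t i / 2\<close>, which is still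
    negative.\<close>
  define \<epsilon> where "\<epsilon> = - z t i / (2 * g t i)"
  have \<epsilon>: "0 < \<epsilon>" using neg gpos[of t i] by (simp add: \<epsilon>_def divide_neg_pos)
  define Z where "Z = (\<lambda>\<tau> j. z \<tau> j + \<epsilon> * g \<tau> j)"
  have Zneg: "Z t i < 0"
    using neg gpos[of t i] by (simp add: Z_def \<epsilon>_def field_simps)
  obtain N :: nat where N: "B < \<epsilon> * real N"
    using \<epsilon> by (metis ex_less_of_nat_mult mult.commute)
  have far: "0 < Z \<tau> j" if \<tau>: "\<tau> \<in> {s..T}" and j: "int N < \<bar>j\<bar>" for \<tau> j
  proof -
    have "real N \<le> \<bar>real_of_int j\<bar>" using j by linarith
    also have "\<dots> \<le> 1 + (real_of_int j)\<^sup>2"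
      using zero_le_power2[of "\<bar>real_of_int j\<bar> - 1"] by (simp add: power2_diff)
    also have "\<dots> \<le> g \<tau> j"
      using \<tau> mult_right_mono[of 1 "exp (K * (\<tau> - s))" "1 + (real_of_int j)\<^sup>2"]
      by (simp add: g_def K_def)
    finally have "\<epsilon> * real N \<le> \<epsilon> * g \<tau> j" using \<epsilon> by simp
    then show ?thesis using N lb[OF \<tau>, of j] by (simp add: Z_def)
  qed
  have contZ: "continuous_on {s..T} (\<lambda>\<tau>. Z \<tau> j)" for j
    unfolding Z_def g_def by (intro continuous_intros cont)
  define C where "C = (\<Union>j\<in>{- int N..int N}. {\<tau> \<in> {s..T}. Z \<tau> j \<le> 0})"
  have "compact {\<tau> \<in> {s..T}. Z \<tau> j \<le> 0}" for j
  proof -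
    have "closed ({s..T} \<inter> (\<lambda>\<tau>. Z \<tau> j) -` {..0})"
      by (rule continuous_closed_preimage[OF contZ]) auto
    moreover have "{\<tau> \<in> {s..T}. Z \<tau> j \<le> 0} = {s..T} \<inter> ({s..T} \<inter> (\<lambda>\<tau>. Z \<tau> j) -` {..0})" by auto
    ultimately show ?thesis by (metis compact_Icc compact_Int_closed)
  qed
  then have "compact C" unfolding C_def by (intro compact_UN) auto
  moreover have "C \<noteq> {}"
  proof -
    have "\<bar>i\<bar> \<le> int N" using far[OF t, of i] Zneg by force
    then have "t \<in> C" using t Zneg unfolding C_def by (intro UN_I[of i]) auto
    then show ?thesis by blast
  qed
  ultimately obtain t0 where t0: "t0 \<in> C" and t0_min: "\<And>\<tau>. \<tau> \<in> C \<Longrightarrow> t0 \<le> \<tau>"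
    using compact_attains_inf by metis
  then obtain i0 where i0: "Z t0 i0 \<le> 0" and t0T: "t0 \<in> {s..T}" by (auto simp: C_def)
  have before: "0 < Z \<tau> j" if "\<tau> \<in> {s..T}" "\<tau> < t0" for \<tau> j
  proof (cases "\<bar>j\<bar> \<le> int N")
    case True
    then have "Z \<tau> j \<le> 0 \<Longrightarrow> \<tau> \<in> C" using that(1) unfolding C_def by (intro UN_I[of j]) auto
    then show ?thesis using t0_min[of \<tau>] that(2) by linarith
  qed (use far[OF that(1)] in auto)
  have "0 < Z s j" for j using init[of j] \<epsilon> gpos[of s j] by (simp add: Z_def add_nonneg_pos)
  then have st0: "s < t0" using i0 t0T by (metis atLeastAtMost_iff less_eq_real_def not_less)
  have at_t0: "0 \<le> Z t0 j" for j
  proof (rule tendsto_lowerbound)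
    have "continuous_on {s..t0} (\<lambda>\<tau>. Z \<tau> j)"
      by (rule continuous_on_subset[OF contZ]) (use t0T in auto)
    then show "((\<lambda>\<tau>. Z \<tau> j) \<longlongrightarrow> Z t0 j) (at_left t0)"
      using continuous_on_Icc_at_leftD st0 by blast
    show "\<forall>\<^sub>F \<tau> in at_left t0. 0 \<le> Z \<tau> j"
      using eventually_at_left_real[OF st0]
      by (rule eventually_mono) (use before t0T in \<open>auto simp: less_imp_le\<close>)
  qed auto
  have zi: "z t0 i0 = - \<epsilon> * g t0 i0" using i0 at_t0[of i0] by (simp add: Z_def)
  then have "z t0 i0 < 0" using \<epsilon> gpos[of t0 i0] by (simp add: mult_pos_pos)
  then obtain D where D: "((\<lambda>\<tau>. z \<tau> i0) has_real_derivative D) (at t0 within {s..T})"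
     and Dge: "dlap (z t0) i0 + A * z t0 i0 \<le> D"
    using ineq[OF st0] t0T by auto
  have "((\<lambda>\<tau>. g \<tau> i0) has_real_derivative K * g t0 i0) (at t0 within {s..T})"
    unfolding g_def by (auto intro!: derivative_eq_intros)
  then have DZ: "((\<lambda>\<tau>. Z \<tau> i0) has_real_derivative D + \<epsilon> * (K * g t0 i0)) (at t0 within {s..T})"
    unfolding Z_def by (auto intro!: derivative_eq_intros D)
  have lapg: "dlap (g t0) i0 = 2 * exp (K * (t0 - s))"
    by (simp add: dlap_def g_def algebra_simps power2_eq_square)
  have "0 \<le> dlap (Z t0) i0"
    using at_t0[of "i0 + 1"] at_t0[of "i0 - 1"] i0 at_t0[of i0] by (simp add: dlap_def)
  then have "- (\<epsilon> * dlap (g t0) i0) \<le> dlap (z t0) i0"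
    by (simp add: dlap_def Z_def algebra_simps)
  then have "- (\<epsilon> * (2 * exp (K * (t0 - s)))) + A * z t0 i0 \<le> D" using Dge lapg by simp
  moreover have "exp (K * (t0 - s)) \<le> g t0 i0"
    by (auto simp: g_def mult_le_cancel_left1)
  then have "\<epsilon> * (2 * exp (K * (t0 - s))) \<le> \<epsilon> * (2 * g t0 i0)" using \<epsilon> by simp
  ultimately have "\<epsilon> * (K * g t0 i0) - \<epsilon> * (2 * g t0 i0) - A * (\<epsilon> * g t0 i0) \<le> D + \<epsilon> * (K * g t0 i0)"
    using zi by simp
  moreover have "0 < (K - 2 - A) * (\<epsilon> * g t0 i0)"
    using \<epsilon> gpos[of t0 i0] by (intro mult_pos_pos) (auto simp: K_def)
  ultimately have "0 < D + \<epsilon> * (K * g t0 i0)" by (simp add: algebra_simps)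
  from has_real_derivative_pos_inc_left[OF DZ this]
  obtain d where d: "d > 0" "\<And>h. h > 0 \<Longrightarrow> t0 - h \<in> {s..T} \<Longrightarrow> h < d \<Longrightarrow> Z (t0 - h) i0 < Z t0 i0"
    by blast
  define h where "h = min (d / 2) (t0 - s)"
  have "0 < h" "h < d" "t0 - h \<in> {s..T}" using d st0 t0T by (auto simp: h_def)
  then show False using d(2)[of h] before[of "t0 - h" i0] i0 by force
qed

section \<open>Picard iteration for the lattice equation\<close>

lemma continuous_has_antiderivative:
  fixes f :: "real \<Rightarrow> real"
  assumes "continuous_on UNIV f"
  obtains F where "\<And>x. (F has_real_derivative f x) (at x)"
proof -
  have "\<exists>F. \<forall>x::real. -\<infinity> < ereal x \<longrightarrow> ereal x < \<infinity> \<longrightarrow> (F has_vector_derivative f x) (at x)"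
    by (rule einterval_antiderivative)
       (use assms in \<open>auto simp: continuous_on_eq_continuous_at\<close>)
  then show ?thesis using that by (auto simp: has_real_derivative_iff_has_vector_derivative)
qed

text \<open>Each slice \<open>UNIV \<times> {i}\<close> is open because \<open>int\<close> is
  discrete, so continuity may be checked slice by slice.\<close>

lemma continuous_on_prod_int:
  fixes h :: "'a::topological_space \<Rightarrow> int \<Rightarrow> 'b::topological_space"
  assumes "\<And>i. continuous_on UNIV (\<lambda>t. h t i)"
  shows "continuous_on UNIV (\<lambda>(t, i). h t i)"
proof -
  have "continuous_on (\<Union>i. UNIV \<times> {i::int}) (\<lambda>(t, i). h t i)"
  proof (rule continuous_on_open_UN)
    fix i :: int
    show "open (UNIV \<times> {i} :: ('a \<times> int) set)"
      by (simp add: open_Times open_discrete)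
    have "continuous_on (UNIV \<times> {i}) (\<lambda>p. h (fst p) i)"
      by (rule continuous_on_compose2[OF assms]) (auto intro: continuous_intros)
    then show "continuous_on (UNIV \<times> {i}) (\<lambda>(t, i). h t i)"
      by (rule continuous_on_eq) auto
  qed
  moreover have "(\<Union>i. UNIV \<times> {i::int}) = (UNIV :: ('a \<times> int) set)" by auto
  ultimately show ?thesis by simp
qed

lemma continuous_on_lipschitz_compose:
  fixes g :: "real \<Rightarrow> real \<Rightarrow> real"
  assumes lip: "\<And>t x y. t \<in> S \<Longrightarrow> \<bar>g t x - g t y\<bar> \<le> L * \<bar>x - y\<bar>"
    and cont: "\<And>x. continuous_on S (\<lambda>t. g t x)" and x: "continuous_on S x"
  shows "continuous_on S (\<lambda>t. g t (x t))"
  unfolding continuous_on_def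
proof
  fix t assume t: "t \<in> S"
  have "((\<lambda>\<tau>. L * \<bar>x \<tau> - x t\<bar> + \<bar>g \<tau> (x t) - g t (x t)\<bar>) \<longlongrightarrow> L * \<bar>x t - x t\<bar> + \<bar>g t (x t) - g t (x t)\<bar>)
      (at t within S)"
    using cont[of "x t"] x t by (intro tendsto_intros) (auto simp: continuous_on_def)
  then have "((\<lambda>\<tau>. L * \<bar>x \<tau> - x t\<bar> + \<bar>g \<tau> (x t) - g t (x t)\<bar>) \<longlongrightarrow> 0) (at t within S)" by simp
  moreover have "\<forall>\<^sub>F \<tau> in at t within S. norm (g \<tau> (x \<tau>) - g t (x t)) \<le> L * \<bar>x \<tau> - x t\<bar> + \<bar>g \<tau> (x t) - g t (x t)\<bar>"
    unfolding eventually_at_filter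
  proof (intro always_eventually allI impI)
    fix \<tau> assume "\<tau> \<in> S"
    from lip[OF this, of "x \<tau>" "x t"]
    show "norm (g \<tau> (x \<tau>) - g t (x t)) \<le> L * \<bar>x \<tau> - x t\<bar> + \<bar>g \<tau> (x t) - g t (x t)\<bar>" by simp
  qed
  ultimately have "((\<lambda>\<tau>. g \<tau> (x \<tau>) - g t (x t)) \<longlongrightarrow> 0) (at t within S)"
    by (rule Lim_null_comparison[rotated])
  then show "((\<lambda>\<tau>. g \<tau> (x \<tau>)) \<longlongrightarrow> g t (x t)) (at t within S)"
    by (simp add: LIM_zero_iff)
qed

text \<open>The library has this only for metric domains, which excludes the type of integers.\<close>
lemma complete_UNIV_bcontfun:
  "complete (UNIV :: ('a::topological_space \<Rightarrow>\<^sub>C 'b::complete_space) set)"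
  unfolding complete_def
proof (intro allI impI)
  fix X :: "nat \<Rightarrow> 'a \<Rightarrow>\<^sub>C 'b" assume "(\<forall>n. X n \<in> UNIV) \<and> Cauchy X"
  then have "uniformly_Cauchy_on UNIV (\<lambda>n. apply_bcontfun (X n))"
    unfolding uniformly_Cauchy_on_def Cauchy_def by (meson UNIV_I dist_bounded le_less_trans)
  then obtain l where l: "uniform_limit UNIV (\<lambda>n. apply_bcontfun (X n)) l sequentially"
    by (metis Cauchy_uniformly_convergent uniformly_convergent_on_def)
  then obtain l' where "X \<longlonglongrightarrow> l'"
    by (rule uniform_limit_bcontfunE) auto
  then show "\<exists>l\<in>UNIV. X \<longlonglongrightarrow> l" by blast
qed

text \<open>Picard iteration for \<open>V(t,i) = exp (- \<Lambda> * (t - s)) * u(t,i)\<close>: with \<open>\<Lambda> = 2 * (4 + L)\<close> the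
  integral operator halves distances.\<close>
lemma lattice_ivp_exists:
  fixes g :: "real \<Rightarrow> real \<Rightarrow> real" and u0 :: "int \<Rightarrow> real"
  assumes sT: "s \<le> T" and L: "0 \<le> L"
    and lip: "\<And>t x y. t \<in> {s..T} \<Longrightarrow> \<bar>g t x - g t y\<bar> \<le> L * \<bar>x - y\<bar>"
    and cont: "\<And>x. continuous_on {s..T} (\<lambda>t. g t x)"
    and u0: "\<And>i. \<bar>u0 i\<bar> \<le> R"
  obtains u B where "\<And>i. u s i = u0 i" "\<And>t i. t \<in> {s..T} \<Longrightarrow> \<bar>u t i\<bar> \<le> B"
    "\<And>t i. t \<in> {s..T} \<Longrightarrow>
       ((\<lambda>\<tau>. u \<tau> i) has_real_derivative dlap (u t) i + g t (u t i)) (at t within {s..T})"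
proof -
  define \<Lambda> where "\<Lambda> = 2 * (4 + L)"
  have \<Lambda>: "0 < \<Lambda>" using L by (simp add: \<Lambda>_def)
  \<comment> \<open>Elements of the function space are defined for all times, so time is clamped to
    \<open>{s..T}\<close>.\<close>
  define cl where "cl = (\<lambda>t. max s (min T t))"
  have cl_in: "cl t \<in> {s..T}" for t using sT by (auto simp: cl_def)
  have cl_id: "cl t = t" if "t \<in> {s..T}" for t using that by (auto simp: cl_def)
  define uu where "uu = (\<lambda>(V :: (real \<times> int) \<Rightarrow>\<^sub>C real) \<sigma> i. exp (\<Lambda> * (\<sigma> - s)) * apply_bcontfun V (\<sigma>, i))"
  define F where "F = (\<lambda>V \<sigma> i. dlap (uu V \<sigma>) i + g \<sigma> (uu V \<sigma> i))"
  have cont_uu: "continuous_on S (\<lambda>\<sigma>. uu V \<sigma> i)" for V S i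
    unfolding uu_def
    by (intro continuous_intros continuous_on_compose2[OF continuous_on_apply_bcontfun[of UNIV V]]) auto
  have contF: "continuous_on {s..T} (\<lambda>\<sigma>. F V \<sigma> i)" for V i
    unfolding F_def dlap_def
    by (intro continuous_intros cont_uu continuous_on_lipschitz_compose[OF lip cont])
  have V_le: "\<bar>apply_bcontfun V p\<bar> \<le> norm V" for V :: "(real \<times> int) \<Rightarrow>\<^sub>C real" and p
    using norm_bounded[of V p] by simp
  define E where "E = exp (\<Lambda> * (T - s))"
  have uu_le: "\<bar>uu V \<sigma> i\<bar> \<le> E * norm V" if "\<sigma> \<in> {s..T}" for V \<sigma> i
    unfolding uu_def E_def abs_mult using that \<Lambda> by (intro mult_mono V_le) auto
  have "bounded ((\<lambda>t. g t 0) ` {s..T})"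
    by (intro compact_imp_bounded compact_continuous_image cont) auto
  then obtain G where G: "\<And>t. t \<in> {s..T} \<Longrightarrow> \<bar>g t 0\<bar> \<le> G"
    unfolding bounded_iff real_norm_def by blast
  have F_le: "\<bar>F V \<sigma> i\<bar> \<le> (4 + L) * (E * norm V) + G" if "\<sigma> \<in> {s..T}" for V \<sigma> i
  proof -
    have "\<bar>g \<sigma> (uu V \<sigma> i)\<bar> \<le> L * \<bar>uu V \<sigma> i\<bar> + G"
      using lip[OF that, of "uu V \<sigma> i" 0] G[OF that] by simp
    also have "\<dots> \<le> L * (E * norm V) + G"
      using uu_le[OF that] L by (simp add: mult_left_mono)
    finally show ?thesis
      using uu_le[OF that, of V i] uu_le[OF that, of V "i+1"] uu_le[OF that, of V "i-1"]
      unfolding F_def dlap_def by (simp add: algebra_simps)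
  qed
  define J where "J = (\<lambda>V t i. integral {s..t} (\<lambda>\<sigma>. F V \<sigma> i))"
  have J_deriv: "((\<lambda>t. J V t i) has_real_derivative F V t i) (at t within {s..T})" if "t \<in> {s..T}" for V t i
    unfolding J_def by (rule integral_has_real_derivative[OF contF that])
  have J_cont: "continuous_on {s..T} (\<lambda>t. J V t i)" for V i
    by (rule DERIV_continuous_on[OF J_deriv])
  have J_le: "\<bar>J V t i\<bar> \<le> ((4 + L) * (E * norm V) + G) * (T - s)" if t: "t \<in> {s..T}" for V t i
  proof -
    have "\<bar>J V t i - J V s i\<bar> \<le> ((4 + L) * (E * norm V) + G) * \<bar>t - s\<bar>"
      using field_differentiable_bound[of "{s..T}" "\<lambda>t. J V t i" "\<lambda>t. F V t i" _ t s] J_deriv F_le t sT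
      by (auto simp: real_norm_def)
    also have "\<dots> \<le> ((4 + L) * (E * norm V) + G) * (T - s)"
      using t F_le[OF t, of V i] by (intro mult_left_mono) auto
    finally show ?thesis by (simp add: J_def)
  qed
  define H where "H = (\<lambda>V t i. exp (- \<Lambda> * (cl t - s)) * (u0 i + J V (cl t) i))"
  define \<Phi> where "\<Phi> = (\<lambda>V. Bcontfun (\<lambda>(t, i). H V t i))"
  have H_in: "(\<lambda>(t, i). H V t i) \<in> bcontfun" for V
  proof (rule bcontfun_normI)
    show "continuous_on UNIV (\<lambda>(t, i). H V t i)"
    proof (rule continuous_on_prod_int)
      fix i
      have "continuous_on UNIV (\<lambda>t. J V (cl t) i)"
        by (rule continuous_on_compose2[OF J_cont]) (use cl_in in \<open>auto simp: cl_def intro!: continuous_intros\<close>)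
      moreover have "continuous_on UNIV cl" by (auto simp: cl_def intro!: continuous_intros)
      ultimately show "continuous_on UNIV (\<lambda>t. H V t i)"
        unfolding H_def by (intro continuous_intros)
    qed
    fix p :: "real \<times> int"
    obtain t i where p: "p = (t, i)" by fastforce
    have "\<bar>H V t i\<bar> \<le> 1 * (R + ((4 + L) * (E * norm V) + G) * (T - s))"
      unfolding H_def abs_mult
    proof (intro mult_mono)
      show "\<bar>exp (- \<Lambda> * (cl t - s))\<bar> \<le> 1" using \<Lambda> cl_in[of t] by simp
      show "\<bar>u0 i + J V (cl t) i\<bar> \<le> R + ((4 + L) * (E * norm V) + G) * (T - s)"
        using u0[of i] J_le[OF cl_in[of t], of V i] by linarith
    qed auto
    then show "norm (case p of (t, i) \<Rightarrow> H V t i) \<le> R + ((4 + L) * (E * norm V) + G) * (T - s)"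
      by (simp add: p)
  qed
  have \<Phi>_apply: "apply_bcontfun (\<Phi> V) (t, i) = H V t i" for V t i
    unfolding \<Phi>_def by (simp add: Bcontfun_inverse[OF H_in])
  have "dist (\<Phi> V) (\<Phi> W) \<le> 1 / 2 * dist V W" for V W
  proof (rule dist_bound)
    fix p :: "real \<times> int"
    obtain t i where p: "p = (t, i)" by fastforce
    define \<tau> where "\<tau> = cl t"
    have \<tau>: "\<tau> \<in> {s..T}" unfolding \<tau>_def by (rule cl_in)
    define d where "d = dist V W"
    have uu_diff: "\<bar>uu V \<sigma> j - uu W \<sigma> j\<bar> \<le> exp (\<Lambda> * (\<sigma> - s)) * d" for \<sigma> j
    proof -
      have "\<bar>uu V \<sigma> j - uu W \<sigma> j\<bar> = exp (\<Lambda> * (\<sigma> - s)) * dist (apply_bcontfun V (\<sigma>, j)) (apply_bcontfun W (\<sigma>, j))"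
        by (simp add: uu_def dist_real_def abs_mult flip: right_diff_distrib)
      also have "\<dots> \<le> exp (\<Lambda> * (\<sigma> - s)) * d"
        unfolding d_def by (intro mult_left_mono dist_bounded) auto
      finally show ?thesis .
    qed
    have F_diff: "\<bar>F V \<sigma> i - F W \<sigma> i\<bar> \<le> (4 + L) * (exp (\<Lambda> * (\<sigma> - s)) * d)" if "\<sigma> \<in> {s..T}" for \<sigma>
    proof -
      have "\<bar>g \<sigma> (uu V \<sigma> i) - g \<sigma> (uu W \<sigma> i)\<bar> \<le> L * \<bar>uu V \<sigma> i - uu W \<sigma> i\<bar>"
        by (rule lip[OF that])
      also have "\<dots> \<le> L * (exp (\<Lambda> * (\<sigma> - s)) * d)" using uu_diff L by (simp add: mult_left_mono)
      finally show ?thesis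
        using uu_diff[of \<sigma> i] uu_diff[of \<sigma> "i+1"] uu_diff[of \<sigma> "i-1"]
        unfolding F_def dlap_def by (simp add: algebra_simps)
    qed
    have sub: "{s..\<tau>} \<subseteq> {s..T}" using \<tau> by auto
    have int: "(\<lambda>\<sigma>. F V' \<sigma> i) integrable_on {s..\<tau>}" for V'
      by (rule integrable_continuous_real[OF continuous_on_subset[OF contF sub]])
    \<comment> \<open>Since \<open>\<Lambda> = 2 * (4 + L)\<close>, integrating the Lipschitz bound
      produces the factor 1/2, the contraction constant. The \<open>4\<close> bounds the discrete
      Laplacian.\<close>
    have ftc: "((\<lambda>\<sigma>. (4 + L) * (exp (\<Lambda> * (\<sigma> - s)) * d)) has_integral
        d / 2 * exp (\<Lambda> * (\<tau> - s)) - d / 2 * exp (\<Lambda> * (s - s))) {s..\<tau>}"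
      by (rule fundamental_theorem_of_calculus)
         (use \<tau> in \<open>auto intro!: derivative_eq_intros simp: \<Lambda>_def simp flip: has_real_derivative_iff_has_vector_derivative\<close>)
    have "\<bar>J V \<tau> i - J W \<tau> i\<bar> = norm (integral {s..\<tau>} (\<lambda>\<sigma>. F V \<sigma> i - F W \<sigma> i))"
      unfolding J_def by (simp add: integral_diff int)
    also have "\<dots> \<le> integral {s..\<tau>} (\<lambda>\<sigma>. (4 + L) * (exp (\<Lambda> * (\<sigma> - s)) * d))"
      using ftc F_diff \<tau> by (intro integral_norm_bound_integral integrable_diff int) auto
    also have "\<dots> \<le> d / 2 * exp (\<Lambda> * (\<tau> - s))"
      using integral_unique[OF ftc] by (simp add: d_def)
    finally have J_diff: "\<bar>J V \<tau> i - J W \<tau> i\<bar> \<le> d / 2 * exp (\<Lambda> * (\<tau> - s))" .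
    have "dist (apply_bcontfun (\<Phi> V) p) (apply_bcontfun (\<Phi> W) p)
        = exp (- \<Lambda> * (\<tau> - s)) * \<bar>J V \<tau> i - J W \<tau> i\<bar>"
      by (simp add: p \<Phi>_apply H_def dist_real_def abs_mult \<tau>_def flip: right_diff_distrib)
    also have "\<dots> \<le> exp (- \<Lambda> * (\<tau> - s)) * (d / 2 * exp (\<Lambda> * (\<tau> - s)))"
      by (intro mult_left_mono J_diff) auto
    also have "\<dots> = d / 2" by (simp add: exp_minus)
    finally show "dist (apply_bcontfun (\<Phi> V) p) (apply_bcontfun (\<Phi> W) p) \<le> 1 / 2 * dist V W"
      by (simp add: d_def)
  qed
  then obtain V where V: "\<Phi> V = V"
    using Banach_fix[OF complete_UNIV_bcontfun UNIV_not_empty, of "1/2" \<Phi>] by auto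
  have u_eq: "uu V t i = u0 i + J V t i" if "t \<in> {s..T}" for t i
  proof -
    have "apply_bcontfun V (t, i) = H V t i" using \<Phi>_apply[of V t i] by (simp add: V)
    then show ?thesis by (simp add: uu_def H_def cl_id[OF that] exp_minus)
  qed
  show ?thesis
  proof (rule that[of "uu V" "E * norm V"])
    show "uu V s i = u0 i" for i using u_eq[of s i] sT by (simp add: J_def)
    show "\<bar>uu V t i\<bar> \<le> E * norm V" if "t \<in> {s..T}" for t i by (rule uu_le[OF that])
    fix t i assume t: "t \<in> {s..T}"
    have "((\<lambda>t. u0 i + J V t i) has_real_derivative F V t i) (at t within {s..T})"
      by (auto intro!: derivative_eq_intros J_deriv[OF t])
    then show "((\<lambda>\<tau>. uu V \<tau> i) has_real_derivative dlap (uu V t) i + g t (uu V t i)) (at t within {s..T})"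
      unfolding F_def by (rule has_field_derivative_transform_within[of _ _ _ _ 1]) (use t u_eq in auto)
  qed
qed

section \<open>The KPP lattice flow\<close>

text \<open>Sitewise form of \<open>lattice_solution\<close>, silent about boundedness and
  continuity in norm: solutions can be built, restricted and glued without constructing elements of
  \<open>linf\<close>.\<close>

definition lattice_flow :: "(real \<Rightarrow> real \<Rightarrow> real) \<Rightarrow> real set \<Rightarrow> (real \<Rightarrow> int \<Rightarrow> real) \<Rightarrow> bool" where
  "lattice_flow f S u \<longleftrightarrow> (\<forall>t\<in>S. \<forall>i.
     ((\<lambda>\<tau>. u \<tau> i) has_real_derivative dlap (u t) i + u t i * f t (u t i)) (at t within S))"

lemma lattice_flow_subset: "lattice_flow f S u \<Longrightarrow> S' \<subseteq> S \<Longrightarrow> lattice_flow f S' u"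
  unfolding lattice_flow_def by (meson DERIV_subset subsetD)

lemma lattice_flowD:
  "lattice_flow f S u \<Longrightarrow> t \<in> S \<Longrightarrow>
     ((\<lambda>\<tau>. u \<tau> i) has_real_derivative dlap (u t) i + u t i * f t (u t i)) (at t within S)"
  by (simp add: lattice_flow_def)

lemma lattice_flow_continuous: "lattice_flow f S u \<Longrightarrow> continuous_on S (\<lambda>t. u t i)"
  by (rule DERIV_continuous_on) (rule lattice_flowD)

lemma lattice_solution_iff_flow:
  "lattice_solution f S U \<longleftrightarrow> continuous_on S U \<and> lattice_flow f S (\<lambda>t. apply_bcontfun (U t))"
  by (simp add: lattice_solution_def lattice_flow_def dlap_def)

text \<open>\<open>P\<close> is an antiderivative of \<open>f t 0\<close>, which turns means into
  increments; \<open>strict\<close> is the negativity of the derivative in \<open>u\<close>,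
  integrated over an interval with its uniformity in \<open>t\<close> preserved.\<close>

locale kpp_reaction =
  fixes f :: "real \<Rightarrow> real \<Rightarrow> real" and P :: "real \<Rightarrow> real" and K M\<^sub>0 m M :: real
  assumes cont_t: "continuous_on UNIV (\<lambda>t. f t u)"
    and lip: "\<exists>L. \<forall>t\<in>{a..b}. L-lipschitz_on UNIV (f t)"
    and K_pos: "0 < K" and f0_le: "\<bar>f t 0\<bar> \<le> K"
    and M0_pos: "0 < M\<^sub>0" and f_neg: "M\<^sub>0 \<le> u \<Longrightarrow> f t u < 0"
    and strict: "0 \<le> x \<Longrightarrow> x < y \<Longrightarrow> \<exists>\<eta>>0. \<forall>t. f t y \<le> f t x - \<eta>"
    and m_pos: "0 < m" and M_pos: "0 < M"
    and f_ge: "0 \<le> u \<Longrightarrow> f t 0 - M * u \<le> f t u"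
    and f_le: "0 \<le> u \<Longrightarrow> f t u \<le> f t 0 - m * u"
    and P_deriv: "(P has_real_derivative f t 0) (at t)"
    and mean: "\<exists>r>0. \<exists>T>0. \<forall>s t. T \<le> t - s \<longrightarrow> r * (t - s) \<le> P t - P s"
begin

lemma f_le_f0: "0 \<le> u \<Longrightarrow> f t u \<le> f t 0"
  using f_le[of u t] m_pos mult_nonneg_nonneg[of m u] by linarith

lemma f_le_K: "0 \<le> u \<Longrightarrow> f t u \<le> K"
  using f_le_f0[of u t] f0_le[of t] by linarith

lemma f_bound:
  assumes "0 \<le> u" "u \<le> R"
  shows "\<bar>f t u\<bar> \<le> K + M * R"
proof -
  have "M * u \<le> M * R" "0 \<le> M * u" using assms M_pos by (auto intro: mult_left_mono)
  then show ?thesis using f_ge[OF assms(1), of t] f_le_K[OF assms(1), of t] f0_le[of t] by linarith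
qed

lemma reaction_bound: "0 \<le> u \<Longrightarrow> u \<le> R \<Longrightarrow> \<bar>u * f t u\<bar> \<le> R * (K + M * R)"
  unfolding abs_mult by (intro mult_mono f_bound) auto

text \<open>The product \<open>x * f t x\<close> is treated by
  \<open>x * (f t x - f t y) + (x - y) * f t y\<close>. Like the constant in \<open>lip\<close>,
  \<open>A\<close> depends on the time interval, which is why flows are first built on compact
  intervals.\<close>

lemma reaction_lipschitz:
  assumes "0 \<le> B"
  obtains A where "0 \<le> A"
    "\<And>t x y. t \<in> {s..T} \<Longrightarrow> \<bar>x\<bar> \<le> B \<Longrightarrow> \<bar>y\<bar> \<le> B \<Longrightarrow> \<bar>x * f t x - y * f t y\<bar> \<le> A * \<bar>x - y\<bar>"
proof -
  obtain L0 where L0: "\<forall>t\<in>{s..T}. L0-lipschitz_on UNIV (f t)" using lip by blast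
  define L where "L = \<bar>L0\<bar>"
  have L: "0 \<le> L" by (simp add: L_def)
  have lip': "\<bar>f t x - f t y\<bar> \<le> L * \<bar>x - y\<bar>" if "t \<in> {s..T}" for t x y
  proof -
    have "\<bar>f t x - f t y\<bar> \<le> L0 * \<bar>x - y\<bar>"
      using lipschitz_onD[of L0 UNIV "f t" x y] L0 that by (auto simp: dist_real_def)
    also have "\<dots> \<le> L * \<bar>x - y\<bar>" by (auto simp: L_def intro!: mult_right_mono)
    finally show ?thesis .
  qed
  show ?thesis
  proof (rule that[of "B * L + (K + L * B)"])
    show "0 \<le> B * L + (K + L * B)" using L assms K_pos by simp
    fix t x y assume t: "t \<in> {s..T}" and xy: "\<bar>x\<bar> \<le> B" "\<bar>y\<bar> \<le> B"
    have "\<bar>f t y\<bar> \<le> K + L * \<bar>y\<bar>" using lip'[OF t, of y 0] f0_le[of t] by auto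
    also have "\<dots> \<le> K + L * B" using xy L by (auto intro: mult_left_mono)
    finally have fy: "\<bar>f t y\<bar> \<le> K + L * B" .
    have "\<bar>x * f t x - y * f t y\<bar> = \<bar>x * (f t x - f t y) + (x - y) * f t y\<bar>" by (simp add: algebra_simps)
    also have "\<dots> \<le> \<bar>x\<bar> * \<bar>f t x - f t y\<bar> + \<bar>x - y\<bar> * \<bar>f t y\<bar>"
      by (metis abs_mult abs_triangle_ineq)
    also have "\<dots> \<le> B * (L * \<bar>x - y\<bar>) + \<bar>x - y\<bar> * (K + L * B)"
      by (intro add_mono mult_mono lip' t xy fy order_refl) (use assms in auto)
    finally show "\<bar>x * f t x - y * f t y\<bar> \<le> (B * L + (K + L * B)) * \<bar>x - y\<bar>"
      by (simp add: algebra_simps)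
  qed
qed

lemma flow_mono:
  assumes u: "lattice_flow f {s..T} u" and v: "lattice_flow f {s..T} v"
    and ub: "\<And>t i. t \<in> {s..T} \<Longrightarrow> \<bar>u t i\<bar> \<le> B" and vb: "\<And>t i. t \<in> {s..T} \<Longrightarrow> \<bar>v t i\<bar> \<le> B"
    and init: "\<And>i. u s i \<le> v s i" and t: "t \<in> {s..T}"
  shows "u t i \<le> v t i"
proof -
  have "0 \<le> B" using ub[OF t, of i] by linarith
  then obtain A where A: "0 \<le> A" "\<And>t x y. t \<in> {s..T} \<Longrightarrow> \<bar>x\<bar> \<le> B \<Longrightarrow> \<bar>y\<bar> \<le> B \<Longrightarrow>
      \<bar>x * f t x - y * f t y\<bar> \<le> A * \<bar>x - y\<bar>"
    using reaction_lipschitz by blast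
  have "0 \<le> v t i - u t i"
  proof (rule lattice_comparison[where s = s and T = T and z = "\<lambda>t i. v t i - u t i" and A = A and B = "2 * B"])
    show "continuous_on {s..T} (\<lambda>t. v t i - u t i)" for i
      using u v by (intro continuous_intros lattice_flow_continuous)
    show "- (2 * B) \<le> v t i - u t i" if "t \<in> {s..T}" for t i
      using ub[OF that, of i] vb[OF that, of i] by linarith
    show "0 \<le> v s i - u s i" for i using init by simp
    fix t i assume "s < t" "t \<le> T" and neg: "v t i - u t i < 0"
    then have t: "t \<in> {s..T}" by simp
    have "\<bar>v t i * f t (v t i) - u t i * f t (u t i)\<bar> \<le> A * \<bar>v t i - u t i\<bar>"
      by (intro A t ub vb)
    \<comment> \<open>Where \<open>v - u\<close> is negative, \<open>A * \<bar>v - u\<bar>\<close>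
      equals \<open>- A * (v - u)\<close>, so the two-sided Lipschitz bound becomes the required
      lower bound.\<close>
    then have "A * (v t i - u t i) \<le> v t i * f t (v t i) - u t i * f t (u t i)"
      using neg by (simp add: algebra_simps)
    then show "\<exists>D. ((\<lambda>\<tau>. v \<tau> i - u \<tau> i) has_real_derivative D) (at t within {s..T}) \<and>
          dlap (\<lambda>i. v t i - u t i) i + A * (v t i - u t i) \<le> D"
      by - (rule exI, rule conjI, rule DERIV_diff[OF lattice_flowD[OF v t] lattice_flowD[OF u t]],
         simp add: dlap_def)
  qed (rule t)
  then show ?thesis by simp
qed

lemma flow_unique:
  assumes "lattice_flow f {s..T} u" "lattice_flow f {s..T} v"
    and "\<And>t i. t \<in> {s..T} \<Longrightarrow> \<bar>u t i\<bar> \<le> B" "\<And>t i. t \<in> {s..T} \<Longrightarrow> \<bar>v t i\<bar> \<le> B"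
    and "\<And>i. u s i = v s i" and "t \<in> {s..T}"
  shows "u t i = v t i"
  using flow_mono[of s T u v B t i] flow_mono[of s T v u B t i] assms by (simp add: order.antisym)

text \<open>Clamping the state to \<open>[0, R]\<close> makes the reaction globally Lipschitz, so
  Picard iteration applies. The solution stays where the clamp is inactive: below 0 the clamped
  reaction vanishes, above \<open>R \<ge> M\<^sub>0\<close> it is nonpositive.\<close>

lemma flow_exists_compact:
  assumes sT: "s \<le> T" and u0: "\<And>i. 0 \<le> u0 i" "\<And>i. u0 i \<le> R" and R: "M\<^sub>0 \<le> R"
  obtains u where "lattice_flow f {s..T} u" "\<And>i. u s i = u0 i"
    "\<And>t i. t \<in> {s..T} \<Longrightarrow> 0 \<le> u t i" "\<And>t i. t \<in> {s..T} \<Longrightarrow> u t i \<le> R"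
proof -
  have R_pos: "0 < R" using R M0_pos by simp
  define c where "c = (\<lambda>x. max 0 (min R x))"
  have c_le: "\<bar>c x\<bar> \<le> R" and c_lip: "\<bar>c x - c y\<bar> \<le> \<bar>x - y\<bar>" for x y
    using R_pos by (auto simp: c_def)
  define g where "g = (\<lambda>t x. c x * f t (c x))"
  obtain A where A: "0 \<le> A" "\<And>t x y. t \<in> {s..T} \<Longrightarrow> \<bar>x\<bar> \<le> R \<Longrightarrow> \<bar>y\<bar> \<le> R \<Longrightarrow>
      \<bar>x * f t x - y * f t y\<bar> \<le> A * \<bar>x - y\<bar>"
    using reaction_lipschitz[of R] R_pos by (metis less_imp_le)
  have g_lip: "\<bar>g t x - g t y\<bar> \<le> A * \<bar>x - y\<bar>" if "t \<in> {s..T}" for t x y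
    using A(2)[OF that c_le c_le, of x y] mult_left_mono[OF c_lip A(1), of x y]
    unfolding g_def by linarith
  have g_cont: "continuous_on {s..T} (\<lambda>t. g t x)" for x
    unfolding g_def by (intro continuous_intros continuous_on_subset[OF cont_t]) auto
  obtain u B where us: "\<And>i. u s i = u0 i" and uB: "\<And>t i. t \<in> {s..T} \<Longrightarrow> \<bar>u t i\<bar> \<le> B"
    and ud: "\<And>t i. t \<in> {s..T} \<Longrightarrow>
       ((\<lambda>\<tau>. u \<tau> i) has_real_derivative dlap (u t) i + g t (u t i)) (at t within {s..T})"
    by (rule lattice_ivp_exists[OF sT A(1) g_lip g_cont, of u0 R]) (use u0 in auto)
  have u_cont: "continuous_on {s..T} (\<lambda>t. u t i)" for i by (rule DERIV_continuous_on[OF ud])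
  have u_ge: "0 \<le> u t i" if "t \<in> {s..T}" for t i
  proof (rule lattice_comparison[where s = s and T = T and z = u and A = 0 and B = B, OF u_cont])
    show "- B \<le> u t i" if "t \<in> {s..T}" for t i using uB[OF that, of i] by linarith
    fix t i assume "s < t" "t \<le> T" "u t i < 0"
    then show "\<exists>D. ((\<lambda>\<tau>. u \<tau> i) has_real_derivative D) (at t within {s..T}) \<and>
        dlap (u t) i + 0 * u t i \<le> D"
      using ud[of t i] by (intro exI[of _ "dlap (u t) i + g t (u t i)"]) (auto simp: g_def c_def)
  qed (use u0 us that in auto)
  have u_le: "0 \<le> R - u t i" if "t \<in> {s..T}" for t i
  proof (rule lattice_comparison[where s = s and T = T and z = "\<lambda>t i. R - u t i" and A = 0 and B = B])
    show "continuous_on {s..T} (\<lambda>t. R - u t i)" for i by (intro continuous_intros u_cont)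
    show "- B \<le> R - u t i" if "t \<in> {s..T}" for t i using uB[OF that, of i] R_pos by linarith
    fix t i assume *: "s < t" "t \<le> T" "R - u t i < 0"
    then have t: "t \<in> {s..T}" by simp
    have "c (u t i) = R" using R_pos * by (simp add: c_def)
    then have "g t (u t i) \<le> 0" using R_pos f_neg[OF R, of t] by (simp add: g_def mult_nonneg_nonpos)
    then show "\<exists>D. ((\<lambda>\<tau>. R - u \<tau> i) has_real_derivative D) (at t within {s..T}) \<and>
        dlap (\<lambda>i. R - u t i) i + 0 * (R - u t i) \<le> D"
      by - (rule exI, rule conjI, rule DERIV_diff[OF DERIV_const ud[OF t]], simp add: dlap_def)
  qed (use u0 us that in auto)
  show ?thesis
  proof (rule that[of u])
    show "lattice_flow f {s..T} u"
      unfolding lattice_flow_def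
    proof (intro ballI allI)
      fix t i assume t: "t \<in> {s..T}"
      have "c (u t i) = u t i" using u_ge[OF t, of i] u_le[OF t, of i] by (simp add: c_def)
      then show "((\<lambda>\<tau>. u \<tau> i) has_real_derivative dlap (u t) i + u t i * f t (u t i)) (at t within {s..T})"
        using ud[OF t, of i] by (simp add: g_def)
    qed
  qed (use us u_ge u_le in auto)
qed

lemma flow_exists:
  assumes u0: "\<And>i. 0 \<le> u0 i" "\<And>i. u0 i \<le> R" and R: "M\<^sub>0 \<le> R"
  obtains u where "lattice_flow f {s..} u" "\<And>i. u s i = u0 i"
    "\<And>t i. s \<le> t \<Longrightarrow> 0 \<le> u t i" "\<And>t i. s \<le> t \<Longrightarrow> u t i \<le> R"
proof -
  have "\<forall>n::nat. \<exists>u. lattice_flow f {s..s + real n + 1} u \<and> (\<forall>i. u s i = u0 i) \<and>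
      (\<forall>t\<in>{s..s + real n + 1}. \<forall>i. 0 \<le> u t i \<and> u t i \<le> R)"
  proof
    fix n :: nat
    have "s \<le> s + real n + 1" by simp
    then show "\<exists>u. lattice_flow f {s..s + real n + 1} u \<and> (\<forall>i. u s i = u0 i) \<and>
      (\<forall>t\<in>{s..s + real n + 1}. \<forall>i. 0 \<le> u t i \<and> u t i \<le> R)"
      by (rule flow_exists_compact[OF _ _ _ R, of _ _ u0]) (use u0 in blast)+
  qed
  then obtain U where U: "\<And>n::nat. lattice_flow f {s..s + real n + 1} (U n)"
      "\<And>n i. U n s i = u0 i" "\<And>n t i. t \<in> {s..s + real n + 1} \<Longrightarrow> 0 \<le> U n t i \<and> U n t i \<le> R"
    by metis
  have agree: "U n t i = U k t i" if "t \<in> {s..s + real n + 1}" "t \<in> {s..s + real k + 1}" for n k t i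
  proof (rule flow_unique[where s = s and T = t and B = R and u = "U n" and v = "U k"])
    show "lattice_flow f {s..t} (U n)" "lattice_flow f {s..t} (U k)"
      using that by (auto intro: lattice_flow_subset[OF U(1)])
    show "\<bar>U n t' i\<bar> \<le> R" "\<bar>U k t' i\<bar> \<le> R" if "t' \<in> {s..t}" for t' i
      using U(3)[of t' n i] U(3)[of t' k i] that \<open>t \<in> {s..s + real n + 1}\<close> \<open>t \<in> {s..s + real k + 1}\<close>
      by auto
  qed (use U that in auto)
  \<comment> \<open>Uniqueness makes the pieces agree on overlaps. The extra unit in
    \<open>s + real n + 1\<close> leaves room to the right of \<open>t\<close>, as needed for the
    derivative within \<open>{s..}\<close>.\<close>
  define u where "u = (\<lambda>t. U (nat \<lceil>t - s\<rceil>) t)"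
  have u_eq: "u t i = U n t i" if "t \<in> {s..s + real n + 1}" for t i n
    unfolding u_def
    by (rule agree[OF _ that]) (use that real_nat_ceiling_ge[of "t - s"] in \<open>simp, linarith\<close>)
  have n_ex: "\<exists>n::nat. t < s + real n + 1" for t
    using real_nat_ceiling_ge[of "t - s"] by (intro exI[of _ "nat \<lceil>t - s\<rceil>"]) linarith
  show ?thesis
  proof (rule that[of u])
    show "lattice_flow f {s..} u"
      unfolding lattice_flow_def
    proof (intro ballI allI)
      fix t i assume t: "t \<in> {s..}"
      obtain n :: nat where n: "t < s + real n + 1" using n_ex by blast
      have "((\<lambda>\<tau>. U n \<tau> i) has_real_derivative dlap (U n t) i + U n t i * f t (U n t i))
          (at t within {s..s + real n + 1})"
        using t n by (intro lattice_flowD[OF U(1)]) auto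
      then have "((\<lambda>\<tau>. u \<tau> i) has_real_derivative dlap (U n t) i + U n t i * f t (U n t i))
          (at t within {s..s + real n + 1})"
        by (rule has_field_derivative_transform_within[of _ _ _ _ 1]) (use t n u_eq in auto)
      also have "at t within {s..s + real n + 1} = at t within {s..}"
        by (rule at_within_nhd[of _ "{..<s + real n + 1}"]) (use n in auto)
      finally show "((\<lambda>\<tau>. u \<tau> i) has_real_derivative dlap (u t) i + u t i * f t (u t i)) (at t within {s..})"
        using u_eq[of t n] t n by (simp add: dlap_def)
    qed
    show "u s i = u0 i" for i using u_eq[of s 0 i] U(2) by simp
    fix t i assume t: "s \<le> t"
    obtain n :: nat where n: "t < s + real n + 1" using n_ex by blast
    then show "0 \<le> u t i" "u t i \<le> R" using U(3)[of t n i] u_eq[of t n i] t by auto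
  qed
qed

text \<open>One Lipschitz constant serves all sites, so a bounded flow is continuous in time for the
  sup norm, as \<open>lattice_solution\<close> demands.\<close>

lemma flow_bounded_lipschitz:
  assumes u: "lattice_flow f S u" and S: "convex S"
    and b: "\<And>t i. t \<in> S \<Longrightarrow> 0 \<le> u t i \<and> u t i \<le> R" and tt: "t \<in> S" "t' \<in> S"
  shows "\<bar>u t i - u t' i\<bar> \<le> (4 * R + R * (K + M * R)) * \<bar>t - t'\<bar>"
proof -
  have "\<bar>dlap (u t) i + u t i * f t (u t i)\<bar> \<le> 4 * R + R * (K + M * R)" if "t \<in> S" for t
    using reaction_bound[of "u t i" R t] b[OF that, of i] b[OF that, of "i+1"] b[OF that, of "i-1"]
    unfolding dlap_def by linarith
  then show ?thesis
    using field_differentiable_bound[OF S lattice_flowD[OF u], of i "4 * R + R * (K + M * R)" t t'] tt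
    by simp
qed

text \<open>Resolves the definite description. A competing solution is continuous in norm, hence
  bounded on \<open>{s..t}\<close>, and \<open>flow_unique\<close> applies to it.\<close>

lemma lattice_sol_flow:
  assumes u0: "\<And>i. 0 \<le> apply_bcontfun u0 i"
  obtains u where "lattice_flow f {s..} u" "\<And>i. u s i = apply_bcontfun u0 i"
    "\<And>t i. s \<le> t \<Longrightarrow> 0 \<le> u t i" "\<And>t i. s \<le> t \<Longrightarrow> u t i \<le> max M\<^sub>0 (norm u0)"
    "\<And>t i. s \<le> t \<Longrightarrow> apply_bcontfun (lattice_sol f t s u0) i = u t i"
proof -
  define R where "R = max M\<^sub>0 (norm u0)"
  have "apply_bcontfun u0 i \<le> R" for i using norm_bounded[of u0 i] by (auto simp: R_def)
  then obtain u where u: "lattice_flow f {s..} u" "\<And>i. u s i = apply_bcontfun u0 i"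
    "\<And>t i. s \<le> t \<Longrightarrow> 0 \<le> u t i" "\<And>t i. s \<le> t \<Longrightarrow> u t i \<le> R"
    using flow_exists[of "apply_bcontfun u0" R s] u0 by (metis R_def max.cobounded1)
  \<comment> \<open>\<open>max s t\<close> freezes the solution before time \<open>s\<close>, so
    \<open>Bcontfun\<close> receives a bounded function at every time.\<close>
  define U where "U = (\<lambda>t. Bcontfun (u (max s t)))"
  have "u (max s t) \<in> bcontfun" for t
    by (rule bcontfun_normI[of _ R]) (use u(3,4) in auto)
  then have U_max: "apply_bcontfun (U t) i = u (max s t) i" for t i
    unfolding U_def by (simp add: Bcontfun_inverse)
  have U_apply: "apply_bcontfun (U t) i = u t i" if "s \<le> t" for t i
    using U_max[of t i] that by (simp add: max_def)
  have U_sol: "lattice_solution f {s..} U"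
    unfolding lattice_solution_iff_flow
  proof
    have "(4 * R + R * (K + M * R))-lipschitz_on {s..} U"
    proof (rule lipschitz_onI)
      fix t t' assume t: "t \<in> {s..}" "t' \<in> {s..}"
      show "dist (U t) (U t') \<le> (4 * R + R * (K + M * R)) * dist t t'"
      proof (rule dist_bound)
        fix i
        have "\<bar>u t i - u t' i\<bar> \<le> (4 * R + R * (K + M * R)) * \<bar>t - t'\<bar>"
          by (rule flow_bounded_lipschitz[OF u(1)]) (use u t in auto)
        then show "dist (apply_bcontfun (U t) i) (apply_bcontfun (U t') i)
            \<le> (4 * R + R * (K + M * R)) * dist t t'"
          using t by (simp add: U_apply dist_real_def)
      qed
    next
      show "0 \<le> 4 * R + R * (K + M * R)" using M0_pos K_pos M_pos by (auto simp: R_def)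
    qed
    then show "continuous_on {s..} U" by (rule lipschitz_on_continuous_on)
    show "lattice_flow f {s..} (\<lambda>t. apply_bcontfun (U t))"
      unfolding lattice_flow_def
    proof (intro ballI allI)
      fix t i assume t: "t \<in> {s..}"
      then have "apply_bcontfun (U t) = u t" by (auto simp: U_apply)
      then show "((\<lambda>\<tau>. apply_bcontfun (U \<tau>) i) has_real_derivative dlap (apply_bcontfun (U t)) i +
          apply_bcontfun (U t) i * f t (apply_bcontfun (U t) i)) (at t within {s..})"
        using has_field_derivative_transform_within[OF lattice_flowD[OF u(1) t, of i], of 1 "\<lambda>\<tau>. apply_bcontfun (U \<tau>) i"] t
        by (auto simp: U_apply)
    qed
  qed
  have "lattice_sol f t s u0 = U t" if t: "s \<le> t" for t
    unfolding lattice_sol_def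
  proof (rule the_equality)
    show "\<exists>W. lattice_solution f {s..} W \<and> W s = u0 \<and> W t = U t"
      by (intro exI[of _ U] conjI U_sol bcontfun_eqI) (auto simp: U_apply u(2))
    fix v assume "\<exists>W. lattice_solution f {s..} W \<and> W s = u0 \<and> W t = v"
    then obtain W where W: "lattice_solution f {s..} W" "W s = u0" "W t = v" by blast
    have Wc: "continuous_on {s..} W" and Wf: "lattice_flow f {s..} (\<lambda>t. apply_bcontfun (W t))"
      using W(1) by (auto simp: lattice_solution_iff_flow)
    have "bounded (W ` {s..t})"
      by (intro compact_imp_bounded compact_continuous_image continuous_on_subset[OF Wc]) auto
    then obtain B where B: "\<And>\<tau>. \<tau> \<in> {s..t} \<Longrightarrow> norm (W \<tau>) \<le> B"
      unfolding bounded_iff by blast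
    have "apply_bcontfun (W t) i = u t i" for i
    proof (rule flow_unique[where s = s and T = t and B = "max R B" and u = "\<lambda>t. apply_bcontfun (W t)" and v = u])
      show "lattice_flow f {s..t} (\<lambda>t. apply_bcontfun (W t))" "lattice_flow f {s..t} u"
        using Wf u(1) by (auto elim: lattice_flow_subset)
      show "\<bar>apply_bcontfun (W \<tau>) i\<bar> \<le> max R B" if "\<tau> \<in> {s..t}" for \<tau> i
        using norm_bounded[of "W \<tau>" i] B[OF that] by simp
      show "\<bar>u \<tau> i\<bar> \<le> max R B" if "\<tau> \<in> {s..t}" for \<tau> i
        using u(3,4)[of \<tau> i] that by simp
    qed (use W u t in auto)
    then show "v = U t" using W(3) t by (auto intro!: bcontfun_eqI simp: U_apply)
  qed
  then show ?thesis using u(4) U_apply by (intro that[OF u(1,2,3)]) (auto simp: R_def)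
qed

end

section \<open>Ratios of solutions\<close>

definition scalar_flow :: "(real \<Rightarrow> real \<Rightarrow> real) \<Rightarrow> real set \<Rightarrow> (real \<Rightarrow> real) \<Rightarrow> bool" where
  "scalar_flow f S w \<longleftrightarrow> (\<forall>t\<in>S. (w has_real_derivative w t * f t (w t)) (at t within S))"

lemma scalar_flow_subset: "scalar_flow f S w \<Longrightarrow> S' \<subseteq> S \<Longrightarrow> scalar_flow f S' w"
  unfolding scalar_flow_def by (meson DERIV_subset subsetD)

lemma scalar_flowD:
  "scalar_flow f S w \<Longrightarrow> t \<in> S \<Longrightarrow> (w has_real_derivative w t * f t (w t)) (at t within S)"
  by (simp add: scalar_flow_def)

lemma scalar_flow_continuous: "scalar_flow f S w \<Longrightarrow> continuous_on S w"
  by (rule DERIV_continuous_on) (rule scalar_flowD)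

lemma scalar_flow_iff_lattice_flow: "scalar_flow f S w \<longleftrightarrow> lattice_flow f S (\<lambda>t i. w t)"
  by (simp add: scalar_flow_def lattice_flow_def dlap_def)

lemma int_shift_invariant:
  fixes h :: "int \<Rightarrow> 'a"
  assumes "\<And>i. h (i + 1) = h i"
  shows "h i = h 0"
proof (induction i rule: int_induct[where k = 0])
  case (step2 i)
  then show ?case using assms[of "i - 1"] by simp
qed (use assms in auto)

lemma nondecreasing_if_deriv_nonneg:
  fixes h :: "real \<Rightarrow> real"
  assumes ab: "a \<le> b" and d: "\<And>t. t \<in> {a..b} \<Longrightarrow> (h has_real_derivative h' t) (at t within {a..b})"
    and nn: "\<And>t. t \<in> {a..b} \<Longrightarrow> 0 \<le> h' t"
  shows "h a \<le> h b"
proof (rule DERIV_nonneg_imp_increasing_open[OF ab])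
  fix t assume t: "a < t" "t < b"
  then have "at t within {a..b} = at t" by (simp add: at_within_Icc_at)
  then show "\<exists>y. (h has_real_derivative y) (at t) \<and> 0 \<le> y"
    using d[of t] nn[of t] t by auto
qed (rule DERIV_continuous_on[OF d])

context kpp_reaction
begin

text \<open>\<open>strict\<close> yields a gap for one pair of arguments at a time. On a grid of
  mesh \<open>c / 2\<close> every interval of length at least \<open>c\<close> inside
  \<open>[0, B]\<close> contains a full cell, and the least of finitely many gaps serves all
  pairs.\<close>

lemma strict_uniform:
  assumes c: "0 < c"
  obtains \<eta> where "0 < \<eta>" "\<And>t x y. 0 \<le> x \<Longrightarrow> x + c \<le> y \<Longrightarrow> y \<le> B \<Longrightarrow> f t y \<le> f t x - \<eta>"
proof -
  obtain N :: nat where N: "B \<le> real N * (c / 2)"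
    using c by (metis ex_less_of_nat_mult half_gt_zero less_imp_le)
  have "\<exists>\<eta>. \<forall>k::nat. 0 < \<eta> k \<and> (\<forall>t. f t ((real k + 1) * (c / 2)) \<le> f t (real k * (c / 2)) - \<eta> k)"
    using c by (intro choice allI) (use strict in \<open>simp add: algebra_simps\<close>)
  then obtain \<eta> where \<eta>: "\<And>k::nat. 0 < \<eta> k"
      "\<And>k t. f t ((real k + 1) * (c / 2)) \<le> f t (real k * (c / 2)) - \<eta> k" by blast
  have anti: "f t y \<le> f t x" if "0 \<le> x" "x \<le> y" for t x y
    using strict[of x y] that by (cases "x = y") (auto, smt (verit))
  define \<eta>' where "\<eta>' = Min (\<eta> ` {..N})"
  have le: "\<eta>' \<le> \<eta> k" if "k \<le> N" for k unfolding \<eta>'_def using that by (intro Min_le) auto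
  show ?thesis
  proof (rule that[of \<eta>'])
    show "0 < \<eta>'" unfolding \<eta>'_def using \<eta>(1) by (subst Min_gr_iff) auto
    fix t x y assume *: "0 \<le> x" "x + c \<le> y" "y \<le> B"
    \<comment> \<open>The first grid point not below \<open>x\<close>; the next one still lies below
      \<open>x + c\<close>.\<close>
    define k where "k = nat \<lceil>x / (c / 2)\<rceil>"
    have "real k = of_int \<lceil>x / (c / 2)\<rceil>"
      using * c less_le_trans[of "-1" 0 "x * 2 / c"] by (simp add: k_def)
    then have k: "x / (c / 2) \<le> real k" "real k < x / (c / 2) + 1"
      using ceiling_correct[of "x / (c / 2)"] by linarith+
    then have kx: "x \<le> real k * (c / 2)" "(real k + 1) * (c / 2) \<le> y"
      using c * by (auto simp: field_simps)
    have "(real k + 1) * (c / 2) \<le> real N * (c / 2)" using kx(2) N *(3) by linarith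
    then have "real k + 1 \<le> real N" using c by simp
    then have "k \<le> N" by simp
    have "f t y \<le> f t ((real k + 1) * (c / 2))" using kx c by (intro anti) auto
    also have "\<dots> \<le> f t (real k * (c / 2)) - \<eta> k" by (rule \<eta>(2))
    also have "\<dots> \<le> f t x - \<eta>'" using le[OF \<open>k \<le> N\<close>] anti[OF *(1) kx(1), of t] by linarith
    finally show "f t y \<le> f t x - \<eta>'" .
  qed
qed

text \<open>\<open>w\<close> is constant in space, so \<open>dlap\<close> commutes with division by
  it. Of the reaction only the difference of growth rates survives; for nonnegative values it has
  the sign of \<open>w - u\<close>.\<close>

lemma ratio_deriv:
  assumes u: "lattice_flow f S u" and w: "scalar_flow f S w" and t: "t \<in> S" and w0: "w t \<noteq> 0"
  shows "((\<lambda>\<tau>. u \<tau> i / w \<tau>) has_real_derivative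
     dlap (\<lambda>i. u t i / w t) i + u t i / w t * (f t (u t i) - f t (w t))) (at t within S)"
  by (rule DERIV_cong[OF DERIV_divide[OF lattice_flowD[OF u t] scalar_flowD[OF w t] w0]])
     (use w0 in \<open>simp add: dlap_def field_simps\<close>)

text \<open>A spatially constant barrier descends at rate \<open>\<eta>\<close> from above the a
  priori bound \<open>Q\<close> to \<open>1 + \<epsilon>\<close>. Where the ratio exceeds it,
  \<open>u\<close> exceeds \<open>w\<close> by at least \<open>\<epsilon> * \<delta>\<close> and the
  ratio is above 1, so the reaction pushes the ratio down at least as fast.\<close>

lemma ratio_upper:
  assumes \<delta>: "0 < \<delta>" and \<epsilon>: "0 < \<epsilon>"
  obtains T where "0 < T"
    "\<And>s u w i. lattice_flow f {s..s + T} u \<Longrightarrow> scalar_flow f {s..s + T} w \<Longrightarrow>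
       (\<And>t. t \<in> {s..s + T} \<Longrightarrow> \<delta> \<le> w t) \<Longrightarrow>
       (\<And>t i. t \<in> {s..s + T} \<Longrightarrow> 0 \<le> u t i \<and> u t i \<le> B) \<Longrightarrow>
       u (s + T) i \<le> (1 + \<epsilon>) * w (s + T)"
proof -
  obtain \<eta> where \<eta>: "0 < \<eta>" "\<And>t x y. 0 \<le> x \<Longrightarrow> x + \<epsilon> * \<delta> \<le> y \<Longrightarrow> y \<le> B \<Longrightarrow> f t y \<le> f t x - \<eta>"
    using strict_uniform[of "\<epsilon> * \<delta>" B] \<delta> \<epsilon> by auto
  define Q where "Q = (\<bar>B\<bar> + 1) / \<delta>"
  have Q: "0 < Q" using \<delta> by (simp add: Q_def)
  define T where "T = Q / \<eta>"
  have T: "0 < T" using Q \<eta> by (simp add: T_def)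
  show ?thesis
  proof (rule that[OF T])
    fix s u w i
    assume u: "lattice_flow f {s..s + T} u" and w: "scalar_flow f {s..s + T} w"
      and w\<delta>: "\<And>t. t \<in> {s..s + T} \<Longrightarrow> \<delta> \<le> w t"
      and uB: "\<And>t i. t \<in> {s..s + T} \<Longrightarrow> 0 \<le> u t i \<and> u t i \<le> B"
    define q where "q = (\<lambda>t i. u t i / w t)"
    have w_pos: "0 < w t" if "t \<in> {s..s + T}" for t using w\<delta>[OF that] \<delta> by linarith
    have q_le: "q t i \<le> Q" if "t \<in> {s..s + T}" for t i
      unfolding q_def Q_def using uB[OF that, of i] w\<delta>[OF that] \<delta> by (intro frac_le) auto
    define \<mu> where "\<mu> = (\<lambda>t. 1 + \<epsilon> + Q - \<eta> * (t - s))"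
    have \<mu>_ge: "1 + \<epsilon> \<le> \<mu> t" if "t \<in> {s..s + T}" for t
    proof -
      have "\<eta> * (t - s) \<le> \<eta> * T" using that \<eta> by (intro mult_left_mono) auto
      then show ?thesis using \<eta> by (simp add: \<mu>_def T_def)
    qed
    have "0 \<le> \<mu> (s + T) - q (s + T) i"
    proof (rule lattice_comparison[where s = s and T = "s + T" and z = "\<lambda>t i. \<mu> t - q t i" and A = 0 and B = Q])
      show "continuous_on {s..s + T} (\<lambda>t. \<mu> t - q t i)" for i
        unfolding \<mu>_def q_def
        by (intro continuous_intros lattice_flow_continuous[OF u] scalar_flow_continuous[OF w])
           (use w_pos in force)
      show "- Q \<le> \<mu> t - q t i" if "t \<in> {s..s + T}" for t i
        using q_le[OF that, of i] \<mu>_ge[OF that] \<epsilon> by linarith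
      show "0 \<le> \<mu> s - q s i" for i using q_le[of s i] \<epsilon> T by (simp add: \<mu>_def)
      fix t i assume "s < t" "t \<le> s + T" and neg: "\<mu> t - q t i < 0"
      then have t: "t \<in> {s..s + T}" by simp
      have q1: "1 + \<epsilon> < q t i" using neg \<mu>_ge[OF t] by linarith
      then have "(1 + \<epsilon>) * w t < u t i" using w_pos[OF t] by (simp add: q_def field_simps)
      moreover have "\<epsilon> * \<delta> \<le> \<epsilon> * w t" using w\<delta>[OF t] \<epsilon> by simp
      ultimately have "w t + \<epsilon> * \<delta> \<le> u t i" by (simp add: algebra_simps)
      then have "f t (u t i) - f t (w t) \<le> - \<eta>"
        using \<eta>(2)[of "w t" "u t i" t] w_pos[OF t] uB[OF t, of i] by simp
      then have "q t i * (f t (u t i) - f t (w t)) \<le> q t i * (- \<eta>)"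
        using q1 \<epsilon> by (intro mult_left_mono) auto
      also have "\<dots> \<le> 1 * (- \<eta>)" using q1 \<epsilon> \<eta>(1) by (intro mult_right_mono_neg) auto
      finally have le: "q t i * (f t (u t i) - f t (w t)) \<le> - \<eta>" by simp
      have d: "((\<lambda>\<tau>. q \<tau> i) has_real_derivative dlap (q t) i + q t i * (f t (u t i) - f t (w t)))
          (at t within {s..s + T})"
        unfolding q_def using w_pos[OF t] by (intro ratio_deriv[OF u w t]) auto
      have "(\<mu> has_real_derivative - \<eta>) (at t within {s..s + T})"
        unfolding \<mu>_def by (auto intro!: derivative_eq_intros)
      from DERIV_diff[OF this d]
      show "\<exists>D. ((\<lambda>\<tau>. \<mu> \<tau> - q \<tau> i) has_real_derivative D) (at t within {s..s + T}) \<and>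
          dlap (\<lambda>i. \<mu> t - q t i) i + 0 * (\<mu> t - q t i) \<le> D"
        by - (rule exI, rule conjI, assumption, insert le, simp add: dlap_def)
    qed (use T in auto)
    moreover have "\<mu> (s + T) = 1 + \<epsilon>" using \<eta> by (simp add: \<mu>_def T_def)
    ultimately have "q (s + T) i \<le> 1 + \<epsilon>" by simp
    then show "u (s + T) i \<le> (1 + \<epsilon>) * w (s + T)"
      using w_pos[of "s + T"] T by (simp add: q_def field_simps)
  qed
qed

text \<open>The subsolution for the ratio is a slowly rising plateau minus the parabola
  \<open>\<beta> * (\<bar>i - j\<bar>\<^sup>2 + 2 * (t - s))\<close>, which solves the discrete heat equation.\<close>
lemma ratio_lower:
  assumes \<delta>: "0 < \<delta>" and B: "0 < B" and \<epsilon>: "0 < \<epsilon>" "\<epsilon> < 1"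
  obtains T R where "0 < T"
    "\<And>s u w j. lattice_flow f {s..s + T} u \<Longrightarrow> scalar_flow f {s..s + T} w \<Longrightarrow>
       (\<And>t. t \<in> {s..s + T} \<Longrightarrow> \<delta> \<le> w t \<and> w t \<le> B) \<Longrightarrow>
       (\<And>t i. t \<in> {s..s + T} \<Longrightarrow> 0 \<le> u t i) \<Longrightarrow>
       (\<And>t i. t \<in> {s..s + T} \<Longrightarrow> \<bar>real_of_int (i - j)\<bar> \<le> R \<Longrightarrow> \<delta> \<le> u t i) \<Longrightarrow>
       (1 - \<epsilon>) * w (s + T) \<le> u (s + T) j"
proof -
  obtain \<eta> where \<eta>: "0 < \<eta>" "\<And>t x y. 0 \<le> x \<Longrightarrow> x + \<epsilon> / 2 * \<delta> \<le> y \<Longrightarrow> y \<le> B \<Longrightarrow> f t y \<le> f t x - \<eta>"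
    using strict_uniform[of "\<epsilon> / 2 * \<delta>" B] \<delta> \<epsilon> by auto
  \<comment> \<open>Near \<open>j\<close> the ratio is at least \<open>\<delta> / B\<close>, and
    below \<open>1 - \<epsilon> / 2\<close> the difference of growth rates is at least
    \<open>\<eta>\<close>; the plateau may rise at the rate of the product. \<open>T\<close> is the
    time it takes from -1 to \<open>1 - \<epsilon> / 2\<close>.\<close>
  define \<kappa> where "\<kappa> = \<delta> / B * \<eta>"
  have \<kappa>: "0 < \<kappa>" using \<delta> B \<eta> by (simp add: \<kappa>_def)
  define T where "T = (2 - \<epsilon> / 2) / \<kappa>"
  have T: "0 < T" and \<kappa>T: "\<kappa> * T = 2 - \<epsilon> / 2" using \<kappa> \<epsilon> by (auto simp: T_def)
  \<comment> \<open>With \<open>\<beta> = 1 / R\<^sup>2\<close> the parabola costs at least 1 beyond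
    distance \<open>R\<close>, so the subsolution is negative there;
    \<open>4 * T / \<epsilon>\<close> limits the loss \<open>2 * \<beta> * T\<close> to
    \<open>\<epsilon> / 2\<close>.\<close>
  define R where "R = max 1 (4 * T / \<epsilon>)"
  have R: "1 \<le> R" "4 * T \<le> \<epsilon> * R" using \<epsilon> by (auto simp: R_def field_simps max_def)
  define \<beta> where "\<beta> = 1 / R\<^sup>2"
  have \<beta>: "0 < \<beta>" "\<beta> * R\<^sup>2 = 1" using R by (auto simp: \<beta>_def)
  have \<beta>T: "2 * \<beta> * T \<le> \<epsilon> / 2"
  proof -
    have "4 * T \<le> \<epsilon> * R\<^sup>2"
      using R(2) mult_left_mono[OF self_le_power[OF R(1), of 2], of \<epsilon>] \<epsilon> by linarith
    then show ?thesis using R(1) by (simp add: \<beta>_def field_simps)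
  qed
  show ?thesis
  proof (rule that[OF T])
    fix s u w j
    assume u: "lattice_flow f {s..s + T} u" and w: "scalar_flow f {s..s + T} w"
      and w\<delta>: "\<And>t. t \<in> {s..s + T} \<Longrightarrow> \<delta> \<le> w t \<and> w t \<le> B"
      and u0: "\<And>t i. t \<in> {s..s + T} \<Longrightarrow> 0 \<le> u t i"
      and u\<delta>: "\<And>t i. t \<in> {s..s + T} \<Longrightarrow> \<bar>real_of_int (i - j)\<bar> \<le> R \<Longrightarrow> \<delta> \<le> u t i"
    define q where "q = (\<lambda>t i. u t i / w t)"
    have w_pos: "0 < w t" if "t \<in> {s..s + T}" for t using w\<delta>[OF that] \<delta> by linarith
    have q0: "0 \<le> q t i" if "t \<in> {s..s + T}" for t i
      using u0[OF that, of i] w_pos[OF that] by (simp add: q_def)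
    define \<mu> where "\<mu> = (\<lambda>t. - 1 + \<kappa> * (t - s))"
    have \<mu>_le: "\<mu> t \<le> 1 - \<epsilon> / 2" if "t \<in> {s..s + T}" for t
    proof -
      have "\<kappa> * (t - s) \<le> \<kappa> * T" using that \<kappa> by (intro mult_left_mono) auto
      then show ?thesis using \<kappa> by (simp add: \<mu>_def T_def)
    qed
    define \<psi> where "\<psi> = (\<lambda>t i. \<mu> t - \<beta> * ((real_of_int (i - j))\<^sup>2 + 2 * (t - s)))"
    have \<psi>_le: "\<psi> t i \<le> \<mu> t - \<beta> * (real_of_int (i - j))\<^sup>2" if "t \<in> {s..s + T}" for t i
      using that \<beta> by (simp add: \<psi>_def algebra_simps)
    then have \<psi>_le\<mu>: "\<psi> t i \<le> \<mu> t" if "t \<in> {s..s + T}" for t i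
      using that \<beta>(1) by (smt (verit) mult_nonneg_nonneg zero_le_power2)
    have "0 \<le> q (s + T) j - \<psi> (s + T) j"
    proof (rule lattice_comparison[where s = s and T = "s + T" and z = "\<lambda>t i. q t i - \<psi> t i" and A = 0 and B = 1])
      show "continuous_on {s..s + T} (\<lambda>t. q t i - \<psi> t i)" for i
        unfolding \<mu>_def q_def \<psi>_def
        by (intro continuous_intros lattice_flow_continuous[OF u] scalar_flow_continuous[OF w])
           (use w_pos in force)
      show "- 1 \<le> q t i - \<psi> t i" if "t \<in> {s..s + T}" for t i
        using q0[OF that, of i] \<mu>_le[OF that] \<psi>_le\<mu>[OF that, of i] \<epsilon> by linarith
      show "0 \<le> q s i - \<psi> s i" for i using q0[of s i] \<psi>_le\<mu>[of s i] T by (simp add: \<mu>_def)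
      fix t i assume "s < t" "t \<le> s + T" and neg: "q t i - \<psi> t i < 0"
      then have t: "t \<in> {s..s + T}" by simp
      have near: "\<bar>real_of_int (i - j)\<bar> \<le> R"
      proof (rule ccontr)
        assume "\<not> \<bar>real_of_int (i - j)\<bar> \<le> R"
        then have "R\<^sup>2 \<le> (real_of_int (i - j))\<^sup>2"
          using R(1) by (simp add: abs_le_square_iff[symmetric])
        then have "1 \<le> \<beta> * (real_of_int (i - j))\<^sup>2" using \<beta> by (metis mult_le_cancel_left_pos)
        then show False using \<psi>_le[OF t, of i] \<mu>_le[OF t] q0[OF t, of i] neg \<epsilon> by linarith
      qed
      have q1: "q t i < 1 - \<epsilon> / 2" using neg \<psi>_le\<mu>[OF t, of i] \<mu>_le[OF t] by linarith
      then have "u t i < (1 - \<epsilon> / 2) * w t" using w_pos[OF t] by (simp add: q_def field_simps)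
      moreover have "\<epsilon> / 2 * \<delta> \<le> \<epsilon> / 2 * w t" using w\<delta>[OF t] \<epsilon> by simp
      ultimately have "u t i + \<epsilon> / 2 * \<delta> \<le> w t" by (simp add: algebra_simps)
      then have \<eta>_le: "\<eta> \<le> f t (u t i) - f t (w t)"
        using \<eta>(2)[of "u t i" "w t" t] u0[OF t, of i] w\<delta>[OF t] by simp
      have "\<delta> / B \<le> q t i"
        unfolding q_def using u\<delta>[OF t near] w\<delta>[OF t] \<delta> by (intro frac_le) auto
      then have le: "\<kappa> \<le> q t i * (f t (u t i) - f t (w t))"
        unfolding \<kappa>_def using \<eta>_le \<eta>(1) q0[OF t, of i] by (intro mult_mono) auto
      have d: "((\<lambda>\<tau>. q \<tau> i) has_real_derivative dlap (q t) i + q t i * (f t (u t i) - f t (w t)))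
          (at t within {s..s + T})"
        unfolding q_def using w_pos[OF t] by (intro ratio_deriv[OF u w t]) auto
      have "((\<lambda>\<tau>. \<psi> \<tau> i) has_real_derivative \<kappa> - 2 * \<beta>) (at t within {s..s + T})"
        unfolding \<psi>_def \<mu>_def by (auto intro!: derivative_eq_intros)
      note d' = DERIV_diff[OF d this]
      have "dlap (\<psi> t) i = - 2 * \<beta>"
        unfolding dlap_def \<psi>_def by (simp add: power2_eq_square algebra_simps)
      then have "dlap (\<lambda>i. q t i - \<psi> t i) i = dlap (q t) i + 2 * \<beta>" by (simp add: dlap_def)
      with d' show "\<exists>D. ((\<lambda>\<tau>. q \<tau> i - \<psi> \<tau> i) has_real_derivative D) (at t within {s..s + T}) \<and>
          dlap (\<lambda>i. q t i - \<psi> t i) i + 0 * (q t i - \<psi> t i) \<le> D"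
        by - (rule exI, rule conjI, assumption, insert le, simp)
    qed (use T in auto)
    moreover have "\<psi> (s + T) j \<ge> 1 - \<epsilon>"
      using \<beta>T \<kappa>T by (simp add: \<psi>_def \<mu>_def)
    ultimately have "1 - \<epsilon> \<le> q (s + T) j" by simp
    then show "(1 - \<epsilon>) * w (s + T) \<le> u (s + T) j"
      using w_pos[of "s + T"] T by (simp add: q_def field_simps)
  qed
qed

end

section \<open>The entire solution\<close>

context kpp_reaction
begin

text \<open>The weight cancels the linear growth: the remaining rate is the deviation of
  \<open>f t (w t)\<close> from \<open>f t 0\<close>, plus a margin \<open>c\<close> to absorb
  it.\<close>

lemma scalar_flow_weighted_deriv:
  assumes "scalar_flow f {a..b} w"
  shows "t \<in> {a..b} \<Longrightarrow> ((\<lambda>\<tau>. w \<tau> * exp (c * \<tau> - P \<tau>)) has_real_derivative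
      w t * exp (c * t - P t) * (f t (w t) - f t 0 + c)) (at t within {a..b})"
  by (rule DERIV_cong[OF DERIV_mult[OF scalar_flowD[OF assms]
        DERIV_chain2[OF DERIV_exp DERIV_diff[OF DERIV_cmult_Id DERIV_subset[OF P_deriv]]]]])
     (auto simp: algebra_simps)

text \<open>On the last stretch during which \<open>w\<close> is small, \<open>f t w\<close> is within \<open>r / 2\<close> of \<open>f t 0\<close>, whose
  long-time averages are at least \<open>r\<close>; so \<open>w\<close> can decrease only for a bounded time.\<close>
lemma scalar_flow_lower_bound:
  obtains \<delta> e where "0 < \<delta>" "0 < e"
    "\<And>s t w. s \<le> t \<Longrightarrow> scalar_flow f {s..t} w \<Longrightarrow> (\<And>\<tau>. \<tau> \<in> {s..t} \<Longrightarrow> 0 \<le> w \<tau>) \<Longrightarrow>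
       e \<le> w s \<Longrightarrow> \<delta> \<le> w t"
proof -
  obtain r T where r: "0 < r" "0 < T" "\<And>s t. T \<le> t - s \<Longrightarrow> r * (t - s) \<le> P t - P s"
    using mean by blast
  \<comment> \<open>At heights up to \<open>e\<close> the bound \<open>f_ge\<close> costs at most
    \<open>M * e = r / 2\<close>, half of the mean growth.\<close>
  define e where "e = r / (2 * M)"
  have e: "0 < e" "M * e = r / 2" using r M_pos by (auto simp: e_def)
  \<comment> \<open>A stretch shorter than \<open>T\<close> loses at most the factor
    \<open>exp ((K + r / 2) * T)\<close>; on a longer one the mean growth outweighs the
    loss.\<close>
  define \<delta> where "\<delta> = e * exp (- ((K + r / 2) * T))"
  have \<delta>: "0 < \<delta>" "\<delta> \<le> e" using e r K_pos by (auto simp: \<delta>_def mult_le_cancel_left1)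
  show ?thesis
  proof (rule that[OF \<delta>(1) e(1)])
    fix s t w
    assume st: "s \<le> t" and w: "scalar_flow f {s..t} w" and w0: "\<And>\<tau>. \<tau> \<in> {s..t} \<Longrightarrow> 0 \<le> w \<tau>"
      and ws: "e \<le> w s"
    define C where "C = {s..t} \<inter> w -` {e..}"
    have "closed C"
      unfolding C_def by (rule continuous_closed_preimage[OF scalar_flow_continuous[OF w]]) auto
    moreover have "bounded C" unfolding C_def by (rule bounded_Int) auto
    ultimately have "compact C" by (simp add: compact_eq_bounded_closed)
    moreover have "s \<in> C" using st ws by (simp add: C_def)
    ultimately obtain a where a: "a \<in> C" and a_max: "\<And>\<tau>. \<tau> \<in> C \<Longrightarrow> \<tau> \<le> a"
      using compact_attains_sup[of C] by blast
    have a': "s \<le> a" "a \<le> t" "e \<le> w a" using a by (auto simp: C_def)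
    show "\<delta> \<le> w t"
    proof (cases "a = t")
      case True
      then show ?thesis using a' \<delta> by simp
    next
      case False
      have small: "w \<tau> < e" if "a < \<tau>" "\<tau> \<le> t" for \<tau>
        using a_max[of \<tau>] that a' by (force simp: C_def)
      have small': "w \<tau> \<le> e" if "\<tau> \<in> {a..t}" for \<tau>
      proof (cases "\<tau> = a")
        case True
        have "((\<lambda>\<tau>. w \<tau>) \<longlongrightarrow> w a) (at_right a)"
          by (rule continuous_on_Icc_at_rightD[of a t])
             (use False a' in \<open>auto intro: continuous_on_subset[OF scalar_flow_continuous[OF w]]\<close>)
        moreover have "\<forall>\<^sub>F \<tau> in at_right a. w \<tau> \<le> e"
          using eventually_at_right_real[of a t] False a'
          by (auto elim!: eventually_mono simp: small less_imp_le)
        ultimately show ?thesis using True by (auto intro: tendsto_upperbound)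
      qed (use small[of \<tau>] that in auto)
      have flow: "scalar_flow f {a..t} w" by (rule scalar_flow_subset[OF w]) (use a' in auto)
      have "w a * exp (r / 2 * a - P a) \<le> w t * exp (r / 2 * t - P t)"
      proof (rule nondecreasing_if_deriv_nonneg[OF a'(2) scalar_flow_weighted_deriv[OF flow]])
        fix \<tau> assume \<tau>: "\<tau> \<in> {a..t}"
        have "0 \<le> w \<tau>" using w0[of \<tau>] \<tau> a' by auto
        moreover have "M * w \<tau> \<le> M * e" using small'[OF \<tau>] M_pos by simp
        then have "0 \<le> f \<tau> (w \<tau>) - f \<tau> 0 + r / 2"
          using f_ge[of "w \<tau>" \<tau>] \<open>0 \<le> w \<tau>\<close> e by linarith
        ultimately show "0 \<le> w \<tau> * exp (r / 2 * \<tau> - P \<tau>) * (f \<tau> (w \<tau>) - f \<tau> 0 + r / 2)" by simp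
      qed
      then have "e * exp (r / 2 * a - P a) \<le> w t * exp (r / 2 * t - P t)"
        using a'(3) by (meson exp_ge_zero mult_right_mono order_trans)
      then have "e * exp (r / 2 * a - P a) * exp (- (r / 2 * t - P t))
          \<le> w t * exp (r / 2 * t - P t) * exp (- (r / 2 * t - P t))"
        by (intro mult_right_mono) auto
      moreover have "exp (r / 2 * a - P a) * exp (- (r / 2 * t - P t)) = exp ((P t - P a) - r / 2 * (t - a))"
        unfolding exp_add[symmetric] by (rule arg_cong[of _ _ exp]) (simp add: field_simps)
      ultimately have wt: "e * exp ((P t - P a) - r / 2 * (t - a)) \<le> w t"
        unfolding mult.assoc exp_minus_inverse by simp
      have "- ((K + r / 2) * T) \<le> (P t - P a) - r / 2 * (t - a)"
      proof (cases "T \<le> t - a")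
        case True
        have "0 \<le> (K + r / 2) * T" "r / 2 * (t - a) \<le> r * (t - a)"
          using K_pos r a' by (auto intro!: mult_right_mono)
        then show ?thesis using r(3)[OF True] by linarith
      next
        case F: False
        have "\<bar>P t - P a\<bar> \<le> K * \<bar>t - a\<bar>"
          using field_differentiable_bound[of UNIV P "\<lambda>t. f t 0" K t a] P_deriv f0_le by auto
        then have "\<bar>P t - P a\<bar> \<le> K * (t - a)" using a' by simp
        moreover have "K * (t - a) \<le> K * T" "r / 2 * (t - a) \<le> r / 2 * T"
          using F K_pos r a' by (auto intro!: mult_left_mono)
        ultimately show ?thesis unfolding distrib_right by linarith
      qed
      then have "\<delta> \<le> e * exp ((P t - P a) - r / 2 * (t - a))"
        unfolding \<delta>_def using e by simp
      then show ?thesis using wt by simp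
    qed
  qed
qed

text \<open>The reciprocal \<open>p = 1 / w\<close> satisfies \<open>p' \<ge> m - K * p\<close> on the whole line, hence \<open>p \<ge> m / K\<close>.\<close>
lemma entire_upper_bound:
  assumes w: "scalar_flow f UNIV w" and pos: "\<And>t. 0 < w t"
  shows "w t \<le> K / m"
proof (rule ccontr)
  assume neg: "\<not> w t \<le> K / m"
  \<comment> \<open>\<open>exp (K * \<tau>)\<close> is the integrating factor, so \<open>h\<close>
    is nondecreasing. A negative value at \<open>t\<close> would keep \<open>h\<close> away from 0
    in the whole past, whereas \<open>h\<close> is at least
    \<open>- (m / K) * exp (K * \<tau>)\<close>, which tends to 0 at minus infinity.\<close>
  define h where "h = (\<lambda>\<tau>. (1 / w \<tau> - m / K) * exp (K * \<tau>))"
  have ht: "h t < 0"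
    using neg pos[of t] K_pos m_pos by (simp add: h_def field_simps mult_less_0_iff)
  have h_mono: "h \<tau> \<le> h t" if "\<tau> \<le> t" for \<tau>
  proof (rule nondecreasing_if_deriv_nonneg[OF that])
    fix x :: real assume "x \<in> {\<tau>..t}"
    have wd: "(w has_real_derivative w x * f x (w x)) (at x within {\<tau>..t})"
      using scalar_flowD[OF w, of x] by (auto intro: DERIV_subset)
    have "((0 * w x - 1 * (w x * F)) / (w x * w x) - 0) * E + (E * K) * (1 / w x - m / K) = ((K - F) / w x - m) * E" for E F
      using pos[of x] K_pos by (simp add: field_simps)
    then show "(h has_real_derivative ((K - f x (w x)) / w x - m) * exp (K * x)) (at x within {\<tau>..t})"
      unfolding h_def using pos[of x]
      by (intro DERIV_cong[OF DERIV_mult[OF DERIV_diff[OF DERIV_divide[OF DERIV_const wd] DERIV_const]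
            DERIV_chain2[OF DERIV_exp DERIV_cmult_Id]]]) auto
    have "f x (w x) \<le> K - m * w x" using f_le[of "w x" x] pos[of x] f0_le[of x] by auto
    then have "m \<le> (K - f x (w x)) / w x" using pos[of x] by (simp add: pos_le_divide_eq)
    then show "0 \<le> ((K - f x (w x)) / w x - m) * exp (K * x)" by simp
  qed
  have "((\<lambda>\<tau>. - (m / K) * exp (K * \<tau>)) \<longlongrightarrow> - (m / K) * 0) at_bot"
    using K_pos by (intro tendsto_intros filterlim_compose[OF exp_at_bot] filterlim_tendsto_pos_mult_at_bot
        filterlim_ident) auto
  then have "\<forall>\<^sub>F \<tau> in at_bot. h t < - (m / K) * exp (K * \<tau>)"
    using ht by (intro order_tendstoD(1)) auto
  then obtain N where N: "\<And>\<tau>. \<tau> \<le> N \<Longrightarrow> h t < - (m / K) * exp (K * \<tau>)"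
    by (auto simp: eventually_at_bot_linorder)
  define \<tau> where "\<tau> = min N t"
  have "- (m / K) * exp (K * \<tau>) \<le> h \<tau>"
    unfolding h_def using pos[of \<tau>] by (intro mult_right_mono) auto
  moreover have "\<tau> \<le> N" "\<tau> \<le> t" by (auto simp: \<tau>_def)
  ultimately show False using N[of \<tau>] h_mono[of \<tau>] by linarith
qed

text \<open>An entire solution has an unlimited past, so \<open>ratio_upper\<close> on
  \<open>[t - T, t]\<close> gives \<open>v t \<le> (1 + \<epsilon>) * w t\<close> for every
  \<open>\<epsilon>\<close>; the bound on \<open>v\<close> comes from
  \<open>entire_upper_bound\<close>. Exchanging the roles yields uniqueness.\<close>

lemma entire_unique:
  assumes v: "scalar_flow f UNIV v" "\<And>t. \<delta> \<le> v t" and w: "scalar_flow f UNIV w" "\<And>t. \<delta> \<le> w t"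
    and \<delta>: "0 < \<delta>"
  shows "v t \<le> w t"
proof (rule field_le_epsilon)
  fix d :: real assume d: "0 < d"
  have pos: "0 < v t" "0 < w t" for t using v w \<delta> by (auto intro: less_le_trans)
  define \<epsilon> where "\<epsilon> = d / w t"
  have \<epsilon>: "0 < \<epsilon>" using d pos[of t] by (simp add: \<epsilon>_def)
  obtain T where T: "0 < T"
    "\<And>s u w i. lattice_flow f {s..s + T} u \<Longrightarrow> scalar_flow f {s..s + T} w \<Longrightarrow>
       (\<And>t. t \<in> {s..s + T} \<Longrightarrow> \<delta> \<le> w t) \<Longrightarrow>
       (\<And>t i. t \<in> {s..s + T} \<Longrightarrow> 0 \<le> u t i \<and> u t i \<le> K / m) \<Longrightarrow>
       u (s + T) i \<le> (1 + \<epsilon>) * w (s + T)"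
    using ratio_upper[OF \<delta> \<epsilon>] by blast
  have "v ((t - T) + T) \<le> (1 + \<epsilon>) * w ((t - T) + T)"
  proof (rule T(2)[where u = "\<lambda>t i. v t" and w = w])
    show "lattice_flow f {t - T..t - T + T} (\<lambda>t i. v t)"
      unfolding scalar_flow_iff_lattice_flow[symmetric] by (rule scalar_flow_subset[OF v(1)]) auto
    show "scalar_flow f {t - T..t - T + T} w" by (rule scalar_flow_subset[OF w(1)]) auto
    show "0 \<le> v \<tau> \<and> v \<tau> \<le> K / m" for \<tau> i
      using pos[of \<tau>] entire_upper_bound[OF v(1) pos(1), of \<tau>] by simp
  qed (use w in auto)
  then show "v t \<le> w t + d" using pos[of t] by (simp add: \<epsilon>_def algebra_simps)
qed

text \<open>The scalar equation is solved through the lattice: the spatial shift of a solution with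
  constant data solves the same problem, so uniqueness makes it independent of the site.\<close>

lemma constant_data_flow:
  assumes R: "M\<^sub>0 \<le> R"
  obtains w where "scalar_flow f {s..} w" "w s = R" "\<And>t. s \<le> t \<Longrightarrow> 0 \<le> w t" "\<And>t. s \<le> t \<Longrightarrow> w t \<le> R"
proof -
  have R0: "0 \<le> R" using R M0_pos by simp
  obtain u where u: "lattice_flow f {s..} u" "\<And>i. u s i = R"
    "\<And>t i. s \<le> t \<Longrightarrow> 0 \<le> u t i" "\<And>t i. s \<le> t \<Longrightarrow> u t i \<le> R"
    by (rule flow_exists[of "\<lambda>i. R" R s]) (use R R0 in auto)
  have shift: "u t (i + 1) = u t i" if "s \<le> t" for t i
  proof (rule flow_unique[where s = s and T = t and B = R and v = u and u = "\<lambda>t i. u t (i + 1)"])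
    have "lattice_flow f {s..} (\<lambda>t i. u t (i + 1))"
      unfolding lattice_flow_def
    proof (intro ballI allI)
      fix t i assume "t \<in> {s..}"
      from lattice_flowD[OF u(1) this, of "i + 1"]
      show "((\<lambda>\<tau>. u \<tau> (i + 1)) has_real_derivative dlap (\<lambda>i. u t (i + 1)) i + u t (i + 1) * f t (u t (i + 1)))
          (at t within {s..})"
        by (simp add: dlap_def)
    qed
    then show "lattice_flow f {s..t} (\<lambda>t i. u t (i + 1))" by (rule lattice_flow_subset) auto
    show "lattice_flow f {s..t} u" using u(1) by (rule lattice_flow_subset) auto
  qed (use u that in auto)
  have u_eq: "u t i = u t 0" if "s \<le> t" for t i by (rule int_shift_invariant) (rule shift[OF that])
  show ?thesis
  proof (rule that[of "\<lambda>t. u t 0"])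
    show "scalar_flow f {s..} (\<lambda>t. u t 0)"
      unfolding scalar_flow_def
    proof
      fix t assume t: "t \<in> {s..}"
      then have "dlap (u t) 0 = 0" using u_eq[of t 1] u_eq[of t "- 1"] by (simp add: dlap_def)
      then show "((\<lambda>t. u t 0) has_real_derivative u t 0 * f t (u t 0)) (at t within {s..})"
        using lattice_flowD[OF u(1) t, of 0] by simp
    qed
  qed (use u in auto)
qed

text \<open>Pullback from the past: solutions start at height \<open>R\<close> at the times
  \<open>- real n\<close>. None exceeds \<open>R\<close>, so comparison makes them decrease in
  \<open>n\<close>, while \<open>scalar_flow_lower_bound\<close> keeps them above
  \<open>\<delta>\<close>. The monotone limit satisfies the integrated equation by dominated
  convergence.\<close>

lemma entire_exists:
  obtains v \<delta> where "scalar_flow f UNIV v" "0 < \<delta>" "\<And>t. \<delta> \<le> v t"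
proof -
  obtain \<delta> e where \<delta>: "0 < \<delta>" "0 < e" and low:
    "\<And>s t w. s \<le> t \<Longrightarrow> scalar_flow f {s..t} w \<Longrightarrow> (\<And>\<tau>. \<tau> \<in> {s..t} \<Longrightarrow> 0 \<le> w \<tau>) \<Longrightarrow>
       e \<le> w s \<Longrightarrow> \<delta> \<le> w t"
    using scalar_flow_lower_bound by blast
  define R where "R = max M\<^sub>0 e"
  have R: "M\<^sub>0 \<le> R" "e \<le> R" "0 < R" using \<delta> by (auto simp: R_def)
  have "\<exists>w. scalar_flow f {- real n..} w \<and> w (- real n) = R \<and> (\<forall>t\<ge>- real n. 0 \<le> w t \<and> w t \<le> R)" for n
    using constant_data_flow[OF R(1), of "- real n"] by metis
  then obtain w where w: "\<And>n. scalar_flow f {- real n..} (w n)" "\<And>n. w n (- real n) = R"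
      "\<And>n t. - real n \<le> t \<Longrightarrow> 0 \<le> w n t \<and> w n t \<le> R" by metis
  have w_low: "\<delta> \<le> w n t" if "- real n \<le> t" for n t
    by (rule low[OF that scalar_flow_subset[OF w(1)]]) (use w R in auto)
  have w_dec: "w (Suc n) t \<le> w n t" if "- real n \<le> t" for n t
  proof (rule flow_mono[where s = "- real n" and T = t and B = R and u = "\<lambda>t i. w (Suc n) t" and v = "\<lambda>t i. w n t"])
    show "lattice_flow f {- real n..t} (\<lambda>t i. w (Suc n) t)" "lattice_flow f {- real n..t} (\<lambda>t i. w n t)"
      unfolding scalar_flow_iff_lattice_flow[symmetric] by (rule scalar_flow_subset[OF w(1)]; force)+
    show "\<bar>w (Suc n) \<tau>\<bar> \<le> R" "\<bar>w n \<tau>\<bar> \<le> R" if "\<tau> \<in> {- real n..t}" for \<tau> i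
      using w(3)[of "Suc n" \<tau>] w(3)[of n \<tau>] that by auto
    show "w (Suc n) (- real n) \<le> w n (- real n)" using w(2)[of n] w(3)[of "Suc n" "- real n"] by simp
  qed (use that in auto)
  \<comment> \<open>The value \<open>R\<close> before the starting time keeps the sequence
    decreasing in \<open>n\<close> at every fixed \<open>t\<close>.\<close>
  define w' where "w' = (\<lambda>n t. if - real n \<le> t then w n t else R)"
  have "w' (Suc n) t \<le> w' n t" for n t
    using w_dec[of n t] w(3)[of "Suc n" t] by (auto simp: w'_def)
  then have dec: "decseq (\<lambda>n. w' n t)" for t by (simp add: decseq_Suc_iff)
  have w'_b: "0 \<le> w' n t" "w' n t \<le> R" for n t using w(3)[of n t] R by (auto simp: w'_def)
  have "\<exists>l. (\<lambda>n. w' n t) \<longlonglongrightarrow> l" for t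
    by (rule decseq_convergent[OF dec[of t], of 0]) (use w'_b in auto)
  then obtain v where v: "\<And>t. (\<lambda>n. w' n t) \<longlonglongrightarrow> v t" by metis
  have v_low: "\<delta> \<le> v t" for t
  proof (rule LIMSEQ_le_const[OF v])
    obtain N :: nat where "- t \<le> real N" using real_arch_simple by blast
    then show "\<exists>N. \<forall>n\<ge>N. \<delta> \<le> w' n t"
      by (intro exI[of _ N]) (auto simp: w'_def intro!: w_low)
  qed
  have v_b: "0 \<le> v t" "v t \<le> R" for t
    using v_low[of t] \<delta> LIMSEQ_le_const2[OF v, of t R] w'_b by auto
  have f_cont: "((\<lambda>n. x n * f t (x n)) \<longlongrightarrow> y * f t y) F" if "(x \<longlongrightarrow> y) F" for x y t and F :: "nat filter"
  proof -
    obtain L where "L-lipschitz_on UNIV (f t)" using lip[of t t] by auto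
    then have "isCont (f t) y" using lipschitz_on_continuous_on continuous_on_eq_continuous_at by blast
    then show ?thesis using that by (intro tendsto_mult isCont_tendsto_compose[of y "f t"])
  qed
  have key: "(\<lambda>\<tau>. v \<tau> * f \<tau> (v \<tau>)) integrable_on {a..b} \<and>
      integral {a..b} (\<lambda>\<tau>. v \<tau> * f \<tau> (v \<tau>)) = v b - v a" if ab: "a \<le> b" for a b
  proof -
    obtain N :: nat where N: "- a \<le> real N" using real_arch_simple by blast
    define g where "g = (\<lambda>k \<tau>. w' (k + N) \<tau> * f \<tau> (w' (k + N) \<tau>))"
    have g: "(g k has_integral w' (k + N) b - w' (k + N) a) {a..b}" for k
    proof (rule fundamental_theorem_of_calculus[OF ab])
      fix x assume x: "x \<in> {a..b}"
      have sub: "{a..b} \<subseteq> {- real (k + N)..}" using N by auto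
      have "(w (k + N) has_real_derivative w (k + N) x * f x (w (k + N) x)) (at x within {a..b})"
        by (rule scalar_flowD[OF scalar_flow_subset[OF w(1) sub] x])
      then have "(w' (k + N) has_real_derivative w (k + N) x * f x (w (k + N) x)) (at x within {a..b})"
        by (rule has_field_derivative_transform_within[of _ _ _ _ 1]) (use sub x in \<open>auto simp: w'_def\<close>)
      moreover have "w (k + N) x = w' (k + N) x" using sub x by (auto simp: w'_def)
      ultimately show "(w' (k + N) has_vector_derivative g k x) (at x within {a..b})"
        by (simp add: g_def has_real_derivative_iff_has_vector_derivative)
    qed
    have shift: "(\<lambda>k. w' (k + N) t) \<longlonglongrightarrow> v t" for t by (rule LIMSEQ_ignore_initial_segment[OF v])
    have dom: "(\<lambda>\<tau>. v \<tau> * f \<tau> (v \<tau>)) integrable_on {a..b}"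
        "(\<lambda>k. integral {a..b} (g k)) \<longlonglongrightarrow> integral {a..b} (\<lambda>\<tau>. v \<tau> * f \<tau> (v \<tau>))"
      by (rule dominated_convergence[where f = g and h = "\<lambda>_. R * (K + M * R)"];
          use g w'_b in \<open>auto simp: g_def intro!: reaction_bound f_cont shift\<close>)+
    have "integral {a..b} (g k) = w' (k + N) b - w' (k + N) a" for k by (rule integral_unique[OF g])
    then have "(\<lambda>k. integral {a..b} (g k)) \<longlonglongrightarrow> v b - v a"
      by (simp add: tendsto_diff shift)
    then show ?thesis using dom LIMSEQ_unique by blast
  qed
  have v_eq: "v t = v a + integral {a..t} (\<lambda>\<tau>. v \<tau> * f \<tau> (v \<tau>))" if "a \<le> t" for a t
    using key[OF that] by simp
  have v_cont: "continuous_on {a..b} v" for a b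
  proof -
    have "continuous_on {a..b} (\<lambda>t. v a + integral {a..t} (\<lambda>\<tau>. v \<tau> * f \<tau> (v \<tau>)))"
      by (cases "a \<le> b") (auto intro!: continuous_intros indefinite_integral_continuous_1 simp: key)
    then show ?thesis by (rule continuous_on_eq) (use v_eq in auto)
  qed
  have g_cont: "continuous_on {a..b} (\<lambda>t. v t * f t (v t))" for a b
  proof -
    obtain L where L: "\<forall>t\<in>{a..b}. L-lipschitz_on UNIV (f t)" using lip by blast
    have "\<bar>f t x - f t y\<bar> \<le> L * \<bar>x - y\<bar>" if "t \<in> {a..b}" for t x y
      using lipschitz_onD[of L UNIV "f t" x y] L that by (auto simp: dist_real_def)
    then have "continuous_on {a..b} (\<lambda>t. f t (v t))"
      by (rule continuous_on_lipschitz_compose[where L = L])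
         (auto intro: continuous_on_subset[OF cont_t] v_cont)
    then show ?thesis by (intro continuous_intros v_cont)
  qed
  have "scalar_flow f UNIV v"
    unfolding scalar_flow_def
  proof
    fix t :: real
    have "((\<lambda>x. v (t - 1) + integral {t - 1..x} (\<lambda>\<tau>. v \<tau> * f \<tau> (v \<tau>))) has_real_derivative v t * f t (v t))
        (at t within {t - 1..t + 1})"
      by (auto intro!: derivative_eq_intros integral_has_real_derivative[OF g_cont])
    then have "(v has_real_derivative v t * f t (v t)) (at t within {t - 1..t + 1})"
      by (rule has_field_derivative_transform_within[of _ _ _ _ 1]) (use v_eq in auto)
    then show "(v has_real_derivative v t * f t (v t)) (at t)"
      by (simp add: at_within_Icc_at)
  qed
  then show ?thesis using that \<delta> v_low by blast
qed

lemma u_plus_flow: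
  obtains \<delta> where "scalar_flow f UNIV (u_plus f)" "0 < \<delta>" "\<And>t. \<delta> \<le> u_plus f t" "\<And>t. u_plus f t \<le> K / m"
proof -
  have iff: "lattice_solution f UNIV (\<lambda>t. const_bcontfun (v t)) \<longleftrightarrow> scalar_flow f UNIV v" for v :: "real \<Rightarrow> real"
  proof -
    have "continuous_on UNIV (\<lambda>t. const_bcontfun (v t) :: linf)" if "continuous_on UNIV v"
    proof (rule continuous_on_compose2[OF _ that])
      have "1-lipschitz_on UNIV (const_bcontfun :: real \<Rightarrow> linf)"
        by (intro lipschitz_onI dist_bound) auto
      then show "continuous_on UNIV (const_bcontfun :: real \<Rightarrow> linf)" by (rule lipschitz_on_continuous_on)
    qed auto
    then show ?thesis
      by (auto simp: lattice_solution_iff_flow scalar_flow_iff_lattice_flow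
          dest: lattice_flow_continuous)
  qed
  obtain v \<delta> where v: "scalar_flow f UNIV v" "0 < \<delta>" "\<And>t. \<delta> \<le> v t" using entire_exists by blast
  have "u_plus f = v"
    unfolding u_plus_def iff
  proof (rule the_equality)
    show "scalar_flow f UNIV v \<and> (\<exists>\<delta>>0. \<forall>t. \<delta> \<le> v t)" using v by blast
    fix w assume "scalar_flow f UNIV w \<and> (\<exists>\<delta>>0. \<forall>t. \<delta> \<le> w t)"
    then obtain \<delta>' where w: "scalar_flow f UNIV w" "0 < \<delta>'" "\<And>t. \<delta>' \<le> w t" by blast
    define d where "d = min \<delta> \<delta>'"
    have d: "0 < d" "\<And>t. d \<le> v t" "\<And>t. d \<le> w t" using v w by (auto simp: d_def min_le_iff_disj)
    show "w = v"
      using entire_unique[OF v(1) d(2) w(1) d(3) d(1)] entire_unique[OF w(1) d(3) v(1) d(2) d(1)]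
      by (auto intro!: ext order.antisym)
  qed
  moreover have "v t \<le> K / m" for t using v by (intro entire_upper_bound) (auto intro: less_le_trans)
  ultimately show ?thesis using that v by simp
qed

end

section \<open>Exponential supersolutions and travelling subsolutions\<close>

lemma truncated_cos_nonneg: "0 \<le> cos (max (- (pi / 2)) (min (pi / 2) z))"
proof (rule cos_ge_zero)
  show "- (pi / 2) \<le> max (- (pi / 2)) (min (pi / 2) z)" by (rule max.cobounded1)
  show "max (- (pi / 2)) (min (pi / 2) z) \<le> pi / 2"
    by (rule max.boundedI[OF _ min.cobounded1]) simp
qed

text \<open>Outside the central arch the truncation is 0 and the cosine is nonpositive up to
  \<open>3 * pi / 2\<close>. The bound \<open>pi / 2 + 1\<close> covers the neighbours of the arch,
  because a lattice step shifts the argument by \<open>\<omega> \<le> 1\<close>.\<close>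

lemma cos_le_truncated_cos:
  assumes "\<bar>z\<bar> \<le> pi / 2 + 1"
  shows "cos z \<le> cos (max (- (pi / 2)) (min (pi / 2) z))"
proof (cases "\<bar>z\<bar> \<le> pi / 2")
  case True
  then have "max (- (pi / 2)) (min (pi / 2) z) = z" by auto
  then show ?thesis by simp
next
  case False
  have "0 \<le> cos (\<bar>z\<bar> - pi)"
    using False assms pi_gt3 by (intro cos_ge_zero) auto
  then have "cos z \<le> 0" by (simp add: cos_diff)
  then show ?thesis using truncated_cos_nonneg[of z] by linarith
qed

text \<open>The bound on \<open>1 - cos \<omega>\<close> keeps the dispersion relation close to that
  of real wave numbers; \<open>\<omega> / 2 \<le> sin \<omega>\<close> bounds the tilt
  \<open>\<mu>\<close> of the profile in terms of the speed.\<close>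

lemma small_frequency:
  assumes e: "0 < e"
  obtains \<omega> :: real where "0 < \<omega>" "\<omega> \<le> 1" "1 - cos \<omega> \<le> e" "\<omega> / 2 \<le> sin \<omega>"
proof -
  have "((\<lambda>x::real. 1 - cos x) \<longlongrightarrow> 1 - cos 0) (at_right 0)"
    by (intro tendsto_intros)
  then have "\<forall>\<^sub>F x::real in at_right 0. 1 - cos x < e" using e by (intro order_tendstoD) auto
  moreover have "((\<lambda>h::real. sin h / h) \<longlongrightarrow> 1) (at_right 0)"
    using DERIV_sin[of "0::real"] unfolding DERIV_def by (auto intro: filterlim_at_withinI tendsto_mono[OF at_le])
  then have "\<forall>\<^sub>F x::real in at_right 0. 1 / 2 < sin x / x" by (intro order_tendstoD) auto
  moreover have "\<forall>\<^sub>F x::real in at_right 0. x \<in> {0<..<1}" by (rule eventually_at_right_real) simp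
  ultimately have "\<forall>\<^sub>F x::real in at_right 0. 1 - cos x < e \<and> 1 / 2 < sin x / x \<and> x \<in> {0<..<1}"
    by eventually_elim auto
  then have "\<exists>x::real. 1 - cos x < e \<and> 1 / 2 < sin x / x \<and> x \<in> {0<..<1}"
    by (rule eventually_happens'[OF trivial_limit_at_right_real])
  then obtain x :: real where "1 - cos x < e" "1 / 2 < sin x / x" "x \<in> {0<..<1}" by blast
  then show ?thesis by (intro that[of x]) (auto simp: field_simps)
qed

text \<open>The profile is one arch of \<open>exp (- \<mu> * x) * cos (\<omega> * x)\<close>, i.e. a solution of the linear equation
  with the complex wave number \<open>\<mu> + \<i> * \<omega>\<close>. The choice \<open>2 * sinh \<mu> * sin \<omega> = c' * \<omega>\<close> makes the
  sine terms cancel. For small \<open>\<omega>\<close> it is uniform in \<open>c'\<close>.\<close>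
lemma travelling_bump:
  fixes c r \<gamma> :: real
  assumes c: "0 \<le> c" and \<gamma>: "0 < \<gamma>"
    and gap: "\<And>\<mu>. 0 \<le> \<mu> \<Longrightarrow> \<gamma> \<le> 2 * cosh \<mu> - 2 + r - c * \<mu>"
  obtains Vb :: real and N :: nat where "0 < Vb"
    "\<And>c'. \<bar>c'\<bar> \<le> c \<Longrightarrow> \<exists>V. continuous_on UNIV V \<and> V 0 = 1 \<and> (\<forall>x. 0 \<le> V x \<and> V x \<le> Vb) \<and>
       (\<forall>x. real N \<le> \<bar>x\<bar> \<longrightarrow> V x = 0) \<and>
       (\<forall>x. 0 < V x \<longrightarrow> (\<exists>V'. (V has_real_derivative V') (at x) \<and>
          - c' * V' \<le> V (x + 1) - 2 * V x + V (x - 1) + (r - \<gamma> / 2) * V x))"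
proof -
  \<comment> \<open>\<open>cosh \<mu> \<le> 1 + c\<close> will hold, so the factor
    \<open>cos \<omega>\<close> costs at most \<open>\<gamma> / 2\<close> of the margin.\<close>
  obtain \<omega> :: real where \<omega>: "0 < \<omega>" "\<omega> \<le> 1" "1 - cos \<omega> \<le> \<gamma> / (4 * (1 + c))" "\<omega> / 2 \<le> sin \<omega>"
    using small_frequency[of "\<gamma> / (4 * (1 + c))"] \<gamma> c by (auto simp: divide_pos_pos)
  have sin_pos: "0 < sin \<omega>" using \<omega> by linarith
  define X where "X = pi / (2 * \<omega>)"
  have X: "0 < X" "\<omega> * X = pi / 2" using \<omega> by (auto simp: X_def)
  define Vb where "Vb = exp ((1 + 2 * c) * X)"
  define N where "N = nat \<lceil>X\<rceil>"
  have XN: "X \<le> real N" unfolding N_def by (rule real_nat_ceiling_ge)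
  show ?thesis
  proof (rule that[of Vb N])
    show "0 < Vb" by (simp add: Vb_def)
    fix c' :: real assume c': "\<bar>c'\<bar> \<le> c"
    define \<mu> where "\<mu> = arsinh (c' * \<omega> / (2 * sin \<omega>))"
    have sinh\<mu>: "2 * sinh \<mu> * sin \<omega> = c' * \<omega>" using sin_pos by (simp add: \<mu>_def)
    have "\<bar>sinh \<mu>\<bar> * \<omega> \<le> \<bar>sinh \<mu>\<bar> * (2 * sin \<omega>)" using \<omega> by (intro mult_left_mono) auto
    also have "\<dots> = \<bar>c'\<bar> * \<omega>"
      using arg_cong[OF sinh\<mu>, of abs] sin_pos \<omega> by (simp add: abs_mult)
    finally have sinh_le: "\<bar>sinh \<mu>\<bar> \<le> c" using \<omega> c' by simp
    have cosh_eq: "cosh \<mu> = \<bar>sinh \<mu>\<bar> + exp (- \<bar>\<mu>\<bar>)"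
      by (cases "0 \<le> \<mu>") (auto simp: cosh_def sinh_def abs_if field_simps)
    then have cosh_le: "cosh \<mu> \<le> 1 + c" using sinh_le by (smt (verit) exp_le_one_iff abs_ge_zero)
    have "1 + \<bar>\<mu>\<bar> \<le> exp \<bar>\<mu>\<bar>" by (rule exp_ge_add_one_self)
    also have "\<dots> \<le> 2 * cosh \<mu>" by (cases "0 \<le> \<mu>") (auto simp: cosh_def)
    finally have \<mu>_le: "\<bar>\<mu>\<bar> \<le> 1 + 2 * c" using cosh_le by linarith
    have disp: "c' * \<mu> \<le> 2 * cosh \<mu> * cos \<omega> - 2 + r - \<gamma> / 2"
    proof -
      have "c' * \<mu> \<le> \<bar>c'\<bar> * \<bar>\<mu>\<bar>" by (metis abs_ge_self abs_mult)
      also have "\<dots> \<le> c * \<bar>\<mu>\<bar>" using c' by (intro mult_right_mono) auto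
      also have "\<dots> \<le> 2 * cosh \<mu> - 2 + r - \<gamma>" using gap[of "\<bar>\<mu>\<bar>"] by simp
      finally have 1: "c' * \<mu> \<le> 2 * cosh \<mu> - 2 + r - \<gamma>" .
      have "2 * cosh \<mu> * (1 - cos \<omega>) \<le> 2 * (1 + c) * (\<gamma> / (4 * (1 + c)))"
        using cosh_le \<omega>(3) c by (intro mult_mono) auto
      also have "\<dots> = \<gamma> / 2" using c by (simp add: field_simps)
      finally show ?thesis using 1 by (simp add: algebra_simps)
    qed
    define B where "B = (\<lambda>x. cos (max (- (pi / 2)) (min (pi / 2) (\<omega> * x))))"
    define V where "V = (\<lambda>x. exp (- \<mu> * x) * B x)"
    have B0: "0 \<le> B x" for x unfolding B_def by (rule truncated_cos_nonneg)
    have B1: "B x \<le> 1" for x unfolding B_def by simp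
    have B_out: "B x = 0" if "X \<le> \<bar>x\<bar>" for x
    proof -
      have "pi / 2 \<le> \<bar>\<omega> * x\<bar>" using that \<omega> X by (metis abs_mult abs_of_pos mult_le_cancel_left_pos)
      then have "\<omega> * x \<le> - (pi / 2) \<or> pi / 2 \<le> \<omega> * x" by linarith
      then have "max (- (pi / 2)) (min (pi / 2) (\<omega> * x)) = - (pi / 2) \<or>
          max (- (pi / 2)) (min (pi / 2) (\<omega> * x)) = pi / 2"
        by linarith
      then show ?thesis unfolding B_def by (metis cos_minus cos_pi_half)
    qed
    have B_in: "B x = cos (\<omega> * x)" "\<bar>\<omega> * x\<bar> < pi / 2" if "\<bar>x\<bar> < X" for x
    proof -
      show "\<bar>\<omega> * x\<bar> < pi / 2" using that \<omega> X by (metis abs_mult abs_of_pos mult_less_cancel_left_pos)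
      then show "B x = cos (\<omega> * x)" by (auto simp: B_def min_def max_def)
    qed
    have V0: "0 \<le> V x" for x using B0[of x] by (simp add: V_def)
    have VVb: "V x \<le> Vb" for x
    proof (cases "\<bar>x\<bar> < X")
      case True
      have "- \<mu> * x \<le> \<bar>\<mu>\<bar> * \<bar>x\<bar>" by (metis abs_ge_self abs_minus_cancel abs_mult)
      also have "\<dots> \<le> (1 + 2 * c) * X" using \<mu>_le True by (intro mult_mono) auto
      finally have "exp (- \<mu> * x) * B x \<le> Vb * 1"
        unfolding Vb_def using B0 B1 by (intro mult_mono) auto
      then show ?thesis by (simp add: V_def)
    qed (use B_out in \<open>simp add: V_def Vb_def\<close>)
    have Vc: "continuous_on UNIV V" unfolding V_def B_def by (intro continuous_intros)
    have deriv: "\<exists>V'. (V has_real_derivative V') (at x) \<and>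
          - c' * V' \<le> V (x + 1) - 2 * V x + V (x - 1) + (r - \<gamma> / 2) * V x" if "0 < V x" for x
    proof -
      have x: "\<bar>x\<bar> < X" using that B_out[of x] by (force simp: V_def)
      define E where "E = exp (- \<mu> * x)"
      have E: "0 < E" by (simp add: E_def)
      define C where "C = cos (\<omega> * x)"
      define S where "S = sin (\<omega> * x)"
      have C: "0 \<le> C" using B0[of x] B_in(1)[OF x] by (simp add: C_def)
      have "((\<lambda>x. exp (- \<mu> * x) * cos (\<omega> * x)) has_real_derivative - E * (\<mu> * C + \<omega> * S)) (at x)"
        unfolding E_def C_def S_def by (auto intro!: derivative_eq_intros simp: algebra_simps)
      then have d: "(V has_real_derivative - E * (\<mu> * C + \<omega> * S)) (at x)"
        by (rule has_field_derivative_transform_within_open[of _ _ _ "{- X<..<X}"])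
           (use x B_in in \<open>auto simp: V_def abs_less_iff\<close>)
      have plus: "E * exp (- \<mu>) * (C * cos \<omega> - S * sin \<omega>) \<le> V (x + 1)"
      proof -
        have "E * exp (- \<mu>) * (C * cos \<omega> - S * sin \<omega>) = exp (- \<mu> * (x + 1)) * cos (\<omega> * (x + 1))"
          unfolding E_def C_def S_def by (simp add: cos_add distrib_left flip: exp_add)
        also have "\<dots> \<le> V (x + 1)"
          unfolding V_def B_def using B_in(2)[OF x] \<omega>
          by (intro mult_left_mono cos_le_truncated_cos) (auto simp: distrib_left)
        finally show ?thesis .
      qed
      have minus: "E * exp \<mu> * (C * cos \<omega> + S * sin \<omega>) \<le> V (x - 1)"
      proof -
        have "E * exp \<mu> * (C * cos \<omega> + S * sin \<omega>) = exp (- \<mu> * (x - 1)) * cos (\<omega> * (x - 1))"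
          unfolding E_def C_def S_def by (simp add: cos_diff right_diff_distrib flip: exp_add)
        also have "\<dots> \<le> V (x - 1)"
          unfolding V_def B_def using B_in(2)[OF x] \<omega>
          by (intro mult_left_mono cos_le_truncated_cos) (auto simp: right_diff_distrib)
        finally show ?thesis .
      qed
      have Vx: "V x = E * C" using B_in(1)[OF x] by (simp add: V_def E_def C_def)
      have cosh_exp: "2 * cosh \<mu> = exp \<mu> + exp (- \<mu>)" and sinh_exp: "2 * sinh \<mu> = exp \<mu> - exp (- \<mu>)"
        by (auto simp: cosh_def sinh_def)
      have "E * C * (c' * \<mu>) \<le> E * C * ((exp \<mu> + exp (- \<mu>)) * cos \<omega> - 2 + r - \<gamma> / 2)"
        using disp E C unfolding cosh_exp by (intro mult_left_mono) auto
      \<comment> \<open>\<open>S\<close> changes sign on the arch, so its coefficients on both sides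
        must agree exactly, by the choice of \<open>\<mu>\<close>; for the terms with
        \<open>C \<ge> 0\<close> the inequality \<open>disp\<close> suffices.\<close>
      moreover have "E * S * (c' * \<omega>) = E * S * ((exp \<mu> - exp (- \<mu>)) * sin \<omega>)"
        using sinh\<mu> unfolding sinh_exp by simp
      moreover have "- c' * (- E * (\<mu> * C + \<omega> * S)) = E * C * (c' * \<mu>) + E * S * (c' * \<omega>)"
        by (simp add: algebra_simps)
      moreover have "E * exp (- \<mu>) * (C * cos \<omega> - S * sin \<omega>) - 2 * (E * C) +
          E * exp \<mu> * (C * cos \<omega> + S * sin \<omega>) + (r - \<gamma> / 2) * (E * C) =
          E * C * ((exp \<mu> + exp (- \<mu>)) * cos \<omega> - 2 + r - \<gamma> / 2) + E * S * ((exp \<mu> - exp (- \<mu>)) * sin \<omega>)"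
        by (simp add: algebra_simps)
      ultimately have "- c' * (- E * (\<mu> * C + \<omega> * S)) \<le>
          E * exp (- \<mu>) * (C * cos \<omega> - S * sin \<omega>) - 2 * (E * C) +
          E * exp \<mu> * (C * cos \<omega> + S * sin \<omega>) + (r - \<gamma> / 2) * (E * C)"
        by linarith
      then have "- c' * (- E * (\<mu> * C + \<omega> * S)) \<le> V (x + 1) - 2 * V x + V (x - 1) + (r - \<gamma> / 2) * V x"
        using plus minus unfolding Vx by linarith
      with d show ?thesis by blast
    qed
    show "\<exists>V. continuous_on UNIV V \<and> V 0 = 1 \<and> (\<forall>x. 0 \<le> V x \<and> V x \<le> Vb) \<and>
       (\<forall>x. real N \<le> \<bar>x\<bar> \<longrightarrow> V x = 0) \<and>
       (\<forall>x. 0 < V x \<longrightarrow> (\<exists>V'. (V has_real_derivative V') (at x) \<and>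
          - c' * V' \<le> V (x + 1) - 2 * V x + V (x - 1) + (r - \<gamma> / 2) * V x))"
    proof (intro exI[of _ V] conjI allI impI Vc V0 VVb deriv)
      show "V 0 = 1" by (simp add: V_def B_def)
      show "V x = 0" if "real N \<le> \<bar>x\<bar>" for x using B_out[of x] that XN by (simp add: V_def)
    qed
  qed
qed

section \<open>Bounds for lattice flows and averaging in time\<close>

context kpp_reaction
begin

text \<open>Exponentials are eigenfunctions of \<open>dlap\<close> with eigenvalue
  \<open>exp (- \<mu>) + exp \<mu> - 2\<close>. The sign of \<open>\<mu>\<close> is free:
  \<open>\<mu>\<close> and \<open>- \<mu>\<close> control the two ends of the lattice.\<close>

lemma flow_exponential_bound:
  assumes u: "lattice_flow f {s..T} u" and b: "\<And>t i. t \<in> {s..T} \<Longrightarrow> 0 \<le> u t i \<and> u t i \<le> R"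
    and C: "0 \<le> C" and init: "\<And>i. u s i \<le> C * exp (- \<mu> * real_of_int i)" and t: "t \<in> {s..T}"
  shows "u t i \<le> C * exp (- \<mu> * real_of_int i + (exp (- \<mu>) + exp \<mu> - 2) * (t - s) + (P t - P s))"
proof -
  define \<Lambda> where "\<Lambda> = exp (- \<mu>) + exp \<mu> - 2"
  define w where "w = (\<lambda>t i. C * exp (- \<mu> * real_of_int i + \<Lambda> * (t - s) + (P t - P s)))"
  have w0: "0 \<le> w t i" for t i using C by (simp add: w_def)
  have "0 \<le> w t i - u t i"
  proof (rule lattice_comparison[where s = s and T = T and z = "\<lambda>t i. w t i - u t i" and A = K and B = R])
    have Pc: "continuous_on S P" for S using DERIV_continuous_on[OF DERIV_subset[OF P_deriv]] by blast
    show "continuous_on {s..T} (\<lambda>t. w t i - u t i)" for i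
      unfolding w_def by (intro continuous_intros Pc lattice_flow_continuous[OF u])
    show "- R \<le> w t i - u t i" if "t \<in> {s..T}" for t i
      using w0[of t i] b[OF that, of i] by linarith
    show "0 \<le> w s i - u s i" for i using init[of i] by (simp add: w_def)
    fix t i assume "s < t" "t \<le> T" and neg: "w t i - u t i < 0"
    then have t: "t \<in> {s..T}" by simp
    have wd: "((\<lambda>\<tau>. w \<tau> i) has_real_derivative (\<Lambda> + f t 0) * w t i) (at t within {s..T})"
      unfolding w_def
      by (auto intro!: derivative_eq_intros DERIV_subset[OF P_deriv] simp: algebra_simps)
    have "w t (i + 1) = w t i * exp (- \<mu>)" "w t (i - 1) = w t i * exp \<mu>"
      unfolding w_def by (auto simp: algebra_simps simp flip: exp_add)
    then have lap: "dlap (w t) i = \<Lambda> * w t i" by (simp add: dlap_def \<Lambda>_def algebra_simps)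
    have "u t i * f t (u t i) \<le> u t i * f t 0"
      using b[OF t, of i] f_le_f0[of "u t i" t] by (intro mult_left_mono) auto
    moreover have "K * (w t i - u t i) \<le> f t 0 * (w t i - u t i)"
      using neg f0_le[of t] by (intro mult_right_mono_neg) auto
    ultimately have "dlap (\<lambda>i. w t i - u t i) i + K * (w t i - u t i)
        \<le> (\<Lambda> + f t 0) * w t i - (dlap (u t) i + u t i * f t (u t i))"
      using lap by (simp add: dlap_def algebra_simps)
    with DERIV_diff[OF wd lattice_flowD[OF u t, of i]]
    show "\<exists>D. ((\<lambda>\<tau>. w \<tau> i - u \<tau> i) has_real_derivative D) (at t within {s..T}) \<and>
        dlap (\<lambda>i. w t i - u t i) i + K * (w t i - u t i) \<le> D" by blast
  qed (rule t)
  then show ?thesis by (simp add: w_def \<Lambda>_def)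
qed

text \<open>The weight with exponent \<open>2 + K + M * R\<close> outweighs the diffusive loss and
  the worst reaction rate, so each weighted site grows at least at the rate of a weighted neighbour.
  Integrating once per lattice step produces the Taylor term
  \<open>(t - s) ^ n / fact n\<close>.\<close>

lemma flow_positive:
  assumes u: "lattice_flow f {s..T} u" and b: "\<And>t i. t \<in> {s..T} \<Longrightarrow> 0 \<le> u t i \<and> u t i \<le> R"
    and init: "\<kappa> \<le> u s j" and t: "t \<in> {s..T}"
  shows "nat \<bar>i - j\<bar> = n \<Longrightarrow> \<kappa> * (t - s) ^ n / fact n \<le> u t i * exp ((2 + K + M * R) * (t - s))"
  using t
proof (induction n arbitrary: i t)
  case (0 i t)
  define \<beta> where "\<beta> = 2 + K + M * R"
  have i: "i = j" using 0 by simp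
  have sub: "{s..t} \<subseteq> {s..T}" using 0 by auto
  have "u s j * exp (\<beta> * (s - s)) \<le> u t j * exp (\<beta> * (t - s))"
  proof (rule nondecreasing_if_deriv_nonneg[where h = "\<lambda>t. u t j * exp (\<beta> * (t - s))"])
    fix \<tau> assume \<tau>: "\<tau> \<in> {s..t}"
    show "((\<lambda>t. u t j * exp (\<beta> * (t - s))) has_real_derivative
       (dlap (u \<tau>) j + u \<tau> j * f \<tau> (u \<tau> j) + \<beta> * u \<tau> j) * exp (\<beta> * (\<tau> - s))) (at \<tau> within {s..t})"
      by (auto intro!: derivative_eq_intros lattice_flowD[OF lattice_flow_subset[OF u sub] \<tau>] simp: algebra_simps)
    note bb = b[OF subsetD[OF sub \<tau>]]
    have "u \<tau> j * (- (K + M * R)) \<le> u \<tau> j * f \<tau> (u \<tau> j)"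
      using bb[of j] f_bound[of "u \<tau> j" R \<tau>] by (intro mult_left_mono) auto
    then have "0 \<le> dlap (u \<tau>) j + u \<tau> j * f \<tau> (u \<tau> j) + \<beta> * u \<tau> j"
      using bb[of "j + 1"] bb[of "j - 1"] by (simp add: dlap_def \<beta>_def algebra_simps)
    then show "0 \<le> (dlap (u \<tau>) j + u \<tau> j * f \<tau> (u \<tau> j) + \<beta> * u \<tau> j) * exp (\<beta> * (\<tau> - s))" by simp
  qed (use 0 in auto)
  then show ?case using init i by (simp add: \<beta>_def)
next
  case (Suc n i t)
  define \<beta> where "\<beta> = 2 + K + M * R"
  define k where "k = (if j < i then i - 1 else i + 1)"
  have k: "nat \<bar>k - j\<bar> = n" "k = i + 1 \<or> k = i - 1" using Suc.prems by (auto simp: k_def)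
  have sub: "{s..t} \<subseteq> {s..T}" using Suc.prems by auto
  have "u s i * exp (\<beta> * (s - s)) - \<kappa> * (s - s) ^ Suc n / fact (Suc n)
      \<le> u t i * exp (\<beta> * (t - s)) - \<kappa> * (t - s) ^ Suc n / fact (Suc n)"
  proof (rule nondecreasing_if_deriv_nonneg[where h = "\<lambda>t. u t i * exp (\<beta> * (t - s)) - \<kappa> * (t - s) ^ Suc n / fact (Suc n)"])
    fix \<tau> assume \<tau>: "\<tau> \<in> {s..t}"
    have "((\<lambda>t. \<kappa> * (t - s) ^ Suc n / fact (Suc n)) has_real_derivative \<kappa> * (real (Suc n) * (\<tau> - s) ^ n) / fact (Suc n)) (at \<tau> within {s..t})"
      by (intro DERIV_cdivide DERIV_cmult DERIV_cong[OF DERIV_power[OF DERIV_diff[OF DERIV_ident DERIV_const]]]) simp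
    moreover have "\<kappa> * (real (Suc n) * (\<tau> - s) ^ n) / fact (Suc n) = \<kappa> * (\<tau> - s) ^ n / fact n"
      by (simp add: fact_Suc del: of_nat_Suc)
    ultimately have d2: "((\<lambda>t. \<kappa> * (t - s) ^ Suc n / fact (Suc n)) has_real_derivative \<kappa> * (\<tau> - s) ^ n / fact n) (at \<tau> within {s..t})"
      by simp
    show "((\<lambda>t. u t i * exp (\<beta> * (t - s)) - \<kappa> * (t - s) ^ Suc n / fact (Suc n)) has_real_derivative
       (dlap (u \<tau>) i + u \<tau> i * f \<tau> (u \<tau> i) + \<beta> * u \<tau> i) * exp (\<beta> * (\<tau> - s)) - \<kappa> * (\<tau> - s) ^ n / fact n) (at \<tau> within {s..t})"
      by (rule DERIV_diff[OF _ d2])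
         (auto intro!: derivative_eq_intros lattice_flowD[OF lattice_flow_subset[OF u sub] \<tau>] simp: algebra_simps)
    note bb = b[OF subsetD[OF sub \<tau>]]
    have "u \<tau> i * (- (K + M * R)) \<le> u \<tau> i * f \<tau> (u \<tau> i)"
      using bb[of i] f_bound[of "u \<tau> i" R \<tau>] by (intro mult_left_mono) auto
    then have "u \<tau> k \<le> dlap (u \<tau>) i + u \<tau> i * f \<tau> (u \<tau> i) + \<beta> * u \<tau> i"
      using bb[of "i + 1"] bb[of "i - 1"] k(2) by (auto simp: dlap_def \<beta>_def algebra_simps)
    then have "u \<tau> k * exp (\<beta> * (\<tau> - s)) \<le> (dlap (u \<tau>) i + u \<tau> i * f \<tau> (u \<tau> i) + \<beta> * u \<tau> i) * exp (\<beta> * (\<tau> - s))"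
      by simp
    moreover have "\<kappa> * (\<tau> - s) ^ n / fact n \<le> u \<tau> k * exp (\<beta> * (\<tau> - s))"
      using Suc.IH[OF k(1) subsetD[OF sub \<tau>]] by (simp add: \<beta>_def)
    ultimately show "0 \<le> (dlap (u \<tau>) i + u \<tau> i * f \<tau> (u \<tau> i) + \<beta> * u \<tau> i) * exp (\<beta> * (\<tau> - s)) - \<kappa> * (\<tau> - s) ^ n / fact n"
      by linarith
  qed (use Suc.prems in auto)
  then show ?case using b[of s i] Suc.prems by (simp add: \<beta>_def)
qed

text \<open>\<open>A\<close> is the difference between the running average of \<open>P\<close> over a window of length \<open>T\<close> and \<open>P\<close>
  itself. Multiplying by \<open>exp A\<close> replaces the growth rate \<open>f t 0\<close> by its average over \<open>[t, t + T]\<close>.\<close>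
lemma averaging_potential:
  assumes T: "0 < T"
  obtains A where "\<And>t. \<bar>A t\<bar> \<le> K * T"
    "\<And>t. (A has_real_derivative (P (t + T) - P t) / T - f t 0) (at t)"
proof -
  have "continuous_on UNIV P" by (rule DERIV_continuous_on[OF P_deriv])
  then obtain Q where Q: "\<And>t. (Q has_real_derivative P t) (at t)"
    using continuous_has_antiderivative by blast
  define A where "A = (\<lambda>t. (Q (t + T) - Q t) / T - P t)"
  show ?thesis
  proof (rule that[of A])
    fix t
    have "((\<lambda>t. Q (t + T)) has_real_derivative P (t + T)) (at t)"
      using DERIV_shift[of Q "P (t + T)" t T] Q by simp
    then show "(A has_real_derivative (P (t + T) - P t) / T - f t 0) (at t)"
      unfolding A_def using T by (auto intro!: derivative_eq_intros Q P_deriv)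
    \<comment> \<open>The window average of \<open>P\<close> is a value of \<open>P\<close> inside
      the window, so \<open>A t\<close> is an increment of \<open>P\<close> over a time below
      \<open>T\<close>.\<close>
    obtain z where z: "t < z" "z < t + T" "Q (t + T) - Q t = (t + T - t) * P z"
      using MVT2[of t "t + T" Q P] T Q by auto
    have "\<bar>P z - P t\<bar> \<le> K * \<bar>z - t\<bar>"
      using field_differentiable_bound[of UNIV P "\<lambda>t. f t 0" K z t] P_deriv f0_le by auto
    also have "\<dots> \<le> K * T" using z K_pos by (intro mult_left_mono) auto
    finally show "\<bar>A t\<bar> \<le> K * T" using z T by (simp add: A_def)
  qed
qed

end

section \<open>Persistence and convergence inside the cone\<close>

context kpp_reaction
begin

text \<open>One unit of time spreads the datum at \<open>j\<close> over all sites that a bump may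
  occupy initially; from then on a small multiple of the bump, weighted by \<open>exp (- A)\<close>,
  is a subsolution. The site \<open>i\<close> at time \<open>t\<close> is met by the bump whose
  speed carries its centre there. \<open>D\<close> is closed under later times because the window
  mean is used at every time after the start.\<close>

lemma flow_persistence:
  assumes D: "\<And>s t. s \<in> D \<Longrightarrow> s \<le> t \<Longrightarrow> t \<in> D"
    and T: "0 < T" and avg: "\<And>s. s \<in> D \<Longrightarrow> r * T \<le> P (s + T) - P s"
    and c: "0 \<le> c" and \<gamma>: "0 < \<gamma>"
    and gap: "\<And>\<mu>. 0 \<le> \<mu> \<Longrightarrow> \<gamma> \<le> 2 * cosh \<mu> - 2 + r - c * \<mu>"
    and \<kappa>: "0 < \<kappa>" and R: "0 < R"
  obtains \<delta> where "0 < \<delta>"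
    "\<And>s u j t i. s \<in> D \<Longrightarrow> lattice_flow f {s..} u \<Longrightarrow>
       (\<And>t i. s \<le> t \<Longrightarrow> 0 \<le> u t i \<and> u t i \<le> R) \<Longrightarrow> \<kappa> \<le> u s j \<Longrightarrow> s + 1 < t \<Longrightarrow>
       \<bar>real_of_int (i - j)\<bar> \<le> c * (t - s - 1) \<Longrightarrow> \<delta> \<le> u t i"
proof -
  obtain Vb :: real and N :: nat where Vb: "0 < Vb" and bump:
    "\<And>c'. \<bar>c'\<bar> \<le> c \<Longrightarrow> \<exists>V. continuous_on UNIV V \<and> V 0 = 1 \<and> (\<forall>x. 0 \<le> V x \<and> V x \<le> Vb) \<and>
       (\<forall>x. real N \<le> \<bar>x\<bar> \<longrightarrow> V x = 0) \<and>
       (\<forall>x. 0 < V x \<longrightarrow> (\<exists>V'. (V has_real_derivative V') (at x) \<and>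
          - c' * V' \<le> V (x + 1) - 2 * V x + V (x - 1) + (r - \<gamma> / 2) * V x))"
    by (rule travelling_bump[OF c \<gamma>, of r]; use gap in blast)
  obtain A where A: "\<And>t. \<bar>A t\<bar> \<le> K * T"
    "\<And>t. (A has_real_derivative (P (t + T) - P t) / T - f t 0) (at t)"
    using averaging_potential[OF T] by blast
  define \<beta> where "\<beta> = 2 + K + M * R"
  define \<kappa>1 where "\<kappa>1 = \<kappa> * exp (- \<beta>) / fact N"
  have \<kappa>1: "0 < \<kappa>1" using \<kappa> by (simp add: \<kappa>1_def)
  define Z where "Z = exp (K * T) * Vb"
  have Z: "0 < Z" using Vb by (simp add: Z_def)
  \<comment> \<open>The first bound places the bump below the solution at time \<open>s + 1\<close>;
    the second gives \<open>M * u \<le> \<gamma> / 2\<close> wherever \<open>u\<close> lies below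
    the bump, so the nonlinearity uses up the remaining half of the margin.\<close>
  define \<epsilon> where "\<epsilon> = min (\<kappa>1 / Z) (\<gamma> / (2 * M * Z))"
  have \<epsilon>: "0 < \<epsilon>" using \<kappa>1 Z \<gamma> M_pos by (simp add: \<epsilon>_def)
  have "\<epsilon> \<le> \<kappa>1 / Z" "\<epsilon> \<le> \<gamma> / (2 * M * Z)" by (auto simp: \<epsilon>_def)
  then have \<epsilon>Z: "\<epsilon> * Z \<le> \<kappa>1" "M * (\<epsilon> * Z) \<le> \<gamma> / 2" using Z M_pos by (auto simp: field_simps)
  show ?thesis
  proof (rule that[of "\<epsilon> * exp (- (K * T))"])
    show "0 < \<epsilon> * exp (- (K * T))" using \<epsilon> by simp
    fix s u j t i
    assume s: "s \<in> D" and u: "lattice_flow f {s..} u"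
      and ub: "\<And>t i. s \<le> t \<Longrightarrow> 0 \<le> u t i \<and> u t i \<le> R"
      and init: "\<kappa> \<le> u s j" and st: "s + 1 < t" and ij: "\<bar>real_of_int (i - j)\<bar> \<le> c * (t - s - 1)"
    define c' where "c' = real_of_int (i - j) / (t - s - 1)"
    have "\<bar>c'\<bar> \<le> c" using ij st by (simp add: c'_def field_simps)
    then obtain V where V: "continuous_on UNIV V" "V 0 = 1" "\<And>x. 0 \<le> V x" "\<And>x. V x \<le> Vb"
      "\<And>x. real N \<le> \<bar>x\<bar> \<Longrightarrow> V x = 0"
      and Vd: "\<And>x. 0 < V x \<Longrightarrow> \<exists>V'. (V has_real_derivative V') (at x) \<and>
          - c' * V' \<le> V (x + 1) - 2 * V x + V (x - 1) + (r - \<gamma> / 2) * V x"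
      using bump[of c'] by blast
    define X where "X = (\<lambda>\<tau> k. real_of_int (k - j) - c' * (\<tau> - s - 1))"
    define \<phi> where "\<phi> = (\<lambda>\<tau> k. \<epsilon> * exp (- A \<tau>) * V (X \<tau> k))"
    have \<phi>_le: "\<phi> \<tau> k \<le> \<epsilon> * Z" for \<tau> k
    proof -
      have "exp (- A \<tau>) * V (X \<tau> k) \<le> exp (K * T) * Vb"
        using A(1)[of \<tau>] V by (intro mult_mono) (auto simp: abs_le_iff)
      then show ?thesis using \<epsilon> by (simp add: \<phi>_def Z_def mult.assoc)
    qed
    have "0 \<le> u t i - \<phi> t i"
    proof (rule lattice_comparison[where s = "s + 1" and T = t and z = "\<lambda>t i. u t i - \<phi> t i" and A = K and B = "\<epsilon> * Z"])
      have Ac: "continuous_on S A" for S using DERIV_continuous_on[OF DERIV_subset[OF A(2)]] by blast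
      have VX: "continuous_on S (\<lambda>\<tau>. V (X \<tau> k))" for S k
        by (rule continuous_on_compose2[OF V(1)]) (auto simp: X_def intro!: continuous_intros)
      have uc: "continuous_on {s + 1..t} (\<lambda>t. u t k)" for k
        by (rule lattice_flow_continuous[OF lattice_flow_subset[OF u]]) auto
      show "continuous_on {s + 1..t} (\<lambda>t. u t k - \<phi> t k)" for k
        unfolding \<phi>_def by (intro continuous_intros Ac VX uc)
      show "- (\<epsilon> * Z) \<le> u \<tau> k - \<phi> \<tau> k" if "\<tau> \<in> {s + 1..t}" for \<tau> k
        using ub[of \<tau> k] \<phi>_le[of \<tau> k] that by auto
      show "0 \<le> u (s + 1) k - \<phi> (s + 1) k" for k
      proof (cases "real N \<le> \<bar>real_of_int (k - j)\<bar>")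
        case True
        then have "\<phi> (s + 1) k = 0" using V(5) by (simp add: \<phi>_def X_def)
        then show ?thesis using ub[of "s + 1" k] by simp
      next
        case False
        define n where "n = nat \<bar>k - j\<bar>"
        have n: "n \<le> N" using False by (simp add: n_def)
        have "\<kappa> * (s + 1 - s) ^ n / fact n \<le> u (s + 1) k * exp ((2 + K + M * R) * (s + 1 - s))"
          by (rule flow_positive[OF lattice_flow_subset[OF u]]) (use ub init in \<open>auto simp: n_def\<close>)
        then have "\<kappa> / fact n * exp (- \<beta>) \<le> u (s + 1) k * exp \<beta> * exp (- \<beta>)"
          by (intro mult_right_mono) (auto simp: \<beta>_def)
        then have "\<kappa> / fact n * exp (- \<beta>) \<le> u (s + 1) k"
          unfolding mult.assoc[of "u (s + 1) k"] exp_minus_inverse by simp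
        moreover have "\<kappa>1 \<le> \<kappa> / fact n * exp (- \<beta>)"
          unfolding \<kappa>1_def using \<kappa> n by (auto intro!: divide_left_mono fact_mono)
        ultimately show ?thesis using \<phi>_le[of "s + 1" k] \<epsilon>Z by linarith
      qed
      fix \<tau> k assume \<tau>: "s + 1 < \<tau>" "\<tau> \<le> t" and neg: "u \<tau> k - \<phi> \<tau> k < 0"
      have u0: "0 \<le> u \<tau> k" using ub[of \<tau> k] \<tau> by simp
      then have "0 < \<phi> \<tau> k" using neg by linarith
      then have "0 < V (X \<tau> k)" using V(3)[of "X \<tau> k"] by (cases "V (X \<tau> k) = 0") (auto simp: \<phi>_def)
      then obtain V' where V': "(V has_real_derivative V') (at (X \<tau> k))"
        "- c' * V' \<le> V (X \<tau> k + 1) - 2 * V (X \<tau> k) + V (X \<tau> k - 1) + (r - \<gamma> / 2) * V (X \<tau> k)"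
        using Vd by blast
      define A' where "A' = (P (\<tau> + T) - P \<tau>) / T - f \<tau> 0"
      have A'_ge: "r - f \<tau> 0 \<le> A'"
        using avg[OF D[OF s], of \<tau>] \<tau> T by (simp add: A'_def field_simps)
      have "((\<lambda>\<tau>. V (X \<tau> k)) has_real_derivative V' * (- c')) (at \<tau> within {s + 1..t})"
        by (rule DERIV_chain2[where f = V and g = "\<lambda>\<tau>. X \<tau> k", OF V'(1)]) (auto simp: X_def intro!: derivative_eq_intros)
      then have \<phi>d: "((\<lambda>\<tau>. \<phi> \<tau> k) has_real_derivative \<epsilon> * exp (- A \<tau>) * (- A' * V (X \<tau> k) + V' * (- c'))) (at \<tau> within {s + 1..t})"
        unfolding \<phi>_def A'_def
        by (auto intro!: derivative_eq_intros DERIV_subset[OF A(2)] simp: algebra_simps)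
      have ud: "((\<lambda>\<tau>. u \<tau> k) has_real_derivative dlap (u \<tau>) k + u \<tau> k * f \<tau> (u \<tau> k)) (at \<tau> within {s + 1..t})"
        by (rule lattice_flowD[OF lattice_flow_subset[OF u]]) (use \<tau> in auto)
      have XX: "X \<tau> (k + 1) = X \<tau> k + 1" "X \<tau> (k - 1) = X \<tau> k - 1" by (auto simp: X_def)
      have lap: "dlap (\<phi> \<tau>) k = \<epsilon> * exp (- A \<tau>) * (V (X \<tau> k + 1) - 2 * V (X \<tau> k) + V (X \<tau> k - 1))"
        unfolding dlap_def \<phi>_def XX by (simp add: algebra_simps)
      \<comment> \<open>The weight contributes \<open>- A'\<close>, at most
        \<open>f \<tau> 0 - r\<close>: it exchanges the constant rate \<open>r\<close> of the
        profile for the actual rate \<open>f \<tau> 0\<close>.\<close>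
      have "- A' * V (X \<tau> k) \<le> (f \<tau> 0 - r) * V (X \<tau> k)"
        using A'_ge V(3) by (intro mult_right_mono) auto
      then have "- A' * V (X \<tau> k) + V' * (- c') \<le>
          V (X \<tau> k + 1) - 2 * V (X \<tau> k) + V (X \<tau> k - 1) + (f \<tau> 0 - \<gamma> / 2) * V (X \<tau> k)"
        using V'(2) by (simp add: algebra_simps)
      then have "\<epsilon> * exp (- A \<tau>) * (- A' * V (X \<tau> k) + V' * (- c')) \<le>
          \<epsilon> * exp (- A \<tau>) * (V (X \<tau> k + 1) - 2 * V (X \<tau> k) + V (X \<tau> k - 1) + (f \<tau> 0 - \<gamma> / 2) * V (X \<tau> k))"
        using \<epsilon> by (intro mult_left_mono) auto
      also have "\<dots> = dlap (\<phi> \<tau>) k + (f \<tau> 0 - \<gamma> / 2) * \<phi> \<tau> k"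
        unfolding lap by (simp add: \<phi>_def algebra_simps)
      finally have \<phi>_sub: "\<epsilon> * exp (- A \<tau>) * (- A' * V (X \<tau> k) + V' * (- c')) \<le>
          dlap (\<phi> \<tau>) k + (f \<tau> 0 - \<gamma> / 2) * \<phi> \<tau> k" .
      have "M * u \<tau> k \<le> M * (\<epsilon> * Z)" using neg \<phi>_le[of \<tau> k] M_pos by (intro mult_left_mono) auto
      then have "f \<tau> 0 - \<gamma> / 2 \<le> f \<tau> (u \<tau> k)" using f_ge[OF u0, of \<tau>] \<epsilon>Z by linarith
      then have u_sup: "u \<tau> k * (f \<tau> 0 - \<gamma> / 2) \<le> u \<tau> k * f \<tau> (u \<tau> k)"
        using u0 by (intro mult_left_mono) auto
      have "K * (u \<tau> k - \<phi> \<tau> k) \<le> (f \<tau> 0 - \<gamma> / 2) * (u \<tau> k - \<phi> \<tau> k)"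
        using neg f0_le[of \<tau>] \<gamma> by (intro mult_right_mono_neg) auto
      then have "dlap (\<lambda>k. u \<tau> k - \<phi> \<tau> k) k + K * (u \<tau> k - \<phi> \<tau> k) \<le>
          dlap (u \<tau>) k + u \<tau> k * f \<tau> (u \<tau> k) - \<epsilon> * exp (- A \<tau>) * (- A' * V (X \<tau> k) + V' * (- c'))"
        using \<phi>_sub u_sup by (simp add: dlap_def algebra_simps)
      with DERIV_diff[OF ud \<phi>d]
      show "\<exists>D. ((\<lambda>\<tau>. u \<tau> k - \<phi> \<tau> k) has_real_derivative D) (at \<tau> within {s + 1..t}) \<and>
          dlap (\<lambda>k. u \<tau> k - \<phi> \<tau> k) k + K * (u \<tau> k - \<phi> \<tau> k) \<le> D" by blast
    qed (use st in auto)
    moreover have "t - s - 1 \<noteq> 0" using st by simp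
    then have "X t i = 0" by (simp add: X_def c'_def)
    then have "\<phi> t i = \<epsilon> * exp (- A t)" using V(2) by (simp add: \<phi>_def)
    moreover have "exp (- (K * T)) \<le> exp (- A t)" using A(1)[of t] by (simp add: abs_le_iff)
    then have "\<epsilon> * exp (- (K * T)) \<le> \<epsilon> * exp (- A t)" using \<epsilon> by simp
    ultimately show "\<epsilon> * exp (- (K * T)) \<le> u t i" by linarith
  qed
qed

text \<open>Persistence is invoked at the larger speed \<open>c1\<close>, so that the sites within
  \<open>R2\<close> of a site in the cone of speed \<open>c\<close> have been above
  \<open>\<delta>\<close> throughout the preceding time \<open>T2\<close>, as
  \<open>ratio_lower\<close> requires. \<open>T0\<close> depends on the distance of \<open>j\<close>
  from the origin, so \<open>j\<close> is fixed beforehand.\<close>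

lemma flow_convergence:
  assumes D: "\<And>s t. s \<in> D \<Longrightarrow> s \<le> t \<Longrightarrow> t \<in> D"
    and T: "0 < T" and avg: "\<And>s. s \<in> D \<Longrightarrow> r * T \<le> P (s + T) - P s"
    and c: "0 \<le> c" "c < c1" and \<gamma>: "0 < \<gamma>"
    and gap: "\<And>\<mu>. 0 \<le> \<mu> \<Longrightarrow> \<gamma> \<le> 2 * cosh \<mu> - 2 + r - c1 * \<mu>"
    and \<kappa>: "0 < \<kappa>" and R: "0 < R" and \<epsilon>: "0 < \<epsilon>"
  obtains T0 where
    "\<And>s u t i. s \<in> D \<Longrightarrow> lattice_flow f {s..} u \<Longrightarrow>
       (\<And>t i. s \<le> t \<Longrightarrow> 0 \<le> u t i \<and> u t i \<le> R) \<Longrightarrow> \<kappa> \<le> u s j \<Longrightarrow> T0 \<le> t \<Longrightarrow>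
       \<bar>real_of_int i\<bar> \<le> c * t \<Longrightarrow> \<bar>u (t + s) i - u_plus f (t + s)\<bar> \<le> \<epsilon>"
proof -
  define w where "w = u_plus f"
  obtain \<delta>1 where w: "scalar_flow f UNIV w" and \<delta>1: "0 < \<delta>1" and w_ge: "\<And>t. \<delta>1 \<le> w t"
    and w_le: "\<And>t. w t \<le> K / m"
    using u_plus_flow unfolding w_def by blast
  have c1: "0 \<le> c1" using c by simp
  obtain \<delta>2 where \<delta>2: "0 < \<delta>2" and persist:
    "\<And>s u j t i. s \<in> D \<Longrightarrow> lattice_flow f {s..} u \<Longrightarrow>
       (\<And>t i. s \<le> t \<Longrightarrow> 0 \<le> u t i \<and> u t i \<le> R) \<Longrightarrow> \<kappa> \<le> u s j \<Longrightarrow> s + 1 < t \<Longrightarrow>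
       \<bar>real_of_int (i - j)\<bar> \<le> c1 * (t - s - 1) \<Longrightarrow> \<delta>2 \<le> u t i"
    by (rule flow_persistence[where D = D and T = T and r = r and c = c1 and \<gamma> = \<gamma> and \<kappa> = \<kappa> and R = R];
        use D T avg c1 \<gamma> gap \<kappa> R in blast)
  define \<delta> where "\<delta> = min \<delta>1 \<delta>2"
  have \<delta>: "0 < \<delta>" "\<delta> \<le> \<delta>1" "\<delta> \<le> \<delta>2" using \<delta>1 \<delta>2 by (auto simp: \<delta>_def)
  have Km: "0 < K / m" using K_pos m_pos by simp
  \<comment> \<open>A relative error, made absolute by \<open>w t \<le> K / m\<close>; the cap
    \<open>1 / 2\<close> keeps it below 1 for \<open>ratio_lower\<close>.\<close>
  define \<epsilon>' where "\<epsilon>' = min (1 / 2) (\<epsilon> / (K / m))"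
  have \<epsilon>': "0 < \<epsilon>'" "\<epsilon>' < 1" using divide_pos_pos[OF \<epsilon> Km] by (auto simp: \<epsilon>'_def)
  have "\<epsilon>' \<le> \<epsilon> / (K / m)" unfolding \<epsilon>'_def by (rule min.cobounded2)
  then have \<epsilon>'_le: "\<epsilon>' * (K / m) \<le> \<epsilon>" by (rule iffD1[OF pos_le_divide_eq[OF Km]])
  obtain T1 where T1: "0 < T1"
    "\<And>s u w i. lattice_flow f {s..s + T1} u \<Longrightarrow> scalar_flow f {s..s + T1} w \<Longrightarrow>
       (\<And>t. t \<in> {s..s + T1} \<Longrightarrow> \<delta> \<le> w t) \<Longrightarrow>
       (\<And>t i. t \<in> {s..s + T1} \<Longrightarrow> 0 \<le> u t i \<and> u t i \<le> R) \<Longrightarrow>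
       u (s + T1) i \<le> (1 + \<epsilon>') * w (s + T1)"
    using ratio_upper[OF \<delta>(1) \<epsilon>'(1)] by blast
  obtain T2 R2 where T2: "0 < T2"
    "\<And>s u w j. lattice_flow f {s..s + T2} u \<Longrightarrow> scalar_flow f {s..s + T2} w \<Longrightarrow>
       (\<And>t. t \<in> {s..s + T2} \<Longrightarrow> \<delta> \<le> w t \<and> w t \<le> K / m) \<Longrightarrow>
       (\<And>t i. t \<in> {s..s + T2} \<Longrightarrow> 0 \<le> u t i) \<Longrightarrow>
       (\<And>t i. t \<in> {s..s + T2} \<Longrightarrow> \<bar>real_of_int (i - j)\<bar> \<le> R2 \<Longrightarrow> \<delta> \<le> u t i) \<Longrightarrow>
       (1 - \<epsilon>') * w (s + T2) \<le> u (s + T2) j"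
    using ratio_lower[OF \<delta>(1) Km \<epsilon>'] by blast
  \<comment> \<open>\<open>T2 + 2\<close> starts the stretch after time \<open>s + 1\<close>; from
    the time given by the quotient on, the widened cone of speed \<open>c\<close> fits into the
    delayed cone of speed \<open>c1\<close>.\<close>
  define T0 where "T0 = max T1 (max (T2 + 2) ((R2 + \<bar>real_of_int j\<bar> + c1 * (T2 + 1)) / (c1 - c)))"
  show ?thesis
  proof (rule that[of T0])
    fix s u t i
    assume s: "s \<in> D" and u: "lattice_flow f {s..} u"
      and ub: "\<And>t i. s \<le> t \<Longrightarrow> 0 \<le> u t i \<and> u t i \<le> R"
      and init: "\<kappa> \<le> u s j" and t: "T0 \<le> t" and i: "\<bar>real_of_int i\<bar> \<le> c * t"
    have t': "T1 \<le> t" "T2 + 2 \<le> t" "(R2 + \<bar>real_of_int j\<bar> + c1 * (T2 + 1)) / (c1 - c) \<le> t"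
      using t by (auto simp: T0_def)
    have t3: "R2 + \<bar>real_of_int j\<bar> + c * t \<le> c1 * (t - T2 - 1)"
      using t'(3) c by (simp add: pos_divide_le_eq algebra_simps)
    have "u ((t + s - T1) + T1) i \<le> (1 + \<epsilon>') * w ((t + s - T1) + T1)"
    proof (rule T1(2))
      show "lattice_flow f {t + s - T1..t + s - T1 + T1} u"
        by (rule lattice_flow_subset[OF u]) (use t' in auto)
      show "scalar_flow f {t + s - T1..t + s - T1 + T1} w" by (rule scalar_flow_subset[OF w]) auto
      show "\<delta> \<le> w \<tau>" for \<tau> using w_ge[of \<tau>] \<delta> by simp
      show "0 \<le> u \<tau> k \<and> u \<tau> k \<le> R" if "\<tau> \<in> {t + s - T1..t + s - T1 + T1}" for \<tau> k
        using ub[of \<tau> k] that t' by auto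
    qed
    then have upper: "u (t + s) i \<le> (1 + \<epsilon>') * w (t + s)" by simp
    have "(1 - \<epsilon>') * w ((t + s - T2) + T2) \<le> u ((t + s - T2) + T2) i"
    proof (rule T2(2))
      show "lattice_flow f {t + s - T2..t + s - T2 + T2} u"
        by (rule lattice_flow_subset[OF u]) (use t' in auto)
      show "scalar_flow f {t + s - T2..t + s - T2 + T2} w" by (rule scalar_flow_subset[OF w]) auto
      show "\<delta> \<le> w \<tau> \<and> w \<tau> \<le> K / m" for \<tau> using w_ge[of \<tau>] w_le[of \<tau>] \<delta> by simp
      show "0 \<le> u \<tau> k" if "\<tau> \<in> {t + s - T2..t + s - T2 + T2}" for \<tau> k
        using ub[of \<tau> k] that t' by auto
      fix \<tau> k assume \<tau>: "\<tau> \<in> {t + s - T2..t + s - T2 + T2}" and k: "\<bar>real_of_int (k - i)\<bar> \<le> R2"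
      have "c1 * (t - T2 - 1) \<le> c1 * (\<tau> - s - 1)" using \<tau> c1 by (intro mult_left_mono) auto
      moreover have "\<bar>real_of_int (k - j)\<bar> \<le> \<bar>real_of_int (k - i)\<bar> + \<bar>real_of_int i\<bar> + \<bar>real_of_int j\<bar>"
        by simp
      ultimately have "\<bar>real_of_int (k - j)\<bar> \<le> c1 * (\<tau> - s - 1)" using k i t3 by linarith
      then have "\<delta>2 \<le> u \<tau> k" using \<tau> t' by (intro persist[OF s u ub init]) auto
      then show "\<delta> \<le> u \<tau> k" using \<delta> by simp
    qed
    then have lower: "(1 - \<epsilon>') * w (t + s) \<le> u (t + s) i" by simp
    have "\<epsilon>' * w (t + s) \<le> \<epsilon>' * (K / m)" using w_le \<epsilon>' by (intro mult_left_mono) auto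
    then have "\<epsilon>' * w (t + s) \<le> \<epsilon>" using \<epsilon>'_le by linarith
    then show "\<bar>u (t + s) i - u_plus f (t + s)\<bar> \<le> \<epsilon>"
      using upper lower unfolding w_def[symmetric] abs_le_iff by (simp add: algebra_simps)
  qed
qed

end

section \<open>Spreading speeds\<close>

text \<open>Baire: the closed sets on which \<open>sup\<^sub>t fu t u \<le> - 1 / (n + 1)\<close> cover the interval, so one of
  them contains a subinterval.\<close>
lemma uniform_strict_decrease:
  fixes f fu :: "real \<Rightarrow> real \<Rightarrow> real"
  assumes deriv: "\<And>t u. 0 \<le> u \<Longrightarrow> (f t has_real_derivative fu t u) (at u within {0..})"
    and cont: "\<And>t. continuous_on {0..} (fu t)"
    and neg: "\<And>u. 0 \<le> u \<Longrightarrow> \<exists>\<delta>>0. \<forall>t. fu t u \<le> - \<delta>"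
    and xy: "0 \<le> x" "x < y"
  shows "\<exists>\<eta>>0. \<forall>t. f t y \<le> f t x - \<eta>"
proof -
  define E where "E = (\<lambda>n::nat. {u \<in> {x..y}. \<forall>t. fu t u \<le> - (1 / real (Suc n))})"
  have E_closed: "closed (E n)" for n
  proof -
    have "closed ({x..y} \<inter> fu t -` {..- (1 / real (Suc n))})" for t
      by (rule continuous_closed_preimage[OF continuous_on_subset[OF cont]]) (use xy in auto)
    then have "closed (\<Inter>t. {x..y} \<inter> fu t -` {..- (1 / real (Suc n))})" by blast
    moreover have "(\<Inter>t. {x..y} \<inter> fu t -` {..- (1 / real (Suc n))}) = E n" by (auto simp: E_def)
    ultimately show ?thesis by simp
  qed
  have E_cover: "\<exists>n. u \<in> E n" if u: "u \<in> {x..y}" for u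
  proof -
    obtain \<delta> where \<delta>: "\<delta> > 0" "\<And>t. fu t u \<le> - \<delta>" using neg[of u] u xy by auto
    obtain n where "inverse (real (Suc n)) < \<delta>" using reals_Archimedean[OF \<delta>(1)] by blast
    then have "fu t u \<le> - (1 / real (Suc n))" for t using \<delta>(2)[of t] by (simp add: inverse_eq_divide)
    then show ?thesis using u by (auto simp: E_def)
  qed
  \<comment> \<open>The gaps \<open>\<delta>\<close> may tend to 0 along points of the interval, as
    the continuity of \<open>fu\<close> in \<open>u\<close> is not uniform in \<open>t\<close>. One
    subinterval with a common gap suffices, since \<open>f\<close> is nonincreasing on the
    rest.\<close>
  have "\<exists>n a b. a < b \<and> {a..b} \<subseteq> E n"
  proof (rule ccontr)
    assume "\<nexists>n a b. a < b \<and> {a..b} \<subseteq> E n"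
    then have no: "\<not> {a..b} \<subseteq> E n" if "a < b" for a b n using that by blast
    have "{x..y} \<subseteq> closure (\<Inter>(range (\<lambda>n. {x..y} - E n)))"
    proof (rule Baire)
      fix G assume "G \<in> range (\<lambda>n. {x..y} - E n)"
      then obtain n where G: "G = {x..y} - E n" by blast
      have "openin (top_of_set {x..y}) G"
        unfolding G by (metis E_closed Diff_eq open_Compl openin_open)
      moreover have "{x..y} \<subseteq> closure G"
      proof
        fix p assume p: "p \<in> {x..y}"
        show "p \<in> closure G"
          unfolding closure_approachable
        proof (intro allI impI)
          fix e :: real assume e: "0 < e"
          define a b where "a = max x (p - e / 2)" and "b = min y (p + e / 2)"
          have "a < b" using p e xy by (auto simp: a_def b_def)
          then obtain q where "q \<in> {a..b}" "q \<notin> E n" using no[of a b n] by blast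
          then show "\<exists>q\<in>G. dist q p < e"
            using e by (intro bexI[of _ q]) (auto simp: G a_def b_def dist_real_def abs_less_iff)
        qed
      qed
      ultimately show "openin (top_of_set {x..y}) G \<and> {x..y} \<subseteq> closure G" by blast
    qed auto
    moreover have "\<Inter>(range (\<lambda>n. {x..y} - E n)) = {}" using E_cover by blast
    ultimately have "{x..y} \<subseteq> closure {}" by (simp only:)
    then show False using xy by simp
  qed
  then obtain n a b where ab: "a < b" "{a..b} \<subseteq> E n" by blast
  have ab': "x \<le> a" "b \<le> y" using ab by (auto simp: E_def dest: subsetD[of _ _ a] subsetD[of _ _ b])
  have anti: "f t q \<le> f t p" if pq: "0 \<le> p" "p \<le> q" for t p q
  proof -
    have "- f t p \<le> - f t q"
    proof (rule nondecreasing_if_deriv_nonneg[OF pq(2)])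
      fix u assume u: "u \<in> {p..q}"
      show "((\<lambda>u. - f t u) has_real_derivative - fu t u) (at u within {p..q})"
        using u pq by (intro DERIV_minus DERIV_subset[OF deriv]) auto
      show "0 \<le> - fu t u" using neg[of u] u pq by (smt (verit) atLeastAtMost_iff)
    qed
    then show ?thesis by simp
  qed
  show ?thesis
  proof (intro exI conjI allI)
    show "0 < (b - a) / real (Suc n)" using ab by simp
    fix t
    have "- f t a - a / real (Suc n) \<le> - f t b - b / real (Suc n)"
    proof (rule nondecreasing_if_deriv_nonneg[where h = "\<lambda>u. - f t u - u / real (Suc n)"])
      fix u assume u: "u \<in> {a..b}"
      show "((\<lambda>u. - f t u - u / real (Suc n)) has_real_derivative - fu t u - (1 / real (Suc n))) (at u within {a..b})"
        using u ab' xy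
        by (intro DERIV_diff DERIV_minus DERIV_subset[OF deriv] DERIV_cdivide DERIV_ident) auto
      have "fu t u \<le> - (1 / real (Suc n))" using subsetD[OF ab(2) u] unfolding E_def by blast
      then show "0 \<le> - fu t u - (1 / real (Suc n))" by linarith
    qed (use ab in simp)
    then have "f t b \<le> f t a - (b - a) / real (Suc n)" by (simp add: diff_divide_distrib)
    then show "f t y \<le> f t x - (b - a) / real (Suc n)"
      using anti[OF _ ab'(2), of t] anti[OF xy(1) ab'(1), of t] ab ab' xy by linarith
  qed
qed

text \<open>The speeds require the limit superior to equal 0, so a lower bound is needed as well; it
  fails when the supremum runs over an empty set.\<close>

lemma Limsup_eq_0_real:
  fixes F :: "real \<Rightarrow> ereal"
  assumes "\<forall>\<^sub>F t in at_top. 0 \<le> F t" and "\<And>\<epsilon>. 0 < \<epsilon> \<Longrightarrow> \<forall>\<^sub>F t in at_top. F t \<le> ereal \<epsilon>"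
  shows "Limsup at_top F = 0"
proof (rule antisym)
  show "Limsup at_top F \<le> 0"
  proof (rule ereal_le_epsilon2)
    fix e :: real assume "0 < e"
    then show "Limsup at_top F \<le> 0 + ereal e"
      using assms(2) by (auto intro: Limsup_bounded)
  qed
  show "0 \<le> Limsup at_top F" by (rule le_Limsup) (use assms(1) in auto)
qed

lemma linf0_decay:
  assumes u0: "u0 \<in> linf0" and \<mu>: "0 < \<mu>"
  obtains C where "0 \<le> C" "\<And>i. apply_bcontfun u0 i \<le> C * exp (- \<mu> * \<bar>real_of_int i\<bar>)"
proof -
  obtain N where N: "\<And>i. N < \<bar>i\<bar> \<Longrightarrow> apply_bcontfun u0 i = 0" using u0 by (auto simp: linf0_def)
  show ?thesis
  proof (rule that[of "norm u0 * exp (\<mu> * real_of_int N)"])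
    fix i
    show "apply_bcontfun u0 i \<le> norm u0 * exp (\<mu> * real_of_int N) * exp (- \<mu> * \<bar>real_of_int i\<bar>)"
    proof (cases "N < \<bar>i\<bar>")
      case False
      have "\<mu> * \<bar>real_of_int i\<bar> \<le> \<mu> * real_of_int N" using False \<mu> by (intro mult_left_mono) linarith+
      then have "norm u0 * 1 \<le> norm u0 * exp (\<mu> * real_of_int N - \<mu> * \<bar>real_of_int i\<bar>)"
        by (intro mult_left_mono) auto
      moreover have "apply_bcontfun u0 i \<le> norm u0" using norm_bounded[of u0 i] by simp
      ultimately show ?thesis by (simp add: mult.assoc flip: exp_add)
    qed (use N in auto)
  qed auto
qed

text \<open>Without admissible data every real number would belong to both speed sets, and the lower
  speed would exceed the upper one.\<close>

lemma linf0_nonempty: "linf0 \<noteq> {}"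
proof -
  define g where "g = (\<lambda>i::int. if i = 0 then 1 else (0::real))"
  have "g \<in> bcontfun" by (rule bcontfun_normI[of _ 1]) (auto simp: g_def)
  then obtain v :: linf where v: "apply_bcontfun v = g" using Bcontfun_inverse by blast
  have "v \<noteq> 0"
  proof
    assume "v = 0"
    then have "g 0 = 0" by (simp flip: v)
    then show False by (simp add: g_def)
  qed
  then have "v \<in> linf0" unfolding linf0_def v by (auto simp: g_def v intro!: exI[of _ 0])
  then show ?thesis by blast
qed

text \<open>\<open>S\<close> collects the starting times: \<open>{0}\<close> gives the ordinary
  speeds and \<open>UNIV\<close> the generalized ones, so both chains share one argument.\<close>

definition upper_speeds :: "(real \<Rightarrow> real \<Rightarrow> real) \<Rightarrow> real set \<Rightarrow> real set" where
  "upper_speeds f S = {c. \<forall>u0\<in>linf0. Limsup at_top (\<lambda>t. SUP s\<in>S. SUP i\<in>{i. c * t \<le> real_of_int \<bar>i\<bar>}.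
     ereal (apply_bcontfun (lattice_sol f (t + s) s u0) i)) = 0}"

definition lower_speeds :: "(real \<Rightarrow> real \<Rightarrow> real) \<Rightarrow> real set \<Rightarrow> real set" where
  "lower_speeds f S = {c. \<forall>u0\<in>linf0. Limsup at_top (\<lambda>t. SUP s\<in>S. SUP i\<in>{i. real_of_int \<bar>i\<bar> \<le> c * t}.
     ereal \<bar>apply_bcontfun (lattice_sol f (t + s) s u0) i - u_plus f (t + s)\<bar>) = 0}"

lemma speeds_eq:
  "c_upper f = Inf (ereal ` upper_speeds f {0})" "c_lower f = Sup (ereal ` lower_speeds f {0})"
  "gen_c_upper f = Inf (ereal ` upper_speeds f UNIV)" "gen_c_lower f = Sup (ereal ` lower_speeds f UNIV)"
  by (simp_all add: c_upper_def c_lower_def gen_c_upper_def gen_c_lower_def upper_speeds_def lower_speeds_def)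

section \<open>Estimates of the sets of admissible speeds\<close>

context kpp_reaction
begin

text \<open>For \<open>\<bar>i\<bar> \<ge> c * t\<close> and late \<open>t\<close> the exponent of
  the supersolution is at most \<open>- (d * t)\<close> with
  \<open>d = c * \<mu> - \<Lambda> - r > 0\<close>, uniformly in \<open>s\<close>.\<close>

lemma upper_speedsI:
  assumes \<mu>: "0 < \<mu>" and T: "\<And>s t. s \<in> S \<Longrightarrow> T \<le> t \<Longrightarrow> P (t + s) - P s \<le> r * t"
    and r: "exp (- \<mu>) + exp \<mu> - 2 + r < c * \<mu>" and S: "S \<noteq> {}"
  shows "c \<in> upper_speeds f S"
  unfolding upper_speeds_def
proof (intro CollectI ballI Limsup_eq_0_real)
  fix u0 assume u0: "u0 \<in> linf0"
  have u0_nn: "\<And>i. 0 \<le> apply_bcontfun u0 i" using u0 by (auto simp: linf0_def)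
  obtain C where C: "0 \<le> C" "\<And>i. apply_bcontfun u0 i \<le> C * exp (- \<mu> * \<bar>real_of_int i\<bar>)"
    using linf0_decay[OF u0 \<mu>] by blast
  define \<Lambda> where "\<Lambda> = exp (- \<mu>) + exp \<mu> - 2"
  define d where "d = c * \<mu> - \<Lambda> - r"
  have d: "0 < d" using r by (simp add: d_def \<Lambda>_def)
  have bound: "0 \<le> apply_bcontfun (lattice_sol f (t + s) s u0) i"
    "apply_bcontfun (lattice_sol f (t + s) s u0) i \<le> C * exp (- \<mu> * \<bar>real_of_int i\<bar> + \<Lambda> * t + (P (t + s) - P s))"
    if t: "0 \<le> t" for t s i
  proof -
    obtain u where u: "lattice_flow f {s..} u" "\<And>i. u s i = apply_bcontfun u0 i"
      "\<And>t i. s \<le> t \<Longrightarrow> 0 \<le> u t i" "\<And>t i. s \<le> t \<Longrightarrow> u t i \<le> max M\<^sub>0 (norm u0)"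
      "\<And>t i. s \<le> t \<Longrightarrow> apply_bcontfun (lattice_sol f t s u0) i = u t i"
      using lattice_sol_flow[OF u0_nn] by blast
    have fl: "lattice_flow f {s..t + s} u" by (rule lattice_flow_subset[OF u(1)]) auto
    have key: "u (t + s) i \<le> C * exp (- \<nu> * real_of_int i + (exp (- \<nu>) + exp \<nu> - 2) * (t + s - s) + (P (t + s) - P s))"
      if \<nu>: "\<nu> = \<mu> \<or> \<nu> = - \<mu>" for \<nu>
    proof (rule flow_exponential_bound[OF fl _ C(1)])
      show "u s k \<le> C * exp (- \<nu> * real_of_int k)" for k
      proof -
        have "\<bar>\<nu> * real_of_int k\<bar> = \<mu> * \<bar>real_of_int k\<bar>" using \<nu> \<mu> by (auto simp: abs_mult)
        then have "- \<mu> * \<bar>real_of_int k\<bar> \<le> - \<nu> * real_of_int k"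
          using abs_ge_self[of "\<nu> * real_of_int k"] by linarith
        then have "C * exp (- \<mu> * \<bar>real_of_int k\<bar>) \<le> C * exp (- \<nu> * real_of_int k)"
          using C(1) by (intro mult_left_mono) auto
        then show ?thesis using C(2)[of k] u(2)[of k] by linarith
      qed
    qed (use u t in auto)
    show "0 \<le> apply_bcontfun (lattice_sol f (t + s) s u0) i" using u(3,5)[of "t + s" i] t by simp
    show "apply_bcontfun (lattice_sol f (t + s) s u0) i \<le> C * exp (- \<mu> * \<bar>real_of_int i\<bar> + \<Lambda> * t + (P (t + s) - P s))"
      using key[of \<mu>] key[of "- \<mu>"] u(5)[of "t + s" i] t
      by (cases "0 \<le> i") (auto simp: \<Lambda>_def algebra_simps)
  qed
  show "\<forall>\<^sub>F t in at_top. 0 \<le> (SUP s\<in>S. SUP i\<in>{i. c * t \<le> real_of_int \<bar>i\<bar>}.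
     ereal (apply_bcontfun (lattice_sol f (t + s) s u0) i))"
    using eventually_ge_at_top[of 0]
  proof eventually_elim
    case (elim t)
    obtain s where s: "s \<in> S" using S by blast
    \<comment> \<open>This site is always admissible, also for negative \<open>c\<close>, so the
      supremum is not over an empty set.\<close>
    have "c * t \<le> real_of_int \<bar>\<lceil>c * t\<rceil>\<bar>" by linarith
    then show ?case
      by (intro SUP_upper2[OF s] SUP_upper2[of "\<lceil>c * t\<rceil>"]) (use bound(1)[OF elim] in auto)
  qed
  fix \<epsilon> :: real assume \<epsilon>: "0 < \<epsilon>"
  have "((\<lambda>t. C * exp (- (d * t))) \<longlongrightarrow> C * 0) at_top"
    using d by (intro tendsto_intros filterlim_compose[OF exp_at_bot])
      (auto simp: filterlim_uminus_at_bot intro!: filterlim_tendsto_pos_mult_at_top filterlim_ident)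
  then have "\<forall>\<^sub>F t in at_top. C * exp (- (d * t)) < \<epsilon>" using \<epsilon> by (intro order_tendstoD(2)) auto
  then show "\<forall>\<^sub>F t in at_top. (SUP s\<in>S. SUP i\<in>{i. c * t \<le> real_of_int \<bar>i\<bar>}.
     ereal (apply_bcontfun (lattice_sol f (t + s) s u0) i)) \<le> ereal \<epsilon>"
    using eventually_ge_at_top[of 0] eventually_ge_at_top[of T]
  proof eventually_elim
    case (elim t)
    show ?case
    proof (intro SUP_least, safe)
      fix s i assume s: "s \<in> S" and i: "c * t \<le> real_of_int \<bar>i\<bar>"
      have "\<mu> * (c * t) \<le> \<mu> * \<bar>real_of_int i\<bar>" using i \<mu> by simp
      then have "- \<mu> * \<bar>real_of_int i\<bar> + \<Lambda> * t + (P (t + s) - P s) \<le> - (d * t)"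
        using T[OF s elim(3)] by (simp add: d_def algebra_simps)
      then have "C * exp (- \<mu> * \<bar>real_of_int i\<bar> + \<Lambda> * t + (P (t + s) - P s)) \<le> C * exp (- (d * t))"
        using C(1) by (intro mult_left_mono) auto
      then show "ereal (apply_bcontfun (lattice_sol f (t + s) s u0) i) \<le> ereal \<epsilon>"
        using bound(2)[OF elim(2), of s i] elim(1) by simp
    qed
  qed
qed

text \<open>The infimum is treated one \<open>\<mu>\<close> at a time: a speed \<open>c\<close>
  above the quotient leaves room for a rate \<open>r\<close> strictly between \<open>a\<close> and
  \<open>c * \<mu> - \<Lambda>\<close>.\<close>

lemma upper_speeds_le_speed:
  assumes avg: "\<And>r. a < ereal r \<Longrightarrow> \<exists>T. \<forall>s\<in>S. \<forall>t\<ge>T. P (t + s) - P s \<le> r * t" and S: "S \<noteq> {}"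
  shows "Inf (ereal ` upper_speeds f S) \<le> speed a"
  unfolding speed_def
proof (rule INF_greatest, rule ccontr)
  fix \<mu> :: real assume "\<mu> \<in> {0<..}" and neg: "\<not> Inf (ereal ` upper_speeds f S) \<le> (ereal (exp (- \<mu>) + exp \<mu> - 2) + a) / ereal \<mu>"
  then have \<mu>: "0 < \<mu>" by simp
  define \<Lambda> where "\<Lambda> = exp (- \<mu>) + exp \<mu> - 2"
  obtain c where c: "(ereal \<Lambda> + a) / ereal \<mu> < ereal c" "ereal c < Inf (ereal ` upper_speeds f S)"
    using neg ereal_dense2 by (metis \<Lambda>_def not_le)
  have "a < ereal (c * \<mu> - \<Lambda>)"
    using c(1) \<mu> by (cases a) (auto simp: field_simps)
  then obtain r where r: "a < ereal r" "r < c * \<mu> - \<Lambda>" using ereal_dense2 by (metis ereal_less_eq(3) less_ereal.simps(1))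
  obtain T where "\<forall>s\<in>S. \<forall>t\<ge>T. P (t + s) - P s \<le> r * t" using avg[OF r(1)] by blast
  then have "c \<in> upper_speeds f S"
    using r(2) by (intro upper_speedsI[OF \<mu> _ _ S, of T r]) (auto simp: \<Lambda>_def)
  then have "Inf (ereal ` upper_speeds f S) \<le> ereal c" by (intro Inf_lower) auto
  then show False using c(2) by simp
qed

text \<open>A positive entry of the datum serves as \<open>\<kappa>\<close>, and the time from
  \<open>flow_convergence\<close> is common to all \<open>s\<close> in \<open>S\<close>.
  \<open>S\<close> holds the starting times, \<open>D\<close> the times from which means are
  controlled.\<close>

lemma lower_speedsI:
  assumes D: "\<And>s t. s \<in> D \<Longrightarrow> s \<le> t \<Longrightarrow> t \<in> D" and SD: "S \<subseteq> D" and S: "S \<noteq> {}"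
    and T: "0 < T" and avg: "\<And>s. s \<in> D \<Longrightarrow> r * T \<le> P (s + T) - P s"
    and c: "0 \<le> c" "c < c1" and \<gamma>: "0 < \<gamma>"
    and gap: "\<And>\<mu>. 0 \<le> \<mu> \<Longrightarrow> \<gamma> \<le> 2 * cosh \<mu> - 2 + r - c1 * \<mu>"
  shows "c \<in> lower_speeds f S"
  unfolding lower_speeds_def
proof (intro CollectI ballI Limsup_eq_0_real)
  fix u0 assume u0: "u0 \<in> linf0"
  have u0_nn: "\<And>i. 0 \<le> apply_bcontfun u0 i" using u0 by (auto simp: linf0_def)
  have "\<exists>j. apply_bcontfun u0 j \<noteq> 0"
  proof (rule ccontr)
    assume "\<nexists>j. apply_bcontfun u0 j \<noteq> 0"
    then have "u0 = 0" by (intro bcontfun_eqI) simp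
    then show False using u0 by (simp add: linf0_def)
  qed
  then obtain j where j: "0 < apply_bcontfun u0 j" using u0_nn by (metis less_eq_real_def)
  have R: "0 < max M\<^sub>0 (norm u0)" using M0_pos by simp
  obtain s0 where s0: "s0 \<in> S" using S by blast
  show "\<forall>\<^sub>F t in at_top. 0 \<le> (SUP s\<in>S. SUP i\<in>{i. real_of_int \<bar>i\<bar> \<le> c * t}.
     ereal \<bar>apply_bcontfun (lattice_sol f (t + s) s u0) i - u_plus f (t + s)\<bar>)"
    using eventually_ge_at_top[of 0]
    by eventually_elim (intro SUP_upper2[OF s0] SUP_upper2[of 0]; use c in simp)
  fix \<epsilon> :: real assume \<epsilon>: "0 < \<epsilon>"
  obtain T0 where T0: "\<And>s u t i. s \<in> D \<Longrightarrow> lattice_flow f {s..} u \<Longrightarrow>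
       (\<And>t i. s \<le> t \<Longrightarrow> 0 \<le> u t i \<and> u t i \<le> max M\<^sub>0 (norm u0)) \<Longrightarrow> apply_bcontfun u0 j \<le> u s j \<Longrightarrow> T0 \<le> t \<Longrightarrow>
       \<bar>real_of_int i\<bar> \<le> c * t \<Longrightarrow> \<bar>u (t + s) i - u_plus f (t + s)\<bar> \<le> \<epsilon>"
    by (rule flow_convergence[where D = D and T = T and r = r and c = c and ?c1.0 = c1 and \<gamma> = \<gamma> and
          \<kappa> = "apply_bcontfun u0 j" and R = "max M\<^sub>0 (norm u0)" and \<epsilon> = \<epsilon> and j = j];
        use D T avg c \<gamma> gap j R \<epsilon> in blast)
  show "\<forall>\<^sub>F t in at_top. (SUP s\<in>S. SUP i\<in>{i. real_of_int \<bar>i\<bar> \<le> c * t}.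
     ereal \<bar>apply_bcontfun (lattice_sol f (t + s) s u0) i - u_plus f (t + s)\<bar>) \<le> ereal \<epsilon>"
    using eventually_ge_at_top[of T0] eventually_ge_at_top[of 0]
  proof eventually_elim
    case (elim t)
    show ?case
    proof (intro SUP_least, safe)
      fix s i assume s: "s \<in> S" and i: "real_of_int \<bar>i\<bar> \<le> c * t"
      obtain u where u: "lattice_flow f {s..} u" "\<And>i. u s i = apply_bcontfun u0 i"
        "\<And>t i. s \<le> t \<Longrightarrow> 0 \<le> u t i" "\<And>t i. s \<le> t \<Longrightarrow> u t i \<le> max M\<^sub>0 (norm u0)"
        "\<And>t i. s \<le> t \<Longrightarrow> apply_bcontfun (lattice_sol f t s u0) i = u t i"
        using lattice_sol_flow[OF u0_nn] by blast
      have "\<bar>u (t + s) i - u_plus f (t + s)\<bar> \<le> \<epsilon>"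
        by (rule T0[OF _ u(1)]) (use s SD u i elim in auto)
      then show "ereal \<bar>apply_bcontfun (lattice_sol f (t + s) s u0) i - u_plus f (t + s)\<bar> \<le> ereal \<epsilon>"
        using u(5)[of "t + s" i] elim by simp
    qed
  qed
qed

text \<open>The linear estimate needs a margin \<open>\<gamma>\<close> uniform in
  \<open>\<mu>\<close>. Lowering the speed from \<open>c2\<close> to \<open>c1\<close> gains
  \<open>(c2 - c1) * \<mu>\<close>, which degenerates at \<open>\<mu> = 0\<close>; there the
  positive mean \<open>a'\<close> provides the margin.\<close>

lemma speed_le_lower_speeds:
  assumes D: "\<And>s t. s \<in> D \<Longrightarrow> s \<le> t \<Longrightarrow> t \<in> D" and SD: "S \<subseteq> D" and S: "S \<noteq> {}"
    and avg: "\<And>r. ereal r < a \<Longrightarrow> \<exists>T>0. \<forall>s\<in>D. r * T \<le> P (s + T) - P s" and a: "0 < a"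
  shows "speed a \<le> Sup (ereal ` lower_speeds f S)"
proof (rule ccontr)
  assume neg: "\<not> speed a \<le> Sup (ereal ` lower_speeds f S)"
  obtain s0 where s0: "s0 \<in> D" using S SD by blast
  have r_le: "r \<le> K" if r: "ereal r < a" for r
  proof -
    obtain T where T: "0 < T" "r * T \<le> P (s0 + T) - P s0" using avg[OF r] s0 by blast
    have "\<bar>P (s0 + T) - P s0\<bar> \<le> K * \<bar>s0 + T - s0\<bar>"
      using field_differentiable_bound[of UNIV P "\<lambda>t. f t 0" K "s0 + T" s0] P_deriv f0_le by auto
    then have "\<bar>P (s0 + T) - P s0\<bar> \<le> K * T" using T by simp
    then have "r * T \<le> K * T" using T by linarith
    then show ?thesis using T by simp
  qed
  then have "a \<noteq> \<infinity>" using r_le[of "K + 1"] by auto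
  then obtain a' where a': "a = ereal a'" "0 < a'" using a by (cases a) auto
  have sp: "speed a = (INF \<mu>\<in>{0<..}. ereal ((2 * cosh \<mu> - 2 + a') / \<mu>))"
    unfolding speed_def a' by (intro INF_cong) (auto simp: cosh_def)
  have cosh_ge: "0 \<le> 2 * cosh \<mu> - 2" for \<mu> :: real using cosh_real_ge_1[of \<mu>] by simp
  \<comment> \<open>Positivity of \<open>speed a\<close> allows replacing a negative
    \<open>z\<close> by 0, as \<open>lower_speedsI\<close> asks for \<open>c \<ge> 0\<close>. The
    values \<open>a' / 2\<close> and \<open>1 / 2\<close> serve \<open>\<mu> \<le> 2\<close> and
    \<open>\<mu> > 2\<close>.\<close>
  define c0 where "c0 = min (1 / 2) (a' / 2)"
  have c0: "0 < c0" using a' by (simp add: c0_def)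
  have "ereal c0 \<le> speed a"
    unfolding sp
  proof (intro INF_greatest, simp)
    fix \<mu> :: real assume \<mu>: "0 < \<mu>"
    show "c0 \<le> (2 * cosh \<mu> - 2 + a') / \<mu>"
    proof (cases "\<mu> \<le> 2")
      case True
      have "c0 * \<mu> \<le> a' / 2 * \<mu>" using \<mu> by (intro mult_right_mono) (auto simp: c0_def)
      also have "\<dots> \<le> a' / 2 * 2" using True a' by (intro mult_left_mono) auto
      also have "\<dots> \<le> 2 * cosh \<mu> - 2 + a'" using cosh_ge[of \<mu>] by simp
      finally show ?thesis using \<mu> by (simp add: pos_le_divide_eq)
    next
      case False
      have "1 + \<mu> \<le> exp \<mu>" by (rule exp_ge_add_one_self)
      moreover have "2 * cosh \<mu> = exp \<mu> + exp (- \<mu>)" by (simp add: cosh_def)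
      moreover have "c0 * \<mu> \<le> 1 / 2 * \<mu>" using \<mu> by (intro mult_right_mono) (auto simp: c0_def)
      ultimately have "c0 * \<mu> \<le> 2 * cosh \<mu> - 2 + a'" using False a' exp_gt_zero[of "- \<mu>"] by linarith
      then show ?thesis using \<mu> by (simp add: pos_le_divide_eq)
    qed
  qed
  then have pos: "0 < speed a" using c0 by (metis ereal_less(2) less_le_trans)
  obtain z where z: "Sup (ereal ` lower_speeds f S) < ereal z" "ereal z < speed a"
    using neg ereal_dense2 by (metis not_le)
  define c where "c = max z 0"
  have c: "0 \<le> c" "z \<le> c" "ereal c < speed a" using z pos by (auto simp: c_def max_def zero_ereal_def)
  obtain c2 where c2: "c < c2" "ereal c2 < speed a" using ereal_dense2[OF c(3)] by auto
  define c1 where "c1 = (c + c2) / 2"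
  have c1: "c < c1" "c1 < c2" "0 < c1" using c2 c by (auto simp: c1_def)
  have disp: "c2 * \<mu> \<le> 2 * cosh \<mu> - 2 + a'" if "0 < \<mu>" for \<mu>
  proof -
    have "speed a \<le> ereal ((2 * cosh \<mu> - 2 + a') / \<mu>)" unfolding sp using that by (intro INF_lower) auto
    then have "c2 \<le> (2 * cosh \<mu> - 2 + a') / \<mu>" using c2(2) by (metis ereal_less_eq(3) less_imp_le order_trans)
    then show ?thesis using that by (simp add: pos_le_divide_eq)
  qed
  \<comment> \<open>After halving, one \<open>\<gamma>\<close> pays for lowering the mean to
    \<open>a' - \<gamma>\<close> and one is the margin. At the threshold
    \<open>\<mu> = a' / (2 * c1)\<close> the term \<open>c1 * \<mu>\<close> reaches
    \<open>a' / 2\<close>.\<close>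
  define \<gamma> where "\<gamma> = min (a' / 2) ((c2 - c1) * (a' / (2 * c1))) / 2"
  have \<gamma>: "0 < \<gamma>" using a' c1 by (simp add: \<gamma>_def)
  have \<gamma>_le: "2 * \<gamma> \<le> a' / 2" "2 * \<gamma> \<le> (c2 - c1) * (a' / (2 * c1))" by (auto simp: \<gamma>_def)
  have gap: "\<gamma> \<le> 2 * cosh \<mu> - 2 + (a' - \<gamma>) - c1 * \<mu>" if \<mu>: "0 \<le> \<mu>" for \<mu>
  proof (cases "\<mu> \<le> a' / (2 * c1)")
    case True
    then have "c1 * \<mu> \<le> a' / 2" using c1 by (simp add: field_simps)
    then show ?thesis using cosh_ge[of \<mu>] \<gamma>_le(1) by linarith
  next
    case False
    then have "0 < \<mu>" using a' c1 by (smt (verit) divide_pos_pos)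
    moreover have "(c2 - c1) * (a' / (2 * c1)) \<le> (c2 - c1) * \<mu>"
      using False c1 by (intro mult_left_mono) auto
    ultimately show ?thesis using disp[of \<mu>] \<gamma>_le(2) by (simp add: algebra_simps)
  qed
  obtain T where T: "0 < T" "\<And>s. s \<in> D \<Longrightarrow> (a' - \<gamma>) * T \<le> P (s + T) - P s"
    using avg[of "a' - \<gamma>"] \<gamma> by (auto simp: a')
  have "c \<in> lower_speeds f S" by (rule lower_speedsI[OF D SD S T c(1) c1(1) \<gamma> gap])
  then have "ereal c \<le> Sup (ereal ` lower_speeds f S)" by (intro Sup_upper) auto
  also have "\<dots> < ereal c" using z(1) c(2) by (metis ereal_less_eq(3) less_le_trans)
  finally show False by simp
qed

text \<open>If \<open>c' < c\<close>, then for late \<open>t\<close> some site satisfies both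
  constraints; there the solution would be within \<open>\<delta> / 2\<close> of
  \<open>u_plus f\<close>, which is at least \<open>\<delta>\<close>, and also below
  \<open>\<delta> / 2\<close>.\<close>

lemma lower_speeds_le_upper_speeds:
  assumes S: "S \<noteq> {}"
  shows "Sup (ereal ` lower_speeds f S) \<le> Inf (ereal ` upper_speeds f S)"
proof (intro Sup_least Inf_greatest, clarify)
  fix c c' assume c: "c \<in> lower_speeds f S" and c': "c' \<in> upper_speeds f S"
  show "ereal c \<le> ereal c'"
  proof (rule ccontr)
    assume "\<not> ereal c \<le> ereal c'"
    then have less: "c' < c" by simp
    obtain u0 where u0: "u0 \<in> linf0" using linf0_nonempty by blast
    define F where "F = (\<lambda>t. SUP s\<in>S. SUP i\<in>{i. real_of_int \<bar>i\<bar> \<le> c * t}.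
       ereal \<bar>apply_bcontfun (lattice_sol f (t + s) s u0) i - u_plus f (t + s)\<bar>)"
    define G where "G = (\<lambda>t. SUP s\<in>S. SUP i\<in>{i. c' * t \<le> real_of_int \<bar>i\<bar>}.
       ereal (apply_bcontfun (lattice_sol f (t + s) s u0) i))"
    have F0: "Limsup at_top F = 0" and G0: "Limsup at_top G = 0"
      using c c' u0 by (auto simp: lower_speeds_def upper_speeds_def F_def G_def)
    \<comment> \<open>A negative \<open>c\<close> would empty the index set and make the limit
      superior \<open>- \<infinity>\<close> instead of 0.\<close>
    have c_nn: "0 \<le> c"
    proof (rule ccontr)
      assume "\<not> 0 \<le> c"
      have "\<forall>\<^sub>F t in at_top. F t \<le> - \<infinity>"
        using eventually_gt_at_top[of 0]
      proof eventually_elim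
        case (elim t)
        then have "c * t < 0" using \<open>\<not> 0 \<le> c\<close> by (simp add: mult_neg_pos)
        then have "{i. real_of_int \<bar>i\<bar> \<le> c * t} = {}" by auto
        then show ?case by (simp add: F_def bot_ereal_def S)
      qed
      then have "Limsup at_top F \<le> - \<infinity>" by (rule Limsup_bounded)
      then show False using F0 by simp
    qed
    obtain \<delta> where \<delta>: "0 < \<delta>" "\<And>t. \<delta> \<le> u_plus f t" using u_plus_flow by metis
    have "\<forall>\<^sub>F t in at_top. F t < ereal (\<delta> / 2)" "\<forall>\<^sub>F t in at_top. G t < ereal (\<delta> / 2)"
      using \<delta> by (auto intro!: Limsup_lessD simp: F0 G0)
    moreover have "\<forall>\<^sub>F t in at_top. 1 / (c - c') \<le> t" by (rule eventually_ge_at_top)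
    ultimately have "\<forall>\<^sub>F t in at_top. F t < ereal (\<delta> / 2) \<and> G t < ereal (\<delta> / 2) \<and> 1 / (c - c') \<le> t"
      by eventually_elim blast
    then obtain t where t: "F t < ereal (\<delta> / 2)" "G t < ereal (\<delta> / 2)" "1 / (c - c') \<le> t"
      using eventually_happens'[OF trivial_limit_at_top_linorder] by blast
    have t0: "0 < t" using t(3) less by (smt (verit) divide_pos_pos)
    have ct: "c' * t \<le> c * t - 1" using t(3) less by (simp add: pos_divide_le_eq algebra_simps)
    \<comment> \<open>\<open>t \<ge> 1 / (c - c')\<close> separates \<open>c' * t\<close> and
      \<open>c * t\<close> by at least 1, so this integer lies between them.\<close>
    define i where "i = \<lfloor>c * t\<rfloor>"
    have "0 \<le> i" using c_nn t0 by (simp add: i_def)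
    then have i: "real_of_int \<bar>i\<bar> \<le> c * t" "c' * t \<le> real_of_int \<bar>i\<bar>"
      using ct by (auto simp: i_def) linarith
    obtain s where s: "s \<in> S" using S by blast
    define v where "v = apply_bcontfun (lattice_sol f (t + s) s u0) i"
    have "ereal \<bar>v - u_plus f (t + s)\<bar> \<le> F t"
      unfolding F_def v_def by (intro SUP_upper2[OF s] SUP_upper2[of i]) (use i in auto)
    moreover have "ereal v \<le> G t"
      unfolding G_def v_def by (intro SUP_upper2[OF s] SUP_upper2[of i]) (use i in auto)
    ultimately have "\<bar>v - u_plus f (t + s)\<bar> < \<delta> / 2" "v < \<delta> / 2"
      using t(1,2) by (metis le_less_trans less_ereal.simps(1))+
    then show False using \<delta>(2)[of "t + s"] by linarith
  qed
qed

end

section \<open>From the KPP assumptions to the locale, and the two chains of inequalities\<close>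

lemma KPP_imp_kpp_reaction:
  assumes "KPP f"
  obtains P K M\<^sub>0 m M where "kpp_reaction f P K M\<^sub>0 m M"
    "\<And>s t. s < t \<Longrightarrow> mean_value f s t = (P t - P s) / (t - s)"
proof -
  obtain fu where a: "KPP_a f fu" and b: "KPP_b f fu" and c: "KPP_c f"
    using assms by (auto simp: KPP_def)
  have deriv: "(f t has_real_derivative fu t u) (at u within {0..})" if "0 \<le> u" for t u
    using a that unfolding KPP_a_def by blast
  have fu_cont: "continuous_on {0..} (fu t)" for t
    using a unfolding KPP_a_def by blast
  have fu_neg: "\<exists>\<delta>>0. \<forall>t. fu t u \<le> - \<delta>" if "0 \<le> u" for u
    using b that unfolding KPP_b_def by blast
  have cont: "continuous_on UNIV (\<lambda>t. f t u)" for u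
    unfolding continuous_on_def
  proof
    fix t :: real
    obtain C \<alpha> where C: "0 < \<alpha>" "\<And>s \<tau>. s \<in> {t - 1..t + 1} \<Longrightarrow> \<tau> \<in> {t - 1..t + 1} \<Longrightarrow>
        \<bar>f \<tau> u - f s u\<bar> \<le> C * \<bar>\<tau> - s\<bar> powr \<alpha>"
      using a unfolding KPP_a_def by meson
    have lim: "((\<lambda>\<tau>. C * \<bar>\<tau> - t\<bar> powr \<alpha>) \<longlongrightarrow> C * 0) (at t)"
      using C(1) by (intro tendsto_intros tendsto_zero_powrI[where b = \<alpha>])
        (auto intro!: tendsto_eq_intros always_eventually)
    have "\<forall>\<^sub>F \<tau> in at t. norm (f \<tau> u - f t u) \<le> C * \<bar>\<tau> - t\<bar> powr \<alpha>"
      unfolding eventually_at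
    proof (intro exI[of _ 1] conjI ballI impI)
      fix \<tau> :: real assume "\<tau> \<noteq> t \<and> dist \<tau> t < 1"
      then have "\<tau> \<in> {t - 1..t + 1}" by (simp add: dist_real_def abs_less_iff)
      then show "norm (f \<tau> u - f t u) \<le> C * \<bar>\<tau> - t\<bar> powr \<alpha>" using C(2)[of t \<tau>] by simp
    qed simp
    then have "((\<lambda>\<tau>. f \<tau> u - f t u) \<longlongrightarrow> 0) (at t)"
      by (rule Lim_null_comparison) (use lim in simp)
    then show "((\<lambda>\<tau>. f \<tau> u) \<longlongrightarrow> f t u) (at t)" by (simp add: LIM_zero_iff)
  qed
  obtain P where P: "\<And>t. (P has_real_derivative f t 0) (at t)"
    by (rule continuous_has_antiderivative[OF cont[of 0]]) blast
  have mv: "mean_value f s t = (P t - P s) / (t - s)" if "s < t" for s t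
  proof -
    have "((\<lambda>\<tau>. f \<tau> 0) has_integral P t - P s) {s..t}"
    proof (rule fundamental_theorem_of_calculus)
      show "(P has_vector_derivative f \<tau> 0) (at \<tau> within {s..t})" for \<tau>
        unfolding has_real_derivative_iff_has_vector_derivative[symmetric]
        by (rule DERIV_subset[OF P]) simp
    qed (use that in simp)
    then show ?thesis by (simp add: mean_value_def integral_unique)
  qed
  have "bounded (range (\<lambda>t. f t 0))" using b unfolding KPP_b_def by blast
  then obtain K0 where "\<And>t. \<bar>f t 0\<bar> \<le> K0" unfolding bounded_iff real_norm_def by blast
  then have K: "0 < max K0 1" "\<And>t. \<bar>f t 0\<bar> \<le> max K0 1" by (auto simp: le_max_iff_disj)
  obtain M\<^sub>0 where M0: "0 < M\<^sub>0" "\<And>t u. M\<^sub>0 \<le> u \<Longrightarrow> f t u < 0" using b unfolding KPP_b_def by blast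
  obtain m M where mM: "0 < m" "m < M" "\<And>t u. 0 \<le> u \<Longrightarrow> f t 0 - M * u \<le> f t u \<and> f t u \<le> f t 0 - m * u"
    using c unfolding KPP_c_def by blast
  have "0 < f_inf f" using b unfolding KPP_b_def by blast
  then obtain r where r: "0 < ereal r" "ereal r < f_inf f" using ereal_dense2 by blast
  have "\<forall>\<^sub>F p in gap_filter. ereal r < (case p of (s, t) \<Rightarrow> ereal (mean_value f s t))"
    by (rule less_LiminfD) (use r in \<open>simp add: f_inf_def\<close>)
  then obtain T where T: "\<And>s t. T \<le> t - s \<Longrightarrow> r < mean_value f s t"
    unfolding gap_filter_def eventually_filtercomap_at_top_linorder by auto
  have "kpp_reaction f P (max K0 1) M\<^sub>0 m M"
  proof
    show "continuous_on UNIV (\<lambda>t. f t u)" for u by (rule cont)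
    show "\<exists>L. \<forall>t\<in>{a..b}. L-lipschitz_on UNIV (f t)" for a b using a unfolding KPP_a_def by blast
    show "\<exists>\<eta>>0. \<forall>t. f t y \<le> f t x - \<eta>" if "0 \<le> x" "x < y" for x y
      by (rule uniform_strict_decrease[OF deriv fu_cont fu_neg that])
    have "r * (t - s) \<le> P t - P s" if "max T 1 \<le> t - s" for s t
      using T[where s = s and t = t] mv[of s t] that by (auto simp: pos_less_divide_eq)
    then show "\<exists>r>0. \<exists>T>0. \<forall>s t. T \<le> t - s \<longrightarrow> r * (t - s) \<le> P t - P s"
      using r by (intro exI[of _ r] conjI exI[of _ "max T 1"]) auto
    show "0 < M" using mM(1,2) by (rule less_trans)
    show "(P has_real_derivative f t 0) (at t)" for t by (rule P)
  qed (use K M0 mM in \<open>simp_all only:\<close>)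
  then show ?thesis using that mv by blast
qed

theorem theorem1p2:
  fixes f :: "real \<Rightarrow> real \<Rightarrow> real"
  assumes "KPP f"
  shows "(speed (f_inf_pos f) \<le> c_lower f \<and> c_lower f \<le> c_upper f \<and>
            c_upper f \<le> speed (f_sup_pos f)) \<and>
         (speed (f_inf f) \<le> gen_c_lower f \<and> gen_c_lower f \<le> gen_c_upper f \<and>
            gen_c_upper f \<le> speed (f_sup f))"
proof -
  obtain P K M\<^sub>0 m M where "kpp_reaction f P K M\<^sub>0 m M"
    and mv: "\<And>s t. s < t \<Longrightarrow> mean_value f s t = (P t - P s) / (t - s)"
    using KPP_imp_kpp_reaction[OF assms] by blast
  then interpret kpp_reaction f P K M\<^sub>0 m M by simp
  have ev: "eventually Q gap_filter \<longleftrightarrow> (\<exists>T. \<forall>s t. T \<le> t - s \<longrightarrow> Q (s, t))" for Q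
    unfolding gap_filter_def eventually_filtercomap_at_top_linorder by auto
  have ev_pos: "eventually Q gap_filter_pos \<longleftrightarrow> (\<exists>T. \<forall>s t. T \<le> t - s \<longrightarrow> 0 \<le> s \<longrightarrow> Q (s, t))" for Q
    unfolding gap_filter_pos_def eventually_inf_principal ev by auto
  have mean_ge: "r * (t - s) \<le> P t - P s" if "s < t" "r < mean_value f s t" for r s t
    using mv[OF that(1)] that by (simp add: pos_less_divide_eq)
  have mean_le: "P t - P s \<le> r * (t - s)" if "s < t" "mean_value f s t < r" for r s t
    using mv[OF that(1)] that by (simp add: pos_divide_less_eq)
  \<comment> \<open>A strict bound below the least mean becomes a bound over windows of one fixed
    length, the form that averaging uses.\<close>
  have inf_avg: "\<exists>T>0. \<forall>s\<in>UNIV. r * T \<le> P (s + T) - P s" if r: "ereal r < f_inf f" for r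
  proof -
    obtain T where T: "\<And>s t. T \<le> t - s \<Longrightarrow> r < mean_value f s t"
      using less_LiminfD[OF r[unfolded f_inf_def]] unfolding ev by auto
    show ?thesis
    proof (intro exI[of _ "max T 1"] conjI ballI)
      fix s :: real assume "s \<in> UNIV"
      then have "r < mean_value f s (s + max T 1)" by (intro T) auto
      then show "r * max T 1 \<le> P (s + max T 1) - P s" using mean_ge[of s "s + max T 1" r] by simp
    qed simp
  qed
  have inf_pos_avg: "\<exists>T>0. \<forall>s\<in>{0..}. r * T \<le> P (s + T) - P s" if r: "ereal r < f_inf_pos f" for r
  proof -
    obtain T where T: "\<And>s t. T \<le> t - s \<Longrightarrow> 0 \<le> s \<Longrightarrow> r < mean_value f s t"
      using less_LiminfD[OF r[unfolded f_inf_pos_def]] unfolding ev_pos by auto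
    show ?thesis
    proof (intro exI[of _ "max T 1"] conjI ballI)
      fix s :: real assume "s \<in> {0..}"
      then have "r < mean_value f s (s + max T 1)" by (intro T) auto
      then show "r * max T 1 \<le> P (s + max T 1) - P s" using mean_ge[of s "s + max T 1" r] by simp
    qed simp
  qed
  have sup_avg: "\<exists>T. \<forall>s\<in>UNIV. \<forall>t\<ge>T. P (t + s) - P s \<le> r * t" if r: "f_sup f < ereal r" for r
  proof -
    obtain T where T: "\<And>s t. T \<le> t - s \<Longrightarrow> mean_value f s t < r"
      using Limsup_lessD[OF r[unfolded f_sup_def]] unfolding ev by auto
    show ?thesis
    proof (intro exI[of _ "max T 1"] ballI allI impI)
      fix s t :: real assume "s \<in> UNIV" and t: "max T 1 \<le> t"
      then have "mean_value f s (t + s) < r" by (intro T) auto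
      then show "P (t + s) - P s \<le> r * t" using mean_le[of s "t + s" r] t by simp
    qed
  qed
  have sup_pos_avg: "\<exists>T. \<forall>s\<in>{0}. \<forall>t\<ge>T. P (t + s) - P s \<le> r * t" if r: "f_sup_pos f < ereal r" for r
  proof -
    obtain T where T: "\<And>s t. T \<le> t - s \<Longrightarrow> 0 \<le> s \<Longrightarrow> mean_value f s t < r"
      using Limsup_lessD[OF r[unfolded f_sup_pos_def]] unfolding ev_pos by auto
    show ?thesis
    proof (intro exI[of _ "max T 1"] ballI allI impI)
      fix s t :: real assume "s \<in> {0}" and t: "max T 1 \<le> t"
      then have "mean_value f s (t + s) < r" by (intro T) auto
      then show "P (t + s) - P s \<le> r * t" using mean_le[of s "t + s" r] t by simp
    qed
  qed
  have inf0: "0 < f_inf f" using assms by (auto simp: KPP_def KPP_b_def)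
  have inf_pos0: "0 < f_inf_pos f"
  proof -
    obtain r where r: "0 < ereal r" "ereal r < f_inf f" using ereal_dense2[OF inf0] by blast
    \<comment> \<open>Restricting to \<open>s \<ge> 0\<close> gives a finer filter, so the least
      mean can only increase and stays positive.\<close>
    have "eventually Q gap_filter_pos" if "eventually Q gap_filter" for Q
      using that unfolding ev ev_pos by blast
    from this[OF less_LiminfD[OF r(2)[unfolded f_inf_def]]]
    have "ereal r \<le> f_inf_pos f"
      unfolding f_inf_pos_def by (intro Liminf_bounded) (auto elim: eventually_mono)
    then show ?thesis using r(1) by (rule less_le_trans[rotated])
  qed
  show ?thesis
    unfolding speeds_eq
  proof (intro conjI)
    \<comment> \<open>Solutions start at 0 only; \<open>{0..}\<close> is the smallest set containing
      0 that is closed under later times.\<close>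
    show "speed (f_inf_pos f) \<le> Sup (ereal ` lower_speeds f {0})"
      by (rule speed_le_lower_speeds[of "{0..}", OF _ _ _ inf_pos_avg inf_pos0]) auto
    show "speed (f_inf f) \<le> Sup (ereal ` lower_speeds f UNIV)"
      by (rule speed_le_lower_speeds[of UNIV, OF _ _ _ inf_avg inf0]) auto
    show "Sup (ereal ` lower_speeds f {0}) \<le> Inf (ereal ` upper_speeds f {0})"
      "Sup (ereal ` lower_speeds f UNIV) \<le> Inf (ereal ` upper_speeds f UNIV)"
      by (rule lower_speeds_le_upper_speeds; simp)+
    show "Inf (ereal ` upper_speeds f {0}) \<le> speed (f_sup_pos f)"
      by (rule upper_speeds_le_speed[OF sup_pos_avg]) auto
    show "Inf (ereal ` upper_speeds f UNIV) \<le> speed (f_sup f)"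
      by (rule upper_speeds_le_speed[OF sup_avg]) auto
  qed
qed

end
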